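(* Let $1\le r\le\infty$, $k\in\mathbb N$ with $k<d$, and let $Q_0\subset\mathbb R^d$ be a cube. There are positive constants $C_0,C_1$, independent of $f$ and $\varepsilon$, such that, as $\varepsilon\to0+$ (i.e. for all sufficiently small $\varepsilon>0$), $$\|f^{\#}\|_{L_{d/\varepsilon,r}(\mathbb R^d)}\le C_0\,\varepsilon^{-1/r}\|f\|_{\dot W^kL_{d/(k+\varepsilon),r}(\mathbb R^d)}$$ and $$\|f^{\#}_{Q_0}\|_{L_{d/\varepsilon,r}(Q_0)}\le C_1\,\varepsilon^{-1/r}\|f\|_{W^kL_{d/(k+\varepsilon),r}(Q_0)}.$$
   Context: Cubes have sides parallel to the axes; Lebesgue measure $|\cdot|_d$ is used. $f^*(t)=\inf\{\lambda\ge0:|\{|f|>\lambda\}|_d\le t\}$. $f^{\#}(x)=\sup_{Q\ni x}\frac1{|Q|_d}\int_Q|f-f_Q|$, $f_Q=\frac1{|Q|_d}\int_Qf$; $f^{\#}_{Q_0}$ is defined for $x\in Q_0$ likewise with cubes $Q\subset Q_0$ containing $x$. $\|g\|_{L_{p,r}(\mathbb R^d)}=\big(\int_0^\infty(t^{1/p}g^*(t))^r\frac{dt}t\big)^{1/r}$ (supremum if $r=\infty$); on $Q_0$ the integral is over $(0,1)$. $|\nabla^mf|=\big(\sum_{|\alpha|_1=m}|D^\alpha f|^2\big)^{1/2}$. $\dot W^kL_{p,r}(\mathbb R^d)$ is the completion of $C_0^\infty(\mathbb R^d)$ with respect to $\|f\|_{\dot W^kL_{p,r}(\mathbb R^d)}=\|\,|\nabla^kf|\,\|_{L_{p,r}(\mathbb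 R^d)}$; $W^kL_{p,r}(Q_0)$ consists of $k$-times weakly differentiable $f$ on $Q_0$ with $\|f\|_{W^kL_{p,r}(Q_0)}=\sum_{m=0}^k\|\,|\nabla^mf|\,\|_{L_{p,r}(Q_0)}<\infty$. *)

theory Defs
  imports "HOL-Analysis.Analysis"
begin

text \<open>
  The dimension is \<open>d = CARD('d)\<close>. Functions take values in a type of sort
  \<open>{real_normed_field, euclidean_space}\<close>, that is, in the real or the complex numbers.
\<close>

section \<open>Classical derivatives and test functions\<close>

definition partial_deriv ::
  "'d::finite \<Rightarrow> (real ^ 'd \<Rightarrow> 'b::real_normed_vector) \<Rightarrow> real ^ 'd \<Rightarrow> 'b" where
  "partial_deriv i f x = frechet_derivative f (at x) (axis i 1)"

text \<open>Iterated partial derivative, applied in the order given by the list (last entry first).\<close>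

definition iter_partial ::
  "'d::finite list \<Rightarrow> (real ^ 'd \<Rightarrow> 'b::real_normed_vector) \<Rightarrow> real ^ 'd \<Rightarrow> 'b" where
  "iter_partial js f = foldr partial_deriv js f"

definition test_fun ::
  "(real ^ 'd::finite) set \<Rightarrow> (real ^ 'd \<Rightarrow> 'b::real_normed_vector) set" where
  "test_fun U = {\<phi>. (\<forall>js x. iter_partial js \<phi> differentiable (at x)) \<and>
                    compact (closure {x. \<phi> x \<noteq> 0}) \<and> closure {x. \<phi> x \<noteq> 0} \<subseteq> U}"

definition multi_abs :: "('d::finite \<Rightarrow> nat) \<Rightarrow> nat" where
  "multi_abs \<alpha> = (\<Sum>i\<in>UNIV. \<alpha> i)"

text \<open>
  \<open>D\<^sup>\<alpha> f\<close> differentiates \<open>\<alpha> i\<close> times in direction \<open>i\<close>. It is only used for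
  smooth functions, for which the order of differentiation (the chosen list) is irrelevant.
\<close>

definition multi_deriv ::
  "('d::finite \<Rightarrow> nat) \<Rightarrow> (real ^ 'd \<Rightarrow> 'b::real_normed_vector) \<Rightarrow> real ^ 'd \<Rightarrow> 'b" where
  "multi_deriv \<alpha> f = iter_partial (SOME js. \<forall>i. count_list js i = \<alpha> i) f"

text \<open>\<open>|\<nabla>\<^sup>m f|\<close>, where \<open>D \<alpha>\<close> is the (classical or weak) derivative of \<open>f\<close> of order \<open>\<alpha>\<close>.\<close>

definition grad_abs ::
  "(('d::finite \<Rightarrow> nat) \<Rightarrow> real ^ 'd \<Rightarrow> 'b::real_normed_vector) \<Rightarrow> nat \<Rightarrow> real ^ 'd \<Rightarrow> real" where
  "grad_abs D m x = sqrt (\<Sum>\<alpha> | multi_abs \<alpha> = m. (norm (D \<alpha> x))\<^sup>2)"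

section \<open>Weak derivatives\<close>

definition locally_integrable ::
  "(real ^ 'd::finite) set \<Rightarrow> (real ^ 'd \<Rightarrow> 'b::euclidean_space) \<Rightarrow> bool" where
  "locally_integrable U f \<longleftrightarrow> (\<forall>K. compact K \<and> K \<subseteq> U \<longrightarrow> set_integrable lebesgue K f)"

definition has_weak_deriv ::
  "(real ^ 'd::finite) set \<Rightarrow> ('d \<Rightarrow> nat) \<Rightarrow>
    (real ^ 'd \<Rightarrow> 'b::euclidean_space) \<Rightarrow> (real ^ 'd \<Rightarrow> 'b) \<Rightarrow> bool" where
  "has_weak_deriv U \<alpha> f g \<longleftrightarrow>
     locally_integrable U f \<and> locally_integrable U g \<and>
     (\<forall>\<phi> :: real ^ 'd \<Rightarrow> real. \<phi> \<in> test_fun U \<longrightarrow>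
        set_lebesgue_integral lebesgue U (\<lambda>x. multi_deriv \<alpha> \<phi> x *\<^sub>R f x) =
        (-1) ^ multi_abs \<alpha> *\<^sub>R set_lebesgue_integral lebesgue U (\<lambda>x. \<phi> x *\<^sub>R g x))"

text \<open>
  Weak derivatives are unique up to null sets, and rearrangements do not see null sets, so the
  choice of a representative is immaterial.
\<close>

definition weak_deriv ::
  "(real ^ 'd::finite) set \<Rightarrow> (real ^ 'd \<Rightarrow> 'b::euclidean_space) \<Rightarrow>
    ('d \<Rightarrow> nat) \<Rightarrow> real ^ 'd \<Rightarrow> 'b" where
  "weak_deriv U f \<alpha> = (SOME g. has_weak_deriv U \<alpha> f g)"

definition weakly_differentiable ::
  "(real ^ 'd::finite) set \<Rightarrow> nat \<Rightarrow> (real ^ 'd \<Rightarrow> 'b::euclidean_space) \<Rightarrow> bool" where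
  "weakly_differentiable U k f \<longleftrightarrow> (\<forall>\<alpha>. multi_abs \<alpha> \<le> k \<longrightarrow> (\<exists>g. has_weak_deriv U \<alpha> f g))"

section \<open>Cubes and sharp maximal functions\<close>

text \<open>
  Cubes are closed and nondegenerate. Function spaces on a cube involve derivatives on its
  interior only.
\<close>

definition is_cube :: "(real ^ 'd::finite) set \<Rightarrow> bool" where
  "is_cube Q \<longleftrightarrow> (\<exists>a l. 0 < l \<and> Q = cbox a (a + (\<chi> i. l)))"

definition average ::
  "(real ^ 'd::finite) set \<Rightarrow> (real ^ 'd \<Rightarrow> 'b::euclidean_space) \<Rightarrow> 'b" where
  "average Q f = (1 / measure lebesgue Q) *\<^sub>R set_lebesgue_integral lebesgue Q f"

definition mean_oscillation ::
  "(real ^ 'd::finite) set \<Rightarrow> (real ^ 'd \<Rightarrow> 'b::euclidean_space) \<Rightarrow> ennreal" where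
  "mean_oscillation Q f =
     (\<integral>\<^sup>+y\<in>Q. ennreal (norm (f y - average Q f)) \<partial>lebesgue) / emeasure lebesgue Q"

text \<open>
  \<open>sharp_max S f\<close> is the sharp maximal function built from the cubes contained in \<open>S\<close>:
  it is \<open>f\<^sup>#\<close> for \<open>S = UNIV\<close> and the local version on \<open>Q\<^sub>0\<close> for \<open>S = Q\<^sub>0\<close>.
\<close>

definition sharp_max ::
  "(real ^ 'd::finite) set \<Rightarrow> (real ^ 'd \<Rightarrow> 'b::euclidean_space) \<Rightarrow> real ^ 'd \<Rightarrow> ennreal" where
  "sharp_max S f x = (SUP Q\<in>{Q. is_cube Q \<and> Q \<subseteq> S \<and> x \<in> Q}. mean_oscillation Q f)"

section \<open>Rearrangements and Lorentz norms\<close>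

text \<open>
  Rearrangement of a nonnegative function on \<open>S\<close>. The value \<open>s = \<infinity>\<close> is always
  admissible and encodes \<open>inf \<emptyset> = \<infinity>\<close>.
\<close>

definition rearrangement ::
  "(real ^ 'd::finite) set \<Rightarrow> (real ^ 'd \<Rightarrow> ennreal) \<Rightarrow> real \<Rightarrow> ennreal" where
  "rearrangement S g t = Inf {s. emeasure lebesgue {x\<in>S. s < g x} \<le> ennreal t}"

text \<open>Used for positive exponents only.\<close>

definition ennpowr :: "ennreal \<Rightarrow> real \<Rightarrow> ennreal" where
  "ennpowr x s = (if x = \<infinity> then \<infinity> else ennreal (enn2real x powr s))"

text \<open>
  \<open>S\<close> is the underlying domain and \<open>T\<close> the range of the variable \<open>t\<close>.
\<close>

definition lorentz_norm_on ::
  "real set \<Rightarrow> (real ^ 'd::finite) set \<Rightarrow> real \<Rightarrow> ennreal \<Rightarrow> (real ^ 'd \<Rightarrow> ennreal) \<Rightarrow> ennreal" where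
  "lorentz_norm_on T S p r g =
     (if r = \<infinity> then SUP t\<in>T. ennreal (t powr (1 / p)) * rearrangement S g t
      else ennpowr
        (\<integral>\<^sup>+t\<in>T. ennpowr (ennreal (t powr (1 / p)) * rearrangement S g t) (enn2real r)
                    * ennreal (1 / t) \<partial>lborel)
        (1 / enn2real r))"

definition lorentz_norm ::
  "real \<Rightarrow> ennreal \<Rightarrow> (real ^ 'd::finite \<Rightarrow> ennreal) \<Rightarrow> ennreal" where
  "lorentz_norm p r g = lorentz_norm_on {0<..} UNIV p r g"

definition lorentz_norm_cube ::
  "(real ^ 'd::finite) set \<Rightarrow> real \<Rightarrow> ennreal \<Rightarrow> (real ^ 'd \<Rightarrow> ennreal) \<Rightarrow> ennreal" where
  "lorentz_norm_cube Q p r g = lorentz_norm_on {0<..<1} Q p r g"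

section \<open>Sobolev spaces over Lorentz spaces\<close>

definition sobolev_cube_norm ::
  "(real ^ 'd::finite) set \<Rightarrow> nat \<Rightarrow> real \<Rightarrow> ennreal \<Rightarrow> (real ^ 'd \<Rightarrow> 'b::euclidean_space) \<Rightarrow> ennreal" where
  "sobolev_cube_norm Q k p r f =
     (\<Sum>m\<le>k. lorentz_norm_cube Q p r (\<lambda>x. ennreal (grad_abs (weak_deriv (interior Q) f) m x)))"

definition sobolev_cube ::
  "(real ^ 'd::finite) set \<Rightarrow> nat \<Rightarrow> real \<Rightarrow> ennreal \<Rightarrow> (real ^ 'd \<Rightarrow> 'b::euclidean_space) set" where
  "sobolev_cube Q k p r =
     {f. weakly_differentiable (interior Q) k f \<and> sobolev_cube_norm Q k p r f < \<infinity>}"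

definition hom_norm_smooth ::
  "nat \<Rightarrow> real \<Rightarrow> ennreal \<Rightarrow> (real ^ 'd::finite \<Rightarrow> 'b::euclidean_space) \<Rightarrow> ennreal" where
  "hom_norm_smooth k p r \<phi> =
     lorentz_norm p r (\<lambda>x. ennreal (grad_abs (\<lambda>\<alpha>. multi_deriv \<alpha> \<phi>) k x))"

text \<open>
  Elements of the completion of \<open>C\<^sub>0\<^sup>\<infinity>\<close> are classes of Cauchy sequences of test functions.
  They are realised as functions through the limit in \<open>L\<^sub>1\<close> on compact sets. For the exponents
  \<open>p = d / (k + \<epsilon>) > 1\<close>, where \<open>k p < d\<close>, the Sobolev embedding shows that every Cauchy
  sequence has such a limit, and that equivalence classes correspond to functions up to null sets.
\<close>

definition hom_sobolev_rep ::
  "nat \<Rightarrow> real \<Rightarrow> ennreal \<Rightarrow> (nat \<Rightarrow> real ^ 'd::finite \<Rightarrow> 'b::euclidean_space) \<Rightarrow>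
    (real ^ 'd \<Rightarrow> 'b) \<Rightarrow> bool" where
  "hom_sobolev_rep k p r \<phi> f \<longleftrightarrow>
     (\<forall>n. \<phi> n \<in> test_fun UNIV) \<and>
     (\<forall>e>0. \<exists>N. \<forall>m\<ge>N. \<forall>n\<ge>N. hom_norm_smooth k p r (\<lambda>x. \<phi> m x - \<phi> n x) < e) \<and>
     locally_integrable UNIV f \<and>
     (\<forall>K. compact K \<longrightarrow>
        (\<lambda>n. \<integral>\<^sup>+x\<in>K. ennreal (norm (\<phi> n x - f x)) \<partial>lebesgue) \<longlonglongrightarrow> 0)"

definition hom_sobolev ::
  "nat \<Rightarrow> real \<Rightarrow> ennreal \<Rightarrow> (real ^ 'd::finite \<Rightarrow> 'b::euclidean_space) set" where
  "hom_sobolev k p r = {f. \<exists>\<phi>. hom_sobolev_rep k p r \<phi> f}"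

text \<open>
  The norm of the completion: the limit of the norms along a representing Cauchy sequence, which
  does not depend on the sequence.
\<close>

definition hom_sobolev_norm ::
  "nat \<Rightarrow> real \<Rightarrow> ennreal \<Rightarrow> (real ^ 'd::finite \<Rightarrow> 'b::euclidean_space) \<Rightarrow> ennreal" where
  "hom_sobolev_norm k p r f =
     lim (\<lambda>n. hom_norm_smooth k p r ((SOME \<phi>. hom_sobolev_rep k p r \<phi> f) n))"

end

theory Submission
  imports Defs
begin

text \<open>
  The Poincare inequality bounds the mean oscillation over a cube of side \<open>l\<close> by
  \<open>l\<^sup>1\<^sup>-\<^sup>d \<integral> |\<nabla>f|\<close>, so \<open>f\<^sup>#\<close> is dominated by the fractional maximal function
  of \<open>|\<nabla>f|\<close>, and representation by Riesz potentials gives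
  \<open>|\<nabla>f| \<le> C I\<^sub>1\<^sup>k\<^sup>-\<^sup>1 H\<close> with \<open>H = |\<nabla>\<^sup>k f|\<close> on the whole space and
  \<open>H\<close> the sum of all \<open>|\<nabla>\<^sup>m f|\<close> with \<open>1 \<le> m \<le> k\<close> on a cube.

  Cutting a function into the dyadic levels \<open>a(2\<^sup>j t)\<close> of its rearrangement \<open>a\<close> bounds the
  rearrangement of \<open>I\<^sub>1\<close> at \<open>t\<close> by a sum over \<open>j \<ge> 0\<close> of \<open>(2\<^sup>j t)\<^sup>1\<^sup>/\<^sup>d a(2\<^sup>j t)\<close>
  plus a geometrically damped sum over \<open>j < 0\<close>. For the fractional maximal function the first sum
  becomes a supremum. Dilations scale the Lorentz functional by a power, so Minkowski's
  inequality makes \<open>I\<^sub>1\<close> bounded from exponent \<open>d/(m+1+\<epsilon>)\<close> to \<open>d/(m+\<epsilon>)\<close>, uniformly in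
  \<open>\<epsilon>\<close>, as long as \<open>m \<ge> 1\<close>. In the last step, where \<open>m = 0\<close>, the dilations only give the
  factors \<open>2\<^sup>-\<^sup>j\<^sup>\<epsilon>\<^sup>/\<^sup>d\<close>. A supremum costs their \<open>l\<^sub>r\<close> norm, of order \<open>\<epsilon>\<^sup>-\<^sup>1\<^sup>/\<^sup>r\<close>, whereas a sum
  would cost \<open>\<epsilon>\<^sup>-\<^sup>1\<close>.
\<close>


section \<open>Powers of extended nonnegative reals and the Minkowski inequality\<close>

text \<open>Both estimates run through one interface, \<open>upper_gradient\<close> and
  \<open>deriv_system\<close>: an inequality along segments that test functions satisfy by the
  fundamental theorem of calculus, and weak derivatives after testing against products of bumps.
  They part at one point. Bounding a function by the potential of its gradient leaves a mean value
  over; on growing cubes it vanishes for integrable functions, on a fixed cube it stays, which is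
  why all orders up to \<open>k\<close> enter there. The whole-space estimate is proved for test
  functions and carried to the completion by Fatou-type lemmas for the sharp maximal function, its
  rearrangement and the Lorentz functional. Three conditions fix the admissible range. From
  \<open>1 <= k < d\<close> comes \<open>d >= 2\<close>, so the Riesz kernel decreases. With
  \<open>epsilon <= 1/2\<close> the exponents \<open>(j + epsilon)/d\<close>, \<open>j <= k\<close>,
  stay \<open>1/(2d)\<close> below 1, where the tail series would diverge. With
  \<open>epsilon R <= d\<close> the linear bound \<open>1 - 2^(-x) >= x/2\<close> behind the blow-up
  rate applies.\<close>

lemma ennpowr_ennreal: "0 \<le> c \<Longrightarrow> ennpowr (ennreal c) s = ennreal (c powr s)"
  by (simp add: ennpowr_def)

lemma ennpowr_top [simp]: "ennpowr top s = top"
  by (simp add: ennpowr_def)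

lemma ennpowr_0 [simp]: "ennpowr 0 s = 0"
  by (simp add: ennpowr_def)

lemma ennpowr_one [simp]: "ennpowr x 1 = x"
  by (cases x) (auto simp: ennpowr_def)

lemma ennpowr_ennpowr: "ennpowr (ennpowr x s) u = ennpowr x (s * u)"
  by (cases x) (auto simp: ennpowr_def powr_powr)

lemma ennpowr_mono: "0 \<le> s \<Longrightarrow> x \<le> y \<Longrightarrow> ennpowr x s \<le> ennpowr y s"
  by (cases x; cases y) (auto simp: ennpowr_def top_unique intro!: ennreal_leI powr_mono2)

lemma ennpowr_mult: "0 < s \<Longrightarrow> ennpowr (x * y) s = ennpowr x s * ennpowr y s"
  by (cases x; cases y)
    (auto simp: ennpowr_def ennreal_mult_top ennreal_top_mult ennreal_mult[symmetric] powr_mult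
      ennreal_mult_eq_top_iff enn2real_mult)

lemma ennpowr_le_iff: "0 < s \<Longrightarrow> ennpowr x s \<le> y \<longleftrightarrow> x \<le> ennpowr y (1 / s)"
  using ennpowr_mono[of "1/s" "ennpowr x s" y] ennpowr_mono[of s x "ennpowr y (1/s)"]
  by (auto simp: ennpowr_ennpowr)

lemma ennpowr_SUP: "0 < s \<Longrightarrow> ennpowr (SUP i\<in>I. f i) s = (SUP i\<in>I. ennpowr (f i) s)"
  by (intro antisym SUP_least ennpowr_mono SUP_upper)
    (auto simp: ennpowr_le_iff intro!: SUP_least ennpowr_le_iff[THEN iffD1] SUP_upper)

lemma ennpowr_borel [measurable]:
  assumes [measurable]: "f \<in> borel_measurable M"
  shows "(\<lambda>x. ennpowr (f x) s) \<in> borel_measurable M"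
proof -
  have "(\<lambda>x. if f x = top then top else ennreal (enn2real (f x) powr s)) \<in> borel_measurable M"
    by measurable
  then show ?thesis by (simp add: ennpowr_def)
qed

text \<open>Only suprema have to be preserved: \<open>liminf\<close> is a supremum of infima, and a
  monotone map sends an infimum below the infimum of the images.\<close>

lemma SUP_continuous_liminf:
  fixes x :: "nat \<Rightarrow> ennreal" and \<Phi> :: "ennreal \<Rightarrow> ennreal"
  assumes "mono \<Phi>" and "\<And>y :: nat \<Rightarrow> ennreal. \<Phi> (SUP n. y n) = (SUP n. \<Phi> (y n))"
  shows "\<Phi> (liminf x) \<le> liminf (\<lambda>n. \<Phi> (x n))"
  unfolding liminf_SUP_INF assms(2)
  by (intro SUP_mono) (auto intro!: bexI INF_greatest monoD[OF assms(1)] INF_lower)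

lemma ennpowr_liminf: "0 < s \<Longrightarrow> ennpowr (liminf x) s \<le> liminf (\<lambda>n. ennpowr (x n) s)"
  by (rule SUP_continuous_liminf) (auto simp: ennpowr_SUP intro!: monoI ennpowr_mono)

lemma mult_liminf_ennreal: "(c :: ennreal) * liminf x \<le> liminf (\<lambda>n. c * x n)"
  by (rule SUP_continuous_liminf) (auto simp: SUP_mult_left_ennreal intro!: monoI mult_left_mono)

text \<open>Convexity of the power function at the points \<open>x / N\<close> and
  \<open>y / M\<close> with the weights \<open>N / (N + M)\<close> and \<open>M / (N + M)\<close>.
  With \<open>N\<close> and \<open>M\<close> close to the two norms, integration of this inequality
  gives Minkowski without any duality argument.\<close>

lemma powr_add_le_weighted:
  fixes x y N M R :: real
  assumes "0 \<le> x" "0 \<le> y" "0 < N" "0 < M" "1 \<le> R"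
  shows "(x + y) powr R \<le> (N + M) powr (R - 1) * (N powr (1 - R) * x powr R + M powr (1 - R) * y powr R)"
proof -
  define l where "l = N / (N + M)"
  have l: "0 < l" "l < 1" "1 - l = M / (N + M)"
    using assms by (auto simp: l_def field_simps)
  have conv: "(l * z + (1 - l) * w) powr R \<le> l * z powr R + (1 - l) * w powr R"
    if "0 \<le> z" "0 \<le> w" for z w
  \<comment> \<open>Convexity is applied to two positive arguments only. If one vanishes, the claim
    reduces to \<open>a powr R <= a\<close> for \<open>0 < a < 1\<close>.\<close>
  proof (cases "z = 0 \<or> w = 0")
    case True
    have *: "a powr R \<le> a" if "0 < a" "a < 1" for a :: real
      using powr_mono'[of 1 R a] assms that by simp
    have "(a * b) powr R \<le> a * b powr R" if "0 < a" "a < 1" "0 \<le> b" for a b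
      using that *[of a] by (simp add: powr_mult mult_right_mono)
    from this[of l z] this[of "1 - l" w] show ?thesis using True l(1,2) that assms(5) by auto
  next
    case False
    then show ?thesis
      using convex_onD[OF powr_convex[OF assms(5)], of "1 - l" z w] that l(1,2) by simp
  qed
  have "(x + y) powr R = ((N + M) * (l * (x / N) + (1 - l) * (y / M))) powr R"
  proof -
    have "S * (N / S * (x / N) + M / S * (y / M)) = x + y" if "0 < S" for S
      using assms that by (simp add: field_simps)
    from this[of "N + M"] show ?thesis using assms unfolding l(3) by (simp add: l_def)
  qed
  also have "\<dots> = (N + M) powr R * (l * (x / N) + (1 - l) * (y / M)) powr R"
    using assms l by (simp add: powr_mult)
  also have "\<dots> \<le> (N + M) powr R * (l * (x / N) powr R + (1 - l) * (y / M) powr R)"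
    using assms by (intro mult_left_mono conv) auto
  also have "\<dots> = (N + M) powr (R - 1) * (N powr (1 - R) * x powr R + M powr (1 - R) * y powr R)"
  proof -
    have "P * (N / S * (a / n) + M / S * (b / m)) = P / S * (N / n * a + M / m * b)" for P S a b n m :: real
      by (simp add: divide_inverse algebra_simps)
    then show ?thesis
      using assms unfolding l(3) by (simp add: l_def powr_diff powr_divide)
  qed
  finally show ?thesis .
qed

definition lr_norm :: "'a measure \<Rightarrow> real \<Rightarrow> ('a \<Rightarrow> ennreal) \<Rightarrow> ennreal" where
  "lr_norm M R h = ennpowr (\<integral>\<^sup>+x. ennpowr (h x) R \<partial>M) (1 / R)"

lemma lr_norm_add:
  assumes R: "1 \<le> R" and [measurable]: "f \<in> borel_measurable M" "g \<in> borel_measurable M"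
  shows "lr_norm M R (\<lambda>x. f x + g x) \<le> lr_norm M R f + lr_norm M R g"
proof (cases "lr_norm M R f = top \<or> lr_norm M R g = top")
  case False
  then obtain A B where A: "lr_norm M R f = ennreal A" "0 \<le> A" and B: "lr_norm M R g = ennreal B" "0 \<le> B"
    by (metis ennreal_cases)
  have If: "(\<integral>\<^sup>+x. ennpowr (f x) R \<partial>M) = ennreal (A powr R)"
    using arg_cong[OF A(1), of "\<lambda>x. ennpowr x R"] R A by (simp add: lr_norm_def ennpowr_ennpowr ennpowr_ennreal)
  have Ig: "(\<integral>\<^sup>+x. ennpowr (g x) R \<partial>M) = ennreal (B powr R)"
    using arg_cong[OF B(1), of "\<lambda>x. ennpowr x R"] R B by (simp add: lr_norm_def ennpowr_ennpowr ennpowr_ennreal)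
  have "lr_norm M R (\<lambda>x. f x + g x) \<le> ennreal (A + B) + ennreal e" if e: "0 < e" for e
  proof -
    \<comment> \<open>The norms are enlarged by \<open>e / 2\<close> each because the weights divide
      by them and a norm may be zero.\<close>
    define N where "N = A + e / 2"
    define L where "L = B + e / 2"
    have NL: "0 < N" "0 < L" "A \<le> N" "B \<le> L" "N + L = A + B + e"
      using A B e by (auto simp: N_def L_def)
    define n where "n = (N + L) powr (R - 1) * N powr (1 - R)"
    define l where "l = (N + L) powr (R - 1) * L powr (1 - R)"
    have nl: "0 \<le> n" "0 \<le> l" by (auto simp: n_def l_def)
    have ptw: "ennpowr (x + y) R \<le> ennreal n * ennpowr x R + ennreal l * ennpowr y R" for x y
    proof (cases x; cases y)
      fix a b assume ab: "x = ennreal a" "y = ennreal b" "0 \<le> a" "0 \<le> b"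
      then show ?thesis
        using powr_add_le_weighted[OF ab(3,4) NL(1,2) R] nl
        by (auto simp: ennpowr_ennreal ennreal_plus[symmetric] ennreal_mult[symmetric] n_def l_def algebra_simps
            simp del: ennreal_plus intro!: ennreal_leI)
    qed (use NL in \<open>auto simp: n_def l_def ennreal_mult_top\<close>)
    have "(\<integral>\<^sup>+x. ennpowr (f x + g x) R \<partial>M) \<le> (\<integral>\<^sup>+x. ennreal n * ennpowr (f x) R + ennreal l * ennpowr (g x) R \<partial>M)"
      by (intro nn_integral_mono ptw)
    also have "\<dots> = ennreal n * ennreal (A powr R) + ennreal l * ennreal (B powr R)"
      by (simp add: nn_integral_add nn_integral_cmult If Ig)
    also have "\<dots> = ennreal (n * A powr R + l * B powr R)"
      using nl by (simp add: ennreal_mult)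
    also have "\<dots> \<le> ennreal (n * N powr R + l * L powr R)"
      using NL nl A B R by (intro ennreal_leI add_mono mult_left_mono powr_mono2) auto
    also have "n * N powr R + l * L powr R = (N + L) powr (R - 1) * (N powr (1 - R + R) + L powr (1 - R + R))"
      unfolding n_def l_def powr_add by (simp add: algebra_simps)
    also have "\<dots> = (N + L) powr R"
      using NL by (simp add: powr_diff)
    finally have "lr_norm M R (\<lambda>x. f x + g x) \<le> ennpowr (ennreal ((N + L) powr R)) (1 / R)"
      unfolding lr_norm_def using R by (intro ennpowr_mono) auto
    also have "\<dots> = ennreal (N + L)"
      using NL R by (simp add: ennpowr_ennreal powr_powr)
    finally show ?thesis using NL(5) A B e by (simp add: ennreal_plus[symmetric] del: ennreal_plus)
  qed
  then show ?thesis
    unfolding A(1) B(1) ennreal_plus[OF A(2) B(2)] by (rule ennreal_le_epsilon)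
qed auto

lemma lr_norm_incseq:
  assumes R: "0 < R" and [measurable]: "\<And>n. F n \<in> borel_measurable M" and "incseq F"
  shows "lr_norm M R (\<lambda>x. SUP n. F n x) = (SUP n. lr_norm M R (F n))"
proof -
  have "incseq (\<lambda>n x. ennpowr (F n x) R)"
    using R assms(3) by (auto simp: incseq_def le_fun_def intro!: ennpowr_mono)
  then have "(\<integral>\<^sup>+x. (SUP n. ennpowr (F n x) R) \<partial>M) = (SUP n. \<integral>\<^sup>+x. ennpowr (F n x) R \<partial>M)"
    by (intro nn_integral_monotone_convergence_SUP) auto
  then show ?thesis
    unfolding lr_norm_def using R by (simp add: ennpowr_SUP)
qed

lemma lr_norm_suminf:
  assumes R: "1 \<le> R" and [measurable]: "\<And>n. f n \<in> borel_measurable M"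
  shows "lr_norm M R (\<lambda>x. \<Sum>n. f n x) \<le> (\<Sum>n. lr_norm M R (f n))"
proof -
  have fin: "lr_norm M R (\<lambda>x. \<Sum>i<n. f i x) \<le> (\<Sum>i<n. lr_norm M R (f i))" for n
  proof (induction n)
    case 0
    then show ?case by (simp add: lr_norm_def)
  next
    case (Suc n)
    then show ?case
      using lr_norm_add[OF R, of "\<lambda>x. \<Sum>i<n. f i x" M "f n"]
      by (simp add: order_trans[OF _ add_right_mono])
  qed
  have "lr_norm M R (\<lambda>x. \<Sum>n. f n x) = (SUP n. lr_norm M R (\<lambda>x. \<Sum>i<n. f i x))"
    unfolding suminf_eq_SUP using R
    by (subst lr_norm_incseq) (auto simp: incseq_def le_fun_def intro!: sum_mono2)
  also have "\<dots> \<le> (\<Sum>n. lr_norm M R (f n))"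
    by (auto intro!: SUP_least order_trans[OF fin] sum_le_suminf)
  finally show ?thesis .
qed

section \<open>The Lorentz functional\<close>

text \<open>The Lorentz norm as a functional of an arbitrary function of \<open>t\<close>, with
  \<open>e\<close> in the role of \<open>1 / p\<close>. The majorants of rearrangements built below
  need not be rearrangements themselves, and on such functions the functional is a genuine norm for
  \<open>r >= 1\<close>.\<close>

definition lorentz_fun :: "real \<Rightarrow> ennreal \<Rightarrow> (real \<Rightarrow> ennreal) \<Rightarrow> ennreal" where
  "lorentz_fun e r a =
     (if r = \<infinity> then SUP t\<in>{0<..}. ennreal (t powr e) * a t
      else ennpowr (\<integral>\<^sup>+t\<in>{0<..}. ennpowr (ennreal (t powr e) * a t) (enn2real r) * ennreal (1 / t) \<partial>lborel)
             (1 / enn2real r))"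

definition haar :: "real measure" where
  "haar = density lborel (\<lambda>t. ennreal (1 / t) * indicator {0<..} t)"

lemma sets_haar [measurable_cong]: "sets haar = sets borel" and space_haar [simp]: "space haar = UNIV"
  by (simp_all add: haar_def)

lemma nn_integral_haar:
  assumes [measurable]: "h \<in> borel_measurable borel"
  shows "(\<integral>\<^sup>+t. h t \<partial>haar) = (\<integral>\<^sup>+t\<in>{0<..}. h t * ennreal (1 / t) \<partial>lborel)"
  unfolding haar_def by (subst nn_integral_density) (auto intro!: nn_integral_cong simp: mult_ac)

lemma nn_integral_haar_dilate:
  assumes [measurable]: "h \<in> borel_measurable borel" and c: "0 < c"
  shows "(\<integral>\<^sup>+t. h (c * t) \<partial>haar) = (\<integral>\<^sup>+t. h t \<partial>haar)"
proof -
  have "(\<integral>\<^sup>+t. h t \<partial>haar) = ennreal c * (\<integral>\<^sup>+t. h (c * t) * ennreal (1 / (c * t)) * indicator {0<..} (c * t) \<partial>lborel)"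
    using c unfolding nn_integral_haar[OF assms(1)]
    by (subst nn_integral_real_affine[where c=c and t=0]) (simp_all add: mult.assoc)
  also have "\<dots> = (\<integral>\<^sup>+t. ennreal c * (h (c * t) * ennreal (1 / (c * t)) * indicator {0<..} (c * t)) \<partial>lborel)"
    by (simp add: nn_integral_cmult)
  also have "\<dots> = (\<integral>\<^sup>+t. h (c * t) * ennreal (1 / t) * indicator {0<..} t \<partial>lborel)"
  proof (intro nn_integral_cong)
    fix t
    have "ennreal c * ennreal (1 / (c * t)) = ennreal (1 / t)" if "0 < t"
      using c that by (simp add: ennreal_mult[symmetric])
    then show "ennreal c * (h (c * t) * ennreal (1 / (c * t)) * indicator {0<..} (c * t)) =
        h (c * t) * ennreal (1 / t) * indicator {0<..} t"
      using c by (auto simp: indicator_def zero_less_mult_iff mult.assoc[symmetric] mult.commute[of _ "h _"])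
        (simp add: mult.assoc)
  qed
  finally show ?thesis by (simp add: nn_integral_haar)
qed

locale lorentz_exponent =
  fixes r :: ennreal
  assumes r_ge_1: "1 \<le> r"
begin

abbreviation "R \<equiv> enn2real r"

lemma R_ge_1: "r \<noteq> top \<Longrightarrow> 1 \<le> R"
  using r_ge_1 by (cases r) auto

lemma lorentz_fun_top: "r = top \<Longrightarrow> lorentz_fun e r a = (SUP t\<in>{0<..}. ennreal (t powr e) * a t)"
  by (simp add: lorentz_fun_def)

lemma lorentz_fun_lr_norm:
  "r \<noteq> top \<Longrightarrow> a \<in> borel_measurable borel \<Longrightarrow>
    lorentz_fun e r a = lr_norm haar R (\<lambda>t. ennreal (t powr e) * a t)"
  by (simp add: lorentz_fun_def lr_norm_def nn_integral_haar)

lemma lorentz_fun_mono: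
  assumes "\<And>t. 0 < t \<Longrightarrow> a t \<le> b t"
  shows "lorentz_fun e r a \<le> lorentz_fun e r b"
proof (cases "r = top")
  case True
  show ?thesis unfolding lorentz_fun_top[OF True] using assms by (auto intro!: SUP_mono bexI mult_left_mono)
next
  case False
  have "ennpowr (ennreal (t powr e) * a t) R * ennreal (1 / t) * indicator {0<..} t
      \<le> ennpowr (ennreal (t powr e) * b t) R * ennreal (1 / t) * indicator {0<..} t" for t
    using assms[of t] R_ge_1[OF False]
    by (cases "0 < t") (auto intro!: ennpowr_mono mult_right_mono mult_left_mono)
  then show ?thesis using False R_ge_1[OF False]
    by (auto simp: lorentz_fun_def intro!: ennpowr_mono nn_integral_mono)
qed

lemma lorentz_fun_cmult:
  assumes [measurable]: "a \<in> borel_measurable borel"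
  shows "lorentz_fun e r (\<lambda>t. c * a t) = c * lorentz_fun e r a"
proof (cases "r = top")
  case True
  show ?thesis unfolding lorentz_fun_top[OF True] by (simp add: SUP_mult_left_ennreal mult.left_commute)
next
  case False
  with R_ge_1[OF False] show ?thesis
    by (simp add: lorentz_fun_lr_norm lr_norm_def mult.left_commute[of _ c] ennpowr_mult[of R c]
        nn_integral_cmult) (simp add: ennpowr_mult ennpowr_ennpowr)
qed

text \<open>This is how smoothing by one order acts on exponents: the factor \<open>t^(1/d)\<close>
  in the bounds for potentials and maximal functions moves \<open>e\<close> to
  \<open>e + 1/d\<close>.\<close>

lemma lorentz_fun_powr_shift:
  "lorentz_fun e r (\<lambda>t. ennreal (t powr f) * a t) = lorentz_fun (e + f) r a"
proof -
  have *: "ennreal (t powr e) * (ennreal (t powr f) * a t) = ennreal (t powr (e + f)) * a t" for t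
    by (simp add: powr_add ennreal_mult mult.assoc)
  show ?thesis unfolding lorentz_fun_def * by simp
qed

lemma lorentz_fun_dilate:
  assumes [measurable]: "a \<in> borel_measurable borel" and c: "0 < c"
  shows "lorentz_fun e r (\<lambda>t. a (c * t)) = ennreal (c powr - e) * lorentz_fun e r a"
proof (cases "r = top")
  case True
  have "(SUP t\<in>{0<..}. ennreal (t powr e) * a (c * t)) = (SUP t\<in>(*) c ` {0<..}. ennreal ((t / c) powr e) * a t)"
    using c by (simp add: image_image)
  also have "(*) c ` {0<..} = {0<..}"
  proof -
    have "x \<in> (*) c ` {0<..}" if "0 < x" for x
      using c that by (intro image_eqI[of _ _ "x / c"]) auto
    then show ?thesis using c by auto
  qed
  also have "(SUP t\<in>{0<..}. ennreal ((t / c) powr e) * a t) = (SUP t\<in>{0<..}. ennreal (c powr - e) * (ennreal (t powr e) * a t))"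
    using c by (intro SUP_cong) (auto simp: powr_divide powr_minus_divide ennreal_mult[symmetric] mult.assoc[symmetric])
  finally show ?thesis unfolding lorentz_fun_top[OF True] by (simp add: SUP_mult_left_ennreal)
next
  case False
  note R = R_ge_1[OF False]
  have "(\<integral>\<^sup>+t. ennpowr (ennreal (t powr e) * a (c * t)) R \<partial>haar) =
      (\<integral>\<^sup>+t. ennpowr (ennreal (((c * t) / c) powr e) * a (c * t)) R \<partial>haar)"
    using c by simp
  also have "\<dots> = (\<integral>\<^sup>+t. ennpowr (ennreal ((t / c) powr e) * a t) R \<partial>haar)"
    using c by (subst nn_integral_haar_dilate[of "\<lambda>t. ennpowr (ennreal ((t / c) powr e) * a t) R"]) simp_all
  also have "\<dots> = (\<integral>\<^sup>+t. ennpowr (ennreal (t powr e) * (ennreal (c powr - e) * a t)) R \<partial>haar)"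
    unfolding haar_def using c
    by (subst (1 2) nn_integral_density)
      (auto intro!: nn_integral_cong simp: indicator_def powr_divide powr_minus_divide ennreal_mult[symmetric] mult.assoc[symmetric])
  finally have "lorentz_fun e r (\<lambda>t. a (c * t)) = lorentz_fun e r (\<lambda>t. ennreal (c powr - e) * a t)"
    using False by (simp add: lorentz_fun_lr_norm lr_norm_def)
  then show ?thesis by (simp add: lorentz_fun_cmult)
qed

lemma lorentz_fun_suminf:
  assumes [measurable]: "\<And>n :: nat. a n \<in> borel_measurable borel"
  shows "lorentz_fun e r (\<lambda>t. \<Sum>n. a n t) \<le> (\<Sum>n. lorentz_fun e r (a n))"
proof (cases "r = top")
  case True
  show ?thesis unfolding lorentz_fun_top[OF True]
    unfolding ennreal_suminf_cmult[symmetric] by (intro SUP_least suminf_le SUP_upper) auto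
next
  case False
  then show ?thesis
    using lr_norm_suminf[OF R_ge_1[OF False], of "\<lambda>n t. ennreal (t powr e) * a n t" haar]
    by (simp add: lorentz_fun_lr_norm ennreal_suminf_cmult)
qed

lemma lorentz_fun_add:
  assumes [measurable]: "a \<in> borel_measurable borel" "b \<in> borel_measurable borel"
  shows "lorentz_fun e r (\<lambda>t. a t + b t) \<le> lorentz_fun e r a + lorentz_fun e r b"
proof (cases "r = top")
  case True
  show ?thesis unfolding lorentz_fun_top[OF True]
    by (auto intro!: SUP_least add_mono SUP_upper simp: distrib_left)
next
  case False
  then show ?thesis
    using lr_norm_add[OF R_ge_1[OF False], of "\<lambda>t. ennreal (t powr e) * a t" haar "\<lambda>t. ennreal (t powr e) * b t"]
    by (simp add: lorentz_fun_lr_norm distrib_left)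
qed

text \<open>The \<open>R\<close>-th power of a supremum is at most the sum of the
  \<open>R\<close>-th powers, so the pieces combine in the sequence space of exponent
  \<open>R\<close> and not in that of exponent 1.\<close>

lemma lorentz_fun_SUP:
  assumes [measurable]: "\<And>n :: nat. a n \<in> borel_measurable borel" and "r \<noteq> top"
  shows "lorentz_fun e r (\<lambda>t. SUP n. a n t) \<le> ennpowr (\<Sum>n. ennpowr (lorentz_fun e r (a n)) R) (1 / R)"
proof -
  note R = R_ge_1[OF assms(2)]
  have "(SUP n. x n) \<le> (\<Sum>n. x n)" for x :: "nat \<Rightarrow> ennreal"
    using sum_le_suminf[of x "{_}"] by (auto intro!: SUP_least)
  then have "(\<integral>\<^sup>+t. ennpowr (ennreal (t powr e) * (SUP n. a n t)) R \<partial>haar) \<le>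
    (\<integral>\<^sup>+t. (\<Sum>n. ennpowr (ennreal (t powr e) * a n t) R) \<partial>haar)"
    using R by (intro nn_integral_mono) (simp add: SUP_mult_left_ennreal ennpowr_SUP)
  also have "\<dots> = (\<Sum>n. \<integral>\<^sup>+t. ennpowr (ennreal (t powr e) * a n t) R \<partial>haar)"
    by (intro nn_integral_suminf) simp
  also have "\<dots> = (\<Sum>n. ennpowr (lorentz_fun e r (a n)) R)"
    using assms(2) R by (simp add: lorentz_fun_lr_norm lr_norm_def ennpowr_ennpowr)
  finally show ?thesis
    using assms(2) R by (auto simp: lorentz_fun_lr_norm lr_norm_def intro!: ennpowr_mono)
qed

lemma lorentz_fun_SUP_top:
  "r = top \<Longrightarrow> lorentz_fun e r (\<lambda>t. SUP n :: nat. a n t) = (SUP n. lorentz_fun e r (a n))"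
  unfolding lorentz_fun_top by (simp add: SUP_mult_left_ennreal) (rule SUP_commute)

lemma lorentz_fun_liminf:
  assumes [measurable]: "\<And>n :: nat. a n \<in> borel_measurable borel"
  shows "lorentz_fun e r (\<lambda>t. liminf (\<lambda>n. a n t)) \<le> liminf (\<lambda>n. lorentz_fun e r (a n))"
proof (cases "r = top")
  case True
  show ?thesis unfolding lorentz_fun_top[OF True]
    by (intro SUP_least order_trans[OF mult_liminf_ennreal] Liminf_mono always_eventually allI SUP_upper)
next
  case False
  note R = R_ge_1[OF False]
  have "(\<integral>\<^sup>+t. ennpowr (ennreal (t powr e) * liminf (\<lambda>n. a n t)) R \<partial>haar) \<le>
     (\<integral>\<^sup>+t. liminf (\<lambda>n. ennpowr (ennreal (t powr e) * a n t) R) \<partial>haar)"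
    using R by (intro nn_integral_mono order_trans[OF ennpowr_mono[OF _ mult_liminf_ennreal]] ennpowr_liminf) auto
  also have "\<dots> \<le> liminf (\<lambda>n. \<integral>\<^sup>+t. ennpowr (ennreal (t powr e) * a n t) R \<partial>haar)"
    by (intro nn_integral_liminf) simp
  finally have "lr_norm haar R (\<lambda>t. ennreal (t powr e) * liminf (\<lambda>n. a n t)) \<le>
      ennpowr (liminf (\<lambda>n. \<integral>\<^sup>+t. ennpowr (ennreal (t powr e) * a n t) R \<partial>haar)) (1 / R)"
    unfolding lr_norm_def using R by (intro ennpowr_mono) auto
  also have "\<dots> \<le> liminf (\<lambda>n. lr_norm haar R (\<lambda>t. ennreal (t powr e) * a n t))"
    unfolding lr_norm_def using R by (intro ennpowr_liminf) auto
  finally show ?thesis using False by (simp add: lorentz_fun_lr_norm)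
qed

end

section \<open>Rearrangements\<close>

text \<open>Measurability is asked of the exceptional set \<open>B\<close> alone. A non-measurable
  level set has \<open>emeasure\<close> 0 and obeys the bound too, which makes the rule available
  for sharp maximal functions.\<close>

lemma rearrangement_leI:
  assumes "B \<in> sets lebesgue" "emeasure lebesgue B \<le> ennreal t" "\<And>x. x \<in> S \<Longrightarrow> x \<notin> B \<Longrightarrow> g x \<le> s"
  shows "rearrangement S g t \<le> s"
  unfolding rearrangement_def
proof (rule Inf_lower, safe)
  have "emeasure lebesgue {x \<in> S. s < g x} \<le> emeasure lebesgue B"
    using assms(1,3) by (intro emeasure_mono) (auto simp: not_le[symmetric])
  then show "emeasure lebesgue {x \<in> S. s < g x} \<le> ennreal t"
    using assms(2) by order
qed

lemma rearrangement_antimono: "s \<le> t \<Longrightarrow> rearrangement S g t \<le> rearrangement S g s"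
  unfolding rearrangement_def
  by (rule Inf_superset_mono) (auto intro: order_trans ennreal_leI)

lemma antimono_borel_measurable:
  fixes f :: "real \<Rightarrow> ennreal"
  assumes "\<And>s t. s \<le> t \<Longrightarrow> f t \<le> f s"
  shows "f \<in> borel_measurable borel"
proof (rule borel_measurableI_greater)
  fix y
  have "is_interval {t. y < f t}"
    unfolding is_interval_1 using assms by (auto intro: less_le_trans)
  then have "{t. y < f t} \<in> sets borel"
    by (rule real_interval_borel_measurable)
  then show "{x \<in> space borel. y < f x} \<in> sets borel" by simp
qed

lemma rearrangement_borel [measurable]: "rearrangement S g \<in> borel_measurable borel"
  by (intro antimono_borel_measurable rearrangement_antimono)

text \<open>The infimum in the definition is attained: some sequence of admissible levels decreases
  to it, and along this sequence the super-level sets increase.\<close>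

lemma emeasure_rearrangement_le:
  assumes "\<And>s. {x \<in> S. s < g x} \<in> sets lebesgue"
  shows "emeasure lebesgue {x \<in> S. rearrangement S g t < g x} \<le> ennreal t"
proof -
  let ?A = "{s. emeasure lebesgue {x \<in> S. s < g x} \<le> ennreal t}"
  have "top \<in> ?A" by simp
  then obtain f where f: "decseq f" "range f \<subseteq> ?A" "Inf ?A = (INF i :: nat. f i)"
    using ennreal_Inf_countable_INF[of ?A] by blast
  have "{x \<in> S. rearrangement S g t < g x} = (\<Union>i. {x \<in> S. f i < g x})"
    unfolding rearrangement_def f(3) by (auto simp: INF_less_iff)
  also have "emeasure lebesgue \<dots> = (SUP i. emeasure lebesgue {x \<in> S. f i < g x})"
    using f(1) assms by (intro SUP_emeasure_incseq[symmetric]) (auto simp: incseq_def decseq_def intro: le_less_trans)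
  also have "\<dots> \<le> ennreal t"
    using f(2) by (auto intro!: SUP_least)
  finally show ?thesis .
qed

lemma emeasure_rearrangement_UNIV_le:
  assumes [measurable]: "g \<in> borel_measurable lebesgue"
  shows "emeasure lebesgue {x. rearrangement UNIV g t < g x} \<le> ennreal t"
proof -
  have "{x \<in> UNIV. s < g x} \<in> sets lebesgue" for s
    using borel_measurable_less[of "\<lambda>_. s" lebesgue g] by simp
  from emeasure_rearrangement_le[OF this] show ?thesis by simp
qed

lemma super_level_lebesgue:
  fixes g :: "real ^ 'd::finite \<Rightarrow> ennreal"
  assumes [measurable]: "g \<in> borel_measurable lebesgue"
  shows "{x. s < g x} \<in> sets lebesgue"
  using borel_measurable_less[of "\<lambda>_. s" lebesgue g] by simp

lemma rearrangement_add_le: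
  fixes g h :: "real ^ 'd::finite \<Rightarrow> ennreal"
  assumes g: "g \<in> borel_measurable lebesgue" and h: "h \<in> borel_measurable lebesgue"
    and "0 \<le> s" "0 \<le> t"
  shows "rearrangement UNIV (\<lambda>x. g x + h x) (s + t) \<le> rearrangement UNIV g s + rearrangement UNIV h t"
proof (rule rearrangement_leI)
  let ?A = "{x. rearrangement UNIV g s < g x}" and ?B = "{x. rearrangement UNIV h t < h x}"
  have m: "?A \<in> sets lebesgue" "?B \<in> sets lebesgue"
    using g h by (auto intro: super_level_lebesgue)
  then show "?A \<union> ?B \<in> sets lebesgue" by simp
  have "emeasure lebesgue (?A \<union> ?B) \<le> emeasure lebesgue ?A + emeasure lebesgue ?B"
    using m by (intro emeasure_subadditive) auto
  also have "\<dots> \<le> ennreal s + ennreal t"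
    using g h by (intro add_mono emeasure_rearrangement_UNIV_le)
  finally show "emeasure lebesgue (?A \<union> ?B) \<le> ennreal (s + t)"
    using assms by (simp add: ennreal_plus)
qed (auto simp: not_less intro: add_mono)

lemma rearrangement_mono_AE:
  fixes g G :: "real ^ 'd::finite \<Rightarrow> ennreal"
  assumes G: "G \<in> borel_measurable lebesgue" and "AE x in lebesgue. x \<in> S \<longrightarrow> g x \<le> c * G x"
  shows "rearrangement S g t \<le> c * rearrangement UNIV G t"
proof -
  obtain N where N: "N \<in> null_sets lebesgue" "{x \<in> space lebesgue. \<not> (x \<in> S \<longrightarrow> g x \<le> c * G x)} \<subseteq> N"
    using assms(2) unfolding eventually_ae_filter by blast
  let ?A = "{x. rearrangement UNIV G t < G x}"
  have A: "?A \<in> sets lebesgue" using G by (rule super_level_lebesgue)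
  show ?thesis
  proof (rule rearrangement_leI)
    show "?A \<union> N \<in> sets lebesgue" using A N by auto
    show "emeasure lebesgue (?A \<union> N) \<le> ennreal t"
      unfolding emeasure_Un_null_set[OF A N(1)] by (rule emeasure_rearrangement_UNIV_le[OF G])
    fix x assume "x \<in> S" "x \<notin> ?A \<union> N"
    then have "g x \<le> c * G x" "G x \<le> rearrangement UNIV G t"
      using N(2) by auto
    then show "g x \<le> c * rearrangement UNIV G t"
      by (meson mult_left_mono order_trans zero_le)
  qed
qed

text \<open>Outer bounds instead of measurability of the \<open>h n\<close>: they will be sharp maximal functions,
  which are suprema over uncountably many cubes.\<close>

lemma rearrangement_liminf_le:
  fixes h :: "nat \<Rightarrow> real ^ 'd::finite \<Rightarrow> ennreal"
  assumes B: "\<And>n. \<exists>B\<in>sets lebesgue. emeasure lebesgue B \<le> ennreal t \<and> (\<forall>x\<in>S. x \<notin> B \<longrightarrow> h n x \<le> s n)"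
    and g: "\<And>x. x \<in> S \<Longrightarrow> g x \<le> liminf (\<lambda>n. h n x)"
  shows "rearrangement S g t \<le> liminf s"
proof (rule dense_ge)
  fix y assume "liminf s < y"
  obtain B where B: "\<And>n. B n \<in> sets lebesgue" "\<And>n. emeasure lebesgue (B n) \<le> ennreal t"
    "\<And>n x. x \<in> S \<Longrightarrow> x \<notin> B n \<Longrightarrow> h n x \<le> s n"
    using B by metis
  have inf: "\<exists>n\<ge>k. s n < y" for k
  proof -
    have "(INF n\<in>{k..}. s n) \<le> liminf s"
      unfolding liminf_SUP_INF by (rule SUP_upper) simp
    also note \<open>liminf s < y\<close>
    finally show ?thesis by (auto simp: INF_less_iff)
  qed
  \<comment> \<open>\<open>C k\<close> holds the points that are exceptional for every late
    \<open>n\<close> with \<open>s n < y\<close>. The sets increase with \<open>k\<close>, and each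
    lies in a single \<open>B n\<close>, so their union still has measure at most \<open>t\<close>.
    A point outside the union satisfies \<open>h n x <= s n < y\<close> for arbitrarily late
    \<open>n\<close>.\<close>
  define C where "C k = (\<Inter>n\<in>{n. k \<le> n \<and> s n < y}. B n)" for k
  have ne: "{n. k \<le> n \<and> s n < y} \<noteq> {}" for k using inf[of k] by auto
  have C: "C k \<in> sets lebesgue" for k
    unfolding C_def using ne B(1) by (intro sets.countable_INT') auto
  show "rearrangement S g t \<le> y"
  proof (rule rearrangement_leI)
    show "(\<Union>k. C k) \<in> sets lebesgue" using C by auto
    have "emeasure lebesgue (\<Union>k. C k) = (SUP k. emeasure lebesgue (C k))"
      using C by (intro SUP_emeasure_incseq[symmetric]) (auto simp: incseq_def C_def)
    also have "\<dots> \<le> ennreal t"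
    proof (rule SUP_least)
      fix k
      obtain n where n: "k \<le> n" "s n < y" using inf by blast
      then have "C k \<subseteq> B n" by (auto simp: C_def)
      then show "emeasure lebesgue (C k) \<le> ennreal t"
        using B(1,2) emeasure_mono order_trans by blast
    qed
    finally show "emeasure lebesgue (\<Union>k. C k) \<le> ennreal t" .
    fix x assume x: "x \<in> S" "x \<notin> (\<Union>k. C k)"
    show "g x \<le> y"
    proof (rule order_trans[OF g[OF x(1)]], unfold liminf_SUP_INF, rule SUP_least)
      fix k
      obtain n where "k \<le> n" "s n < y" "x \<notin> B n"
        using x(2) by (auto simp: C_def)
      then have "h n x \<le> y" using B(3)[OF x(1)] by (meson le_less order_trans)
      then show "(INF n\<in>{k..}. h n x) \<le> y"
        using \<open>k \<le> n\<close> by (intro INF_lower2[of n]) auto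
    qed
  qed
qed

section \<open>Riesz potentials and fractional maximal functions\<close>

lemma suminf_geometric_ennreal: "0 \<le> q \<Longrightarrow> q < 1 \<Longrightarrow> (\<Sum>n. ennreal (q ^ n)) = ennreal (1 / (1 - q))"
  by (intro suminf_ennreal_eq geometric_sums) auto

lemma ennreal_le_suminf: "f n \<le> (\<Sum>n. f n :: ennreal)"
  using sum_le_suminf[of f "{n}"] by simp

definition riesz :: "(real ^ 'd::finite \<Rightarrow> ennreal) \<Rightarrow> real ^ 'd \<Rightarrow> ennreal" where
  "riesz G x = (\<integral>\<^sup>+y. ennreal (norm (x - y) powr (1 - real CARD('d))) * G y \<partial>lborel)"

lemma riesz_borel [measurable]:
  assumes [measurable]: "G \<in> borel_measurable borel"
  shows "riesz (G :: real ^ 'd::finite \<Rightarrow> ennreal) \<in> borel_measurable borel"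
proof -
  have "(\<lambda>x. \<integral>\<^sup>+y. ennreal (norm (x - y) powr (1 - real CARD('d))) * G y \<partial>lborel) \<in> borel_measurable lborel"
    by (rule lborel.borel_measurable_nn_integral) measurable
  then show ?thesis by (simp add: riesz_def[abs_def])
qed

lemma riesz_mono_AE:
  assumes "AE y in lborel. G y \<le> H y"
  shows "riesz G x \<le> riesz H x"
  unfolding riesz_def by (intro nn_integral_mono_AE) (use assms in eventually_elim, auto intro: mult_left_mono)

lemma riesz_add:
  assumes [measurable]: "G \<in> borel_measurable borel" "H \<in> borel_measurable borel"
  shows "riesz (\<lambda>y. G y + H y) x = riesz G x + riesz H x"
  unfolding riesz_def distrib_left by (rule nn_integral_add) auto

lemma riesz_cmult:
  assumes [measurable]: "G \<in> borel_measurable borel"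
  shows "riesz (\<lambda>y. c * G y) x = c * riesz G x"
  unfolding riesz_def by (simp add: mult.left_commute[of _ c] nn_integral_cmult)

lemma riesz_kernel_shells:
  fixes x y :: "real ^ 'd::finite"
  assumes "0 < R" "x \<noteq> y" "2 \<le> CARD('d)"
  shows "ennreal (norm (x - y) powr (1 - real CARD('d))) \<le> ennreal (R powr (1 - real CARD('d))) +
    (\<Sum>n. ennreal ((R * (1 / 2) ^ Suc n) powr (1 - real CARD('d))) * indicator (cball x (R * (1 / 2) ^ n)) y)"
proof (cases "R \<le> norm (x - y)")
  case True
  then have "norm (x - y) powr (1 - real CARD('d)) \<le> R powr (1 - real CARD('d))"
    using assms by (intro powr_mono2') auto
  then show ?thesis by (intro add_increasing2 ennreal_leI) auto
next
  case False
  define m where "m = (LEAST m. R * (1 / 2) ^ m \<le> norm (x - y))"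
  have "\<exists>m. (1 / 2 :: real) ^ m < norm (x - y) / R"
    using assms by (intro real_arch_pow_inv) auto
  then have "\<exists>m. R * (1 / 2) ^ m \<le> norm (x - y)"
    using assms by (auto simp: field_simps intro: less_imp_le)
  then have m: "R * (1 / 2) ^ m \<le> norm (x - y)"
    unfolding m_def by (rule LeastI_ex)
  have "m \<noteq> 0" using m False by (intro notI) auto
  then obtain n where n: "m = Suc n" by (cases m) auto
  then have "norm (x - y) \<le> R * (1 / 2) ^ n"
    using not_less_Least[of n "\<lambda>m. R * (1 / 2) ^ m \<le> norm (x - y)"] unfolding m_def[symmetric] by simp
  then have y: "y \<in> cball x (R * (1 / 2) ^ n)" by (simp add: dist_norm)
  have "ennreal (norm (x - y) powr (1 - real CARD('d))) \<le>
     ennreal ((R * (1 / 2) ^ Suc n) powr (1 - real CARD('d))) * indicator (cball x (R * (1 / 2) ^ n)) y"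
    using y m assms unfolding n by (auto intro!: ennreal_leI powr_mono2')
  also have "\<dots> \<le> (\<Sum>n. ennreal ((R * (1 / 2) ^ Suc n) powr (1 - real CARD('d))) * indicator (cball x (R * (1 / 2) ^ n)) y)"
    by (rule ennreal_le_suminf[of "\<lambda>n. ennreal ((R * (1 / 2) ^ Suc n) powr (1 - real CARD('d))) * indicator (cball x (R * (1 / 2) ^ n)) y"])
  finally show ?thesis by (intro add_increasing) auto
qed

text \<open>The 1 comes from the part of a set outside the ball of radius \<open>R\<close>, the
  other term from the geometric series over the balls inside.\<close>

definition kernel_const :: "'d::finite itself \<Rightarrow> real" where
  "kernel_const _ = 1 + 2 ^ CARD('d) * unit_ball_vol (real CARD('d))"

lemma kernel_const_pos: "1 \<le> kernel_const TYPE('d::finite)"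
  by (simp add: kernel_const_def)

lemma riesz_kernel_set:
  fixes x :: "real ^ 'd::finite"
  assumes [measurable]: "E \<in> sets borel" and E: "emeasure lborel E \<le> ennreal V" and V: "0 < V" and d: "2 \<le> CARD('d)"
  shows "(\<integral>\<^sup>+y\<in>E. ennreal (norm (x - y) powr (1 - real CARD('d))) \<partial>lborel)
    \<le> ennreal (kernel_const TYPE('d) * V powr (1 / real CARD('d)))"
proof -
  let ?d = "CARD('d)" and ?D = "real CARD('d)"
  \<comment> \<open>The edge of a cube of measure \<open>V\<close>. Outside the ball the set
    contributes at most \<open>R^(1-d) V = R\<close>, which is also the order of the integral of the
    kernel over the ball.\<close>
  define R where "R = V powr (1 / ?D)"
  define w where "w = unit_ball_vol ?D"
  have w: "0 \<le> w" by (simp add: w_def)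
  have R: "0 < R" "R ^ ?d = V" using V d by (auto simp: R_def powr_realpow[symmetric] powr_powr)
  have RD: "R powr (1 - ?D) = R / V" using R by (simp add: powr_diff powr_realpow)
  define B where "B n = cball x (R * (1 / 2) ^ n)" for n
  have [measurable]: "B n \<in> sets borel" for n by (simp add: B_def)
  let ?f = "\<lambda>n y. ennreal ((R * (1 / 2) ^ Suc n) powr (1 - ?D)) * indicator (B n) y"
  have "(\<integral>\<^sup>+y\<in>E. ennreal (norm (x - y) powr (1 - ?D)) \<partial>lborel) \<le>
    (\<integral>\<^sup>+y. ennreal (R powr (1 - ?D)) * indicator E y + (\<Sum>n. ?f n y) \<partial>lborel)"
  proof (rule nn_integral_mono_AE)
    show "AE y in lborel. ennreal (norm (x - y) powr (1 - ?D)) * indicator E y \<le>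
        ennreal (R powr (1 - ?D)) * indicator E y + (\<Sum>n. ?f n y)"
      using AE_lborel_singleton[of x]
    proof eventually_elim
      case (elim y)
      then show ?case using riesz_kernel_shells[OF R(1), of x y] d unfolding B_def by (cases "y \<in> E") auto
    qed
  qed
  also have "\<dots> = ennreal (R powr (1 - ?D)) * emeasure lborel E +
      (\<Sum>n. ennreal ((R * (1 / 2) ^ Suc n) powr (1 - ?D)) * emeasure lborel (B n))"
  proof -
    have "(\<integral>\<^sup>+y. (\<Sum>n. ?f n y) \<partial>lborel) = (\<Sum>n. \<integral>\<^sup>+y. ?f n y \<partial>lborel)"
      by (rule nn_integral_suminf) measurable
    also have "\<dots> = (\<Sum>n. ennreal ((R * (1 / 2) ^ Suc n) powr (1 - ?D)) * emeasure lborel (B n))"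
      by (intro suminf_cong nn_integral_cmult_indicator) simp
    finally show ?thesis
      by (subst nn_integral_add) (measurable, simp add: nn_integral_cmult_indicator)
  qed
  also have "\<dots> \<le> ennreal (R powr (1 - ?D)) * ennreal V + (\<Sum>n. ennreal (w * R * 2 ^ (?d - 1) * (1 / 2) ^ n))"
  proof (intro add_mono mult_left_mono E suminf_le)
    fix n
    have "(R * (1 / 2) ^ Suc n) powr (1 - ?D) * (w * (R * (1 / 2) ^ n) ^ ?d) = w * R * 2 ^ (?d - 1) * (1 / 2) ^ n"
    proof -
      have "(R * (1 / 2) ^ Suc n) powr (1 - ?D) = (R * (1 / 2) ^ Suc n) / (R * (1 / 2) ^ Suc n) ^ ?d"
      proof -
        have "z powr (1 - ?D) = z / z ^ ?d" if "0 < z" for z :: real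
          using that by (simp add: powr_diff powr_realpow)
        then show ?thesis using R by simp
      qed
      also have "\<dots> = R * (1 / 2) ^ Suc n * 2 ^ ?d / (R * (1 / 2) ^ n) ^ ?d"
      proof -
        have "z / 2 / (z / 2) ^ ?d = z / 2 * 2 ^ ?d / z ^ ?d" for z :: real
          by (simp add: power_divide)
        from this[of "R * (1 / 2) ^ n"] show ?thesis by simp
      qed
      also have "\<dots> = R * (1 / 2) ^ n * 2 ^ (?d - 1) / (R * (1 / 2) ^ n) ^ ?d"
        using d by (cases ?d) auto
      finally show ?thesis using R by simp
    qed
    moreover have "emeasure lborel (B n) = ennreal (w * (R * (1 / 2) ^ n) ^ ?d)"
      using R by (simp add: B_def emeasure_cball w_def)
    ultimately show "ennreal ((R * (1 / 2) ^ Suc n) powr (1 - ?D)) * emeasure lborel (B n)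
        \<le> ennreal (w * R * 2 ^ (?d - 1) * (1 / 2) ^ n)"
      by (simp only: ennreal_mult'[symmetric, OF powr_ge_zero] order_refl)
  qed auto
  also have "(\<Sum>n. ennreal (w * R * 2 ^ (?d - 1) * (1 / 2) ^ n)) = ennreal (w * R * 2 ^ (?d - 1)) * ennreal 2"
  proof -
    have "0 \<le> w * R * 2 ^ (?d - 1)" using w R by simp
    then have "(\<Sum>n. ennreal (w * R * 2 ^ (?d - 1) * (1 / 2) ^ n)) = (\<Sum>n. ennreal (w * R * 2 ^ (?d - 1)) * ennreal ((1 / 2) ^ n))"
      by (intro suminf_cong ennreal_mult') 
    also have "\<dots> = ennreal (w * R * 2 ^ (?d - 1)) * (\<Sum>n. ennreal ((1 / 2) ^ n))"
      by (rule ennreal_suminf_cmult)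
    also have "(\<Sum>n. ennreal ((1 / 2) ^ n)) = ennreal 2"
      by (subst suminf_geometric_ennreal) auto
    finally show ?thesis .
  qed
  also have "ennreal (R powr (1 - ?D)) * ennreal V + ennreal (w * R * 2 ^ (?d - 1)) * ennreal 2 =
      ennreal (R + w * R * (2 ^ (?d - 1) * 2))"
  proof -
    have "ennreal (R powr (1 - ?D)) * ennreal V = ennreal R"
      using V R unfolding RD by (simp add: ennreal_mult[symmetric])
    moreover have "ennreal K * ennreal 2 = ennreal (K * 2)" for K
      by (rule ennreal_mult''[symmetric]) simp
    ultimately show ?thesis using R w by (simp only: mult.assoc) (simp add: ennreal_plus[symmetric] del: ennreal_plus)
  qed
  also have "2 ^ (?d - 1) * 2 = (2 :: real) ^ ?d" using d by (cases ?d) auto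
  finally show ?thesis by (simp add: kernel_const_def R_def[symmetric] w_def[symmetric] algebra_simps)
qed

text \<open>Tonelli and the symmetry of the kernel reduce this to \<open>riesz_kernel_set\<close>
  with centre \<open>y\<close>.\<close>

lemma nn_integral_riesz:
  fixes G :: "real ^ 'd::finite \<Rightarrow> ennreal"
  assumes [measurable]: "G \<in> borel_measurable borel" "E \<in> sets borel"
    and E: "emeasure lborel E \<le> ennreal V" and V: "0 < V" and d: "2 \<le> CARD('d)"
  shows "(\<integral>\<^sup>+x\<in>E. riesz G x \<partial>lborel)
    \<le> ennreal (kernel_const TYPE('d) * V powr (1 / real CARD('d))) * (\<integral>\<^sup>+y. G y \<partial>lborel)"
proof -
  let ?k = "\<lambda>x y :: real ^ 'd. ennreal (norm (x - y) powr (1 - real CARD('d)))"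
  have "(\<integral>\<^sup>+x\<in>E. riesz G x \<partial>lborel) = (\<integral>\<^sup>+x. \<integral>\<^sup>+y. ?k x y * G y * indicator E x \<partial>lborel \<partial>lborel)"
    unfolding riesz_def by (simp add: nn_integral_multc)
  also have "\<dots> = (\<integral>\<^sup>+y. \<integral>\<^sup>+x. ?k x y * G y * indicator E x \<partial>lborel \<partial>lborel)"
    by (rule lborel_pair.Fubini') measurable
  also have "\<dots> = (\<integral>\<^sup>+y. (\<integral>\<^sup>+x\<in>E. ?k y x \<partial>lborel) * G y \<partial>lborel)"
  proof (intro nn_integral_cong)
    fix y
    show "(\<integral>\<^sup>+x. ?k x y * G y * indicator E x \<partial>lborel) = (\<integral>\<^sup>+x\<in>E. ?k y x \<partial>lborel) * G y"
      by (subst nn_integral_multc[symmetric]) (auto intro!: nn_integral_cong simp: mult_ac norm_minus_commute)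
  qed
  also have "\<dots> \<le> (\<integral>\<^sup>+y. ennreal (kernel_const TYPE('d) * V powr (1 / real CARD('d))) * G y \<partial>lborel)"
    by (intro nn_integral_mono mult_right_mono riesz_kernel_set assms) auto
  finally show ?thesis by (simp add: nn_integral_cmult)
qed

text \<open>If the level set had a measure \<open>V > t\<close>, integrating the potential over it
  would give \<open>t^(1/d-1) <= V^(1/d-1)\<close>, against the strict decrease of this negative
  power.\<close>

lemma riesz_weak_type:
  fixes G :: "real ^ 'd::finite \<Rightarrow> ennreal"
  assumes [measurable]: "G \<in> borel_measurable borel" and t: "0 < t" and d: "2 \<le> CARD('d)"
  defines "lam \<equiv> ennreal (kernel_const TYPE('d) * t powr (1 / real CARD('d) - 1)) * (\<integral>\<^sup>+y. G y \<partial>lborel)"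
  shows "emeasure lborel {x. lam < riesz G x} \<le> ennreal t"
proof (cases "(\<integral>\<^sup>+y. G y \<partial>lborel)")
  case top
  have "lam = top"
    unfolding lam_def top using t kernel_const_pos[where ?'d='d] by (auto simp: ennreal_mult_top)
  then show ?thesis by simp
next
  case (real A)
  let ?c = "kernel_const TYPE('d)"
  have c: "1 \<le> ?c" by (rule kernel_const_pos)
  show ?thesis
  proof (cases "A = 0")
    case True
    then have "AE y in lborel. G y = 0"
      using real by (simp add: nn_integral_0_iff_AE)
    then have "riesz G x \<le> riesz (\<lambda>_. 0) x" for x
      by (intro riesz_mono_AE) auto
    then have "riesz G x = 0" for x by (simp add: riesz_def)
    then show ?thesis by simp
  next
    case False
    with real have A: "0 < A" by simp
    define l where "l = ?c * t powr (1 / real CARD('d) - 1) * A"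
    have l: "lam = ennreal l" "0 < l"
      unfolding lam_def l_def using real A c t by (auto simp: ennreal_mult)
    \<comment> \<open>Intersecting with balls makes the measure finite, so that one may divide by
      it.\<close>
    define B where "B n = {x. lam < riesz G x} \<inter> ball 0 (real n)" for n
    have [measurable]: "B n \<in> sets borel" for n unfolding B_def by measurable
    have "emeasure lborel (B n) \<le> ennreal t" for n
    proof (rule ccontr)
      assume not: "\<not> emeasure lborel (B n) \<le> ennreal t"
      have "emeasure lborel (B n) \<le> emeasure lborel (ball 0 (real n) :: (real ^ 'd) set)"
        by (intro emeasure_mono) (auto simp: B_def)
      then obtain V where V: "emeasure lborel (B n) = ennreal V" "0 \<le> V"
        by (cases "emeasure lborel (B n)") (auto simp: emeasure_ball top_unique)
      with not have tV: "t < V" by (auto simp: ennreal_leI not_le[symmetric])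
      have "ennreal (l * V) = (\<integral>\<^sup>+x\<in>B n. lam \<partial>lborel)"
        using V l by (simp add: nn_integral_cmult_indicator ennreal_mult)
      also have "\<dots> \<le> (\<integral>\<^sup>+x\<in>B n. riesz G x \<partial>lborel)"
        by (intro nn_integral_mono) (auto simp: B_def split: split_indicator)
      also have "\<dots> \<le> ennreal (?c * V powr (1 / real CARD('d))) * ennreal A"
        using nn_integral_riesz[of G "B n" V] V tV t d real by simp
      finally have "l * V \<le> ?c * V powr (1 / real CARD('d)) * A"
        using A c V by (simp add: ennreal_mult[symmetric])
      then have "t powr (1 / real CARD('d) - 1) * V \<le> V powr (1 / real CARD('d))"
        using A c unfolding l_def by (simp add: mult_ac)
      then have "t powr (1 / real CARD('d) - 1) \<le> V powr (1 / real CARD('d) - 1)"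
        using tV t by (simp add: powr_diff pos_le_divide_eq)
      moreover have "V powr (1 / real CARD('d) - 1) < t powr (1 / real CARD('d) - 1)"
        using tV t d by (intro powr_less_mono2_neg) auto
      ultimately show False by simp
    qed
    moreover have "{x. lam < riesz G x} = (\<Union>n. B n)"
      by (auto simp: B_def) (metis dist_0_norm mem_ball reals_Archimedean2)
    moreover have "emeasure lborel (\<Union>n. B n) = (SUP n. emeasure lborel (B n))"
      by (intro SUP_emeasure_incseq[symmetric]) (auto simp: incseq_def B_def)
    ultimately show ?thesis by (auto intro: SUP_least)
  qed
qed

text \<open>Dyadic decomposition of \<open>G\<close> along its level sets at the heights \<open>G\<^sup>*(2\<^sup>j t)\<close>.\<close>

lemma level_sets_low:
  fixes a :: "real \<Rightarrow> ennreal"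
  assumes "G x \<le> a t"
  shows "G x \<le> a (2 ^ J * t) + (\<Sum>j<J. a (2 ^ j * t) * indicator {x. a (2 ^ Suc j * t) < G x} x)"
proof (induction J)
  case (Suc J)
  show ?case
  proof (cases "G x \<le> a (2 ^ Suc J * t)")
    case False
    then show ?thesis using Suc by (simp add: not_le add.commute add_increasing)
  qed (simp add: add_increasing2 del: power_Suc)
qed (use assms in simp)

text \<open>The second hypothesis excludes points that exceed every level. They form a null set,
  because the levels belong to measures shrinking to 0.\<close>

lemma level_sets_high:
  fixes a :: "real \<Rightarrow> ennreal"
  assumes "a t < G x" "G x \<le> a ((1 / 2) ^ i * t)"
  shows "G x \<le> (\<Sum>i. a ((1 / 2) ^ Suc i * t) * indicator {x. a ((1 / 2) ^ i * t) < G x} x)"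
proof -
  define m where "m = (LEAST m. G x \<le> a ((1 / 2) ^ m * t))"
  have m: "G x \<le> a ((1 / 2) ^ m * t)"
    unfolding m_def by (rule LeastI[of _ i]) (rule assms)
  have "m \<noteq> 0" using m assms(1) by (intro notI) auto
  then obtain n where n: "m = Suc n" by (cases m) auto
  have "a ((1 / 2) ^ n * t) < G x"
    using not_less_Least[of n "\<lambda>m. G x \<le> a ((1 / 2) ^ m * t)"] n unfolding m_def[symmetric] by simp
  then have "G x \<le> a ((1 / 2) ^ Suc n * t) * indicator {x. a ((1 / 2) ^ n * t) < G x} x"
    using m unfolding n by simp
  also have "\<dots> \<le> (\<Sum>i. a ((1 / 2) ^ Suc i * t) * indicator {x. a ((1 / 2) ^ i * t) < G x} x)"
    by (rule ennreal_le_suminf[of "\<lambda>i. a ((1 / 2) ^ Suc i * t) * indicator {x. a ((1 / 2) ^ i * t) < G x} x"])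
  finally show ?thesis .
qed

text \<open>For decreasing \<open>a\<close> this is twice an upper dyadic sum for the Hardy average
  \<open>(1/t)\<close> times the integral of \<open>a\<close> over \<open>(0, t)\<close>.\<close>

definition tail_sum :: "(real \<Rightarrow> ennreal) \<Rightarrow> real \<Rightarrow> ennreal" where
  "tail_sum a t = (\<Sum>i. ennreal ((1 / 2) ^ i) * a ((1 / 2) ^ Suc i * t))"

lemma emeasure_completion_borel: "S \<in> sets M \<Longrightarrow> emeasure (completion M) S = emeasure M S"
  by (simp add: emeasure_completion)

lemma emeasure_level:
  fixes G :: "real ^ 'd::finite \<Rightarrow> ennreal"
  assumes [measurable]: "G \<in> borel_measurable borel"
  shows "emeasure lborel {x. rearrangement UNIV G t < G x} \<le> ennreal t"
proof -
  have "G \<in> borel_measurable lebesgue" by (rule measurable_completion) simp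
  from emeasure_rearrangement_UNIV_le[OF this, of t] show ?thesis
    by (subst (asm) emeasure_completion_borel) simp_all
qed

lemma nn_integral_high_part:
  fixes G :: "real ^ 'd::finite \<Rightarrow> ennreal"
  assumes [measurable]: "G \<in> borel_measurable borel" and t: "0 < t"
  defines "a \<equiv> rearrangement UNIV G"
  shows "(\<integral>\<^sup>+x\<in>{x. a t < G x}. G x \<partial>lborel) \<le> ennreal t * tail_sum a t"
proof -
  define F where "F i = {x. a ((1 / 2) ^ i * t) < G x}" for i
  have [measurable]: "F i \<in> sets borel" for i unfolding F_def by measurable
  have F: "emeasure lborel (F i) \<le> ennreal ((1 / 2) ^ i * t)" for i
    unfolding F_def a_def by (rule emeasure_level) simp
  \<comment> \<open>Points above all levels lie in sets of measure at most \<open>2^(-i) t\<close>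
    for every \<open>i\<close>, hence in a null set, and elsewhere \<open>level_sets_high\<close>
    applies.\<close>
  have "emeasure lborel (\<Inter>i. F i) \<le> ennreal e" if e: "0 < e" for e
  proof -
    obtain i where "(1 / 2 :: real) ^ i < e / t"
      using real_arch_pow_inv[of "e / t" "1 / 2"] e t by auto
    then have "(1 / 2) ^ i * t \<le> e" using t by (simp add: field_simps)
    have "emeasure lborel (\<Inter>i. F i) \<le> emeasure lborel (F i)"
      by (intro emeasure_mono) auto
    also note F also have "ennreal ((1 / 2) ^ i * t) \<le> ennreal e"
      by (rule ennreal_leI) fact
    finally show ?thesis .
  qed
  then have "emeasure lborel (\<Inter>i. F i) \<le> 0"
    by - (rule ennreal_le_epsilon, simp del: INT_iff)
  then have "emeasure lborel (\<Inter>i. F i) = 0" by (simp only: le_zero_eq)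
  moreover have "(\<Inter>i. F i) \<in> sets lborel" by (intro sets.countable_INT'') auto
  ultimately have null: "AE x in lborel. x \<notin> (\<Inter>i. F i)"
    by (intro AE_not_in null_setsI)
  have "(\<integral>\<^sup>+x\<in>{x. a t < G x}. G x \<partial>lborel) \<le>
      (\<integral>\<^sup>+x. (\<Sum>i. a ((1 / 2) ^ Suc i * t) * indicator (F i) x) \<partial>lborel)"
  proof (rule nn_integral_mono_AE)
    show "AE x in lborel. G x * indicator {x. a t < G x} x \<le> (\<Sum>i. a ((1 / 2) ^ Suc i * t) * indicator (F i) x)"
      using null
    proof eventually_elim
      case (elim x)
      then obtain i where "G x \<le> a ((1 / 2) ^ i * t)" by (auto simp: F_def not_less)
      then show ?case using level_sets_high[of a t G x i] by (simp add: F_def split: split_indicator)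
    qed
  qed
  also have "\<dots> = (\<Sum>i. \<integral>\<^sup>+x. a ((1 / 2) ^ Suc i * t) * indicator (F i) x \<partial>lborel)"
    by (rule nn_integral_suminf) measurable
  also have "\<dots> = (\<Sum>i. a ((1 / 2) ^ Suc i * t) * emeasure lborel (F i))"
    by (intro suminf_cong nn_integral_cmult_indicator) simp
  also have "\<dots> \<le> (\<Sum>i. ennreal t * (ennreal ((1 / 2) ^ i) * a ((1 / 2) ^ Suc i * t)))"
  proof (intro suminf_le)
    fix i
    have "a ((1 / 2) ^ Suc i * t) * emeasure lborel (F i) \<le> a ((1 / 2) ^ Suc i * t) * ennreal ((1 / 2) ^ i * t)"
      by (intro mult_left_mono F) simp
    then show "a ((1 / 2) ^ Suc i * t) * emeasure lborel (F i) \<le> ennreal t * (ennreal ((1 / 2) ^ i) * a ((1 / 2) ^ Suc i * t))"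
      using t by (simp add: ennreal_mult mult_ac del: power_Suc)
  qed auto
  finally show ?thesis by (simp add: tail_sum_def)
qed

text \<open>The part of \<open>G\<close> above the height \<open>a t\<close> has integral at most
  \<open>t * tail_sum a t\<close>. The weak-type bound at measure \<open>t\<close> multiplies this
  by \<open>t^(1/d-1)\<close>.\<close>

lemma riesz_high_part:
  fixes G :: "real ^ 'd::finite \<Rightarrow> ennreal"
  assumes [measurable]: "G \<in> borel_measurable borel" and t: "0 < t" and d: "2 \<le> CARD('d)"
  defines "a \<equiv> rearrangement UNIV G"
  obtains B where "B \<in> sets borel" "emeasure lborel B \<le> ennreal t"
    "\<And>x. x \<notin> B \<Longrightarrow> riesz (\<lambda>x. G x * indicator {x. a t < G x} x) x
        \<le> ennreal (kernel_const TYPE('d) * t powr (1 / real CARD('d))) * tail_sum a t"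
proof -
  let ?H = "\<lambda>x. G x * indicator {x. a t < G x} x"
  let ?l = "ennreal (kernel_const TYPE('d) * t powr (1 / real CARD('d) - 1)) * (\<integral>\<^sup>+y. ?H y \<partial>lborel)"
  have "?l \<le> ennreal (kernel_const TYPE('d) * t powr (1 / real CARD('d) - 1)) * (ennreal t * tail_sum a t)"
    unfolding a_def by (intro mult_left_mono nn_integral_high_part assms) auto
  also have "\<dots> = ennreal (kernel_const TYPE('d) * t powr (1 / real CARD('d))) * tail_sum a t"
    using t kernel_const_pos[where ?'d='d] by (simp add: mult.assoc[symmetric] ennreal_mult[symmetric] powr_diff)
  finally have "riesz ?H x \<le> ennreal (kernel_const TYPE('d) * t powr (1 / real CARD('d))) * tail_sum a t"
    if "x \<notin> {x. ?l < riesz ?H x}" for x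
    using that by (auto simp: not_less)
  then show ?thesis
    using riesz_weak_type[of ?H t] t d by (intro that[of "{x. ?l < riesz ?H x}"]) auto
qed

definition riesz_bound :: "real \<Rightarrow> (real \<Rightarrow> ennreal) \<Rightarrow> real \<Rightarrow> ennreal" where
  "riesz_bound D a t = ennreal (t powr (1 / D)) *
     ((\<Sum>j. ennreal ((2 ^ j) powr (1 / D)) * a (2 ^ j * t)) + tail_sum a t)"

definition fracmax_bound :: "real \<Rightarrow> (real \<Rightarrow> ennreal) \<Rightarrow> real \<Rightarrow> ennreal" where
  "fracmax_bound D a t = ennreal (t powr (1 / D)) *
     ((SUP j. ennreal ((2 ^ j) powr (1 / D)) * a (2 ^ j * t)) + tail_sum a t)"

lemma rearrangement_riesz:
  fixes G :: "real ^ 'd::finite \<Rightarrow> ennreal"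
  assumes [measurable]: "G \<in> borel_measurable borel" and t: "0 < t" and d: "2 \<le> CARD('d)"
  shows "rearrangement UNIV (riesz G) t
    \<le> ennreal (2 * kernel_const TYPE('d)) * riesz_bound (real CARD('d)) (rearrangement UNIV G) t"
proof -
  define a where "a = rearrangement UNIV G"
  define c where "c = kernel_const TYPE('d)"
  let ?D = "real CARD('d)"
  have c: "1 \<le> c" unfolding c_def by (rule kernel_const_pos)
  let ?S = "\<Sum>j. ennreal ((2 ^ j) powr (1 / ?D)) * a (2 ^ j * t)"
  show ?thesis
  proof (cases "?S = top")
    case True
    then show ?thesis using t c
      unfolding riesz_bound_def a_def[symmetric] c_def[symmetric] True by (simp add: ennreal_mult_top)
  next
    case False
    \<comment> \<open>When the series is infinite nothing has to be shown. When it is finite its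
      terms tend to 0, hence so do the levels, and the layers exhaust the part of \<open>G\<close>
      below \<open>a t\<close>.\<close>
    have lim: "(\<lambda>j. a (2 ^ j * t)) \<longlonglongrightarrow> 0"
    proof (rule tendsto_sandwich[where f="\<lambda>_. 0" and h="\<lambda>j. ennreal ((2 ^ j) powr (1 / ?D)) * a (2 ^ j * t)"])
      have "(\<lambda>j. ennreal ((2 ^ j) powr (1 / ?D)) * a (2 ^ j * t)) \<longlonglongrightarrow> 0"
      proof -
        obtain f where f: "\<And>j. ennreal ((2 ^ j) powr (1 / ?D)) * a (2 ^ j * t) = ennreal (f j)" "\<And>j. 0 \<le> f j"
        proof -
          have "ennreal ((2 ^ j) powr (1 / ?D)) * a (2 ^ j * t) \<noteq> top" for j
            using ennreal_le_suminf[of "\<lambda>j. ennreal ((2 ^ j) powr (1 / ?D)) * a (2 ^ j * t)" j] False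
            by (auto simp: top_unique)
          then show ?thesis
            using that[of "\<lambda>j. enn2real (ennreal ((2 ^ j) powr (1 / ?D)) * a (2 ^ j * t))"]
            by (auto simp: less_top)
        qed
        have "summable f" using False unfolding f(1) by (intro summable_suminf_not_top f(2)) auto
        then have "(\<lambda>j. ennreal (f j)) \<longlonglongrightarrow> ennreal 0"
          by (intro tendsto_ennrealI summable_LIMSEQ_zero)
        then show ?thesis unfolding f(1) by simp
      qed
      then show "(\<lambda>j. ennreal ((2 ^ j) powr (1 / ?D)) * a (2 ^ j * t)) \<longlonglongrightarrow> 0" .
      have *: "a (2 ^ j * t) \<le> ennreal ((2 ^ j) powr (1 / ?D)) * a (2 ^ j * t)" for j
        using mult_right_mono[of 1 "ennreal ((2 ^ j) powr (1 / ?D))" "a (2 ^ j * t)"]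
        by (simp add: ge_one_powr_ge_zero)
      show "\<forall>\<^sub>F j in sequentially. a (2 ^ j * t) \<le> ennreal ((2 ^ j) powr (1 / ?D)) * a (2 ^ j * t)"
        by (intro always_eventually allI *)
    qed auto
    define F where "F j = {x. a (2 ^ Suc j * t) < G x}" for j
    have [measurable]: "F i \<in> sets borel" for i unfolding F_def by measurable
    have F: "emeasure lborel (F i) \<le> ennreal (2 ^ Suc i * t)" for i
      unfolding F_def a_def by (rule emeasure_level) simp
    let ?H = "\<lambda>x. G x * indicator {x. a t < G x} x"
    let ?L = "\<lambda>x. \<Sum>j. a (2 ^ j * t) * indicator (F j) x"
    have "G x \<le> ?L x + ?H x" for x
    proof (cases "G x \<le> a t")
      case True
      have "G x \<le> a (2 ^ J * t) + ?L x" for J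
        unfolding F_def by (rule order_trans[OF level_sets_low[of G x a t J, OF True]])
          (intro add_left_mono sum_le_suminf summableI, simp_all)
      moreover have "(\<lambda>J. a (2 ^ J * t) + ?L x) \<longlonglongrightarrow> 0 + ?L x"
        by (intro tendsto_add lim tendsto_const)
      ultimately have "G x \<le> 0 + ?L x"
        by (intro LIMSEQ_le_const) auto
      then show ?thesis by (simp add: add_increasing2)
    qed (simp add: not_le)
    then have "riesz G x \<le> riesz (\<lambda>x. ?L x + ?H x) x" for x
      by (intro riesz_mono_AE) auto
    also have "riesz (\<lambda>x. ?L x + ?H x) x = riesz ?L x + riesz ?H x" for x
      by (rule riesz_add) measurable
    finally have GLH: "riesz G x \<le> riesz ?L x + riesz ?H x" for x .
    \<comment> \<open>This bound holds at every \<open>x\<close>: each layer is a constant on a set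
      of measure at most \<open>2^(j+1) t\<close>, to which \<open>riesz_kernel_set\<close> applies.
      Only the high part needs an exceptional set.\<close>
    have L: "riesz ?L x \<le> ennreal (2 * c * t powr (1 / ?D)) * ?S" for x
    proof -
      let ?k = "\<lambda>y. ennreal (norm (x - y) powr (1 - ?D))"
      have "riesz ?L x = (\<integral>\<^sup>+y. (\<Sum>j. a (2 ^ j * t) * (?k y * indicator (F j) y)) \<partial>lborel)"
        unfolding riesz_def ennreal_suminf_cmult[symmetric] by (simp only: mult.left_commute)
      also have "\<dots> = (\<Sum>j. \<integral>\<^sup>+y. a (2 ^ j * t) * (?k y * indicator (F j) y) \<partial>lborel)"
        by (rule nn_integral_suminf) measurable
      also have "\<dots> = (\<Sum>j. a (2 ^ j * t) * (\<integral>\<^sup>+y\<in>F j. ?k y \<partial>lborel))"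
        by (intro suminf_cong nn_integral_cmult) measurable
      also have "\<dots> \<le> (\<Sum>j. a (2 ^ j * t) * ennreal (c * (2 ^ Suc j * t) powr (1 / ?D)))"
        unfolding c_def using t by (intro suminf_le mult_left_mono riesz_kernel_set F d) auto
      also have "\<dots> \<le> (\<Sum>j. ennreal (2 * c * t powr (1 / ?D)) * (ennreal ((2 ^ j) powr (1 / ?D)) * a (2 ^ j * t)))"
      proof (intro suminf_le)
        fix j
        have "(2 ^ Suc j * t) powr (1 / ?D) = 2 powr (1 / ?D) * (2 ^ j) powr (1 / ?D) * t powr (1 / ?D)"
          using t by (simp add: powr_mult)
        also have "\<dots> \<le> 2 powr 1 * (2 ^ j) powr (1 / ?D) * t powr (1 / ?D)"
          using d by (intro mult_right_mono powr_mono) auto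
        finally have "c * (2 ^ Suc j * t) powr (1 / ?D) \<le> 2 * c * t powr (1 / ?D) * (2 ^ j) powr (1 / ?D)"
          using mult_left_mono[of _ _ c] c by (simp add: mult_ac)
        then have "ennreal (c * (2 ^ Suc j * t) powr (1 / ?D)) \<le> ennreal (2 * c * t powr (1 / ?D)) * ennreal ((2 ^ j) powr (1 / ?D))"
          using c by (subst ennreal_mult[symmetric]) (auto intro: ennreal_leI)
        then show "a (2 ^ j * t) * ennreal (c * (2 ^ Suc j * t) powr (1 / ?D)) \<le> ennreal (2 * c * t powr (1 / ?D)) * (ennreal ((2 ^ j) powr (1 / ?D)) * a (2 ^ j * t))"
          by (subst mult.assoc[symmetric], subst (2) mult.commute) (intro mult_left_mono, simp_all only: zero_le)
      qed auto
      finally show ?thesis by simp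
    qed
    obtain B where B: "B \<in> sets borel" "emeasure lborel B \<le> ennreal t"
      "\<And>x. x \<notin> B \<Longrightarrow> riesz ?H x \<le> ennreal (c * t powr (1 / ?D)) * tail_sum a t"
      using riesz_high_part[OF assms] unfolding a_def c_def by blast
    show ?thesis
    proof (rule rearrangement_leI[of B])
      show "B \<in> sets lebesgue" "emeasure lebesgue B \<le> ennreal t" using B by auto
      fix x assume "x \<notin> B"
      have "riesz G x \<le> ennreal (2 * c * t powr (1 / ?D)) * ?S + ennreal (c * t powr (1 / ?D)) * tail_sum a t"
        by (rule order_trans[OF GLH add_mono[OF L B(3)]]) fact
      also have "\<dots> \<le> ennreal (2 * c * t powr (1 / ?D)) * ?S + ennreal (2 * c * t powr (1 / ?D)) * tail_sum a t"
        using c by (intro add_mono mult_right_mono ennreal_leI) auto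
      also have "\<dots> = ennreal (2 * kernel_const TYPE('d)) * riesz_bound ?D (rearrangement UNIV G) t"
        using c by (simp add: riesz_bound_def a_def[symmetric] c_def[symmetric] ennreal_mult distrib_left mult.assoc)
      finally show "riesz G x \<le> ennreal (2 * kernel_const TYPE('d)) * riesz_bound ?D (rearrangement UNIV G) t" .
    qed
  qed
qed

section \<open>Cubes and the fractional maximal function\<close>

definition side_cube :: "real ^ 'd::finite \<Rightarrow> real \<Rightarrow> (real ^ 'd) set" where
  "side_cube a l = cbox a (a + (\<chi> i. l))"

lemma is_cube_iff: "is_cube Q \<longleftrightarrow> (\<exists>a l. 0 < l \<and> Q = side_cube a l)"
  by (simp add: is_cube_def side_cube_def)

lemma side_cube_borel [measurable]: "side_cube a l \<in> sets borel"
  by (simp add: side_cube_def)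

lemma mem_side_cube: "x \<in> side_cube a l \<longleftrightarrow> (\<forall>i. a $ i \<le> x $ i \<and> x $ i \<le> a $ i + l)"
  by (auto simp: side_cube_def mem_box_cart)

lemma emeasure_side_cube: "0 < l \<Longrightarrow> emeasure lborel (side_cube (a :: real ^ 'd::finite) l) = ennreal (l ^ CARD('d))"
proof -
  assume l: "0 < l"
  have b: "(\<chi> i. l) \<bullet> b = l" if "b \<in> Basis" for b :: "real ^ 'd"
    using that by (auto simp: Basis_vec_def inner_axis)
  have "emeasure lborel (side_cube a l) = ennreal (\<Prod>b\<in>(Basis :: (real ^ 'd) set). (\<chi> i. l) \<bullet> b)"
    unfolding side_cube_def using l by (subst emeasure_lborel_cbox) (auto simp: b inner_add_left)
  also have "(\<Prod>b\<in>(Basis :: (real ^ 'd) set). (\<chi> i. l) \<bullet> b) = (\<Prod>b\<in>(Basis :: (real ^ 'd) set). l)"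
    by (intro prod.cong refl b)
  finally show ?thesis by simp
qed

lemma side_cube_diameter:
  fixes x y :: "real ^ 'd::finite"
  assumes "x \<in> side_cube a l" "y \<in> side_cube a l"
  shows "norm (x - y) \<le> real CARD('d) * l"
proof -
  have "norm (x - y) \<le> (\<Sum>i\<in>UNIV. \<bar>(x - y) $ i\<bar>)" by (rule norm_le_l1_cart)
  also have "\<dots> \<le> (\<Sum>i\<in>(UNIV :: 'd set). l)"
  proof (rule sum_mono)
    fix i
    show "\<bar>(x - y) $ i\<bar> \<le> l"
      using assms[unfolded mem_side_cube, THEN spec[of _ i]] by auto
  qed
  finally show ?thesis by simp
qed

definition frac_max :: "(real ^ 'd::finite \<Rightarrow> ennreal) \<Rightarrow> real ^ 'd \<Rightarrow> ennreal" where
  "frac_max G x = (SUP (a, l)\<in>{(a, l). 0 < l \<and> x \<in> side_cube a l}.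
     ennreal (l powr (1 - real CARD('d))) * (\<integral>\<^sup>+y\<in>side_cube a l. G y \<partial>lborel))"

lemma frac_max_upper:
  "0 < l \<Longrightarrow> x \<in> side_cube a l \<Longrightarrow>
    ennreal (l powr (1 - real CARD('d))) * (\<integral>\<^sup>+y\<in>side_cube a l. G y \<partial>lborel) \<le> frac_max G (x :: real ^ 'd::finite)"
  unfolding frac_max_def by (rule SUP_upper2[of "(a, l)"]) auto

text \<open>Two points of the cube have distance at most \<open>d l\<close>, so on the cube the
  kernel centred at \<open>x\<close> is at least \<open>(d l)^(1-d)\<close>.\<close>

lemma cube_integral_le_riesz:
  fixes x :: "real ^ 'd::finite"
  assumes [measurable]: "G \<in> borel_measurable borel" and l: "0 < l" and x: "x \<in> side_cube a l" and d: "2 \<le> CARD('d)"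
  shows "ennreal (l powr (1 - real CARD('d))) * (\<integral>\<^sup>+y\<in>side_cube a l. G y \<partial>lborel)
    \<le> ennreal (real CARD('d) powr (real CARD('d) - 1)) * riesz G x"
proof -
  let ?D = "real CARD('d)"
  have "ennreal (l powr (1 - ?D)) * (\<integral>\<^sup>+y\<in>side_cube a l. G y \<partial>lborel) =
      (\<integral>\<^sup>+y. ennreal (l powr (1 - ?D)) * (G y * indicator (side_cube a l) y) \<partial>lborel)"
    by (rule nn_integral_cmult[symmetric]) measurable
  also have "\<dots> \<le> (\<integral>\<^sup>+y. ennreal (?D powr (?D - 1)) * (ennreal (norm (x - y) powr (1 - ?D)) * G y) \<partial>lborel)"
  proof (rule nn_integral_mono_AE)
    \<comment> \<open>At \<open>y = x\<close> the kernel has the value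
      \<open>0 powr (1 - d) = 0\<close>, so the comparison can fail at that one point.\<close>
    show "AE y in lborel. ennreal (l powr (1 - ?D)) * (G y * indicator (side_cube a l) y)
        \<le> ennreal (?D powr (?D - 1)) * (ennreal (norm (x - y) powr (1 - ?D)) * G y)"
      using AE_lborel_singleton[of x]
    proof eventually_elim
      case (elim y)
      show ?case
      proof (cases "y \<in> side_cube a l")
        case True
        then have "norm (x - y) \<le> ?D * l" by (intro side_cube_diameter[OF x])
        then have "(?D * l) powr (1 - ?D) \<le> norm (x - y) powr (1 - ?D)"
          using d l elim by (intro powr_mono2') auto
        then have "?D powr (?D - 1) * (?D * l) powr (1 - ?D) \<le> ?D powr (?D - 1) * norm (x - y) powr (1 - ?D)"
          by (intro mult_left_mono) auto
        also have "?D powr (?D - 1) * (?D * l) powr (1 - ?D) = l powr (1 - ?D)"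
        proof -
          have "?D powr (?D - 1) * (?D * l) powr (1 - ?D) = ?D powr (?D - 1 + (1 - ?D)) * l powr (1 - ?D)"
            using l by (simp add: powr_mult powr_add[symmetric] mult.assoc[symmetric] del: powr_zero_eq_one) 
          then show ?thesis using d by simp
        qed
        finally have "ennreal (l powr (1 - ?D)) \<le> ennreal (?D powr (?D - 1)) * ennreal (norm (x - y) powr (1 - ?D))"
          by (subst ennreal_mult[symmetric]) (auto intro: ennreal_leI)
        then show ?thesis using True by (simp add: mult.assoc[symmetric] mult_right_mono)
      qed auto
    qed
  qed
  also have "\<dots> = ennreal (?D powr (?D - 1)) * riesz G x"
    unfolding riesz_def by (rule nn_integral_cmult) measurable
  finally show ?thesis .
qed

text \<open>The part of \<open>G\<close> below the height \<open>G\<^sup>*(t)\<close>: only the dyadic levels \<open>2\<^sup>j t\<close> up to the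
  measure of the cube matter, and their contributions form a geometric series.\<close>

lemma cube_integral_low_part:
  fixes G :: "real ^ 'd::finite \<Rightarrow> ennreal"
  assumes [measurable]: "G \<in> borel_measurable borel" and t: "0 < t" and l: "0 < l" and d: "2 \<le> CARD('d)"
  defines "a \<equiv> rearrangement UNIV G"
  shows "ennreal (l powr (1 - real CARD('d))) * (\<integral>\<^sup>+y\<in>side_cube z l. G y * indicator {y. G y \<le> a t} y \<partial>lborel)
    \<le> ennreal (20 * t powr (1 / real CARD('d))) * (SUP j. ennreal ((2 ^ j) powr (1 / real CARD('d))) * a (2 ^ j * t))"
proof -
  let ?D = "real CARD('d)"
  define S where "S = (SUP j. ennreal ((2 ^ j) powr (1 / ?D)) * a (2 ^ j * t))"
  have aS: "a (2 ^ j * t) \<le> ennreal ((2 ^ j) powr (- 1 / ?D)) * S" for j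
  proof -
    have "ennreal ((2 ^ j) powr (- 1 / ?D)) * (ennreal ((2 ^ j) powr (1 / ?D)) * a (2 ^ j * t)) \<le> ennreal ((2 ^ j) powr (- 1 / ?D)) * S"
      unfolding S_def by (intro mult_left_mono SUP_upper) auto
    then show ?thesis by (simp add: mult.assoc[symmetric] ennreal_mult[symmetric] powr_add[symmetric])
  qed
  \<comment> \<open>The first dyadic level whose measure reaches that of the cube. The remainder
    below \<open>a (2 ^ J * t)\<close> is integrated over the whole cube, the layers with
    \<open>j < J\<close> over their own level sets.\<close>
  define J where "J = (LEAST J. l ^ CARD('d) \<le> 2 ^ J * t)"
  have "\<exists>J. l ^ CARD('d) / t < 2 ^ J" by (rule real_arch_pow) simp
  then have "\<exists>J. l ^ CARD('d) \<le> 2 ^ J * t" using t by (auto simp: field_simps intro: less_imp_le)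
  then have J: "l ^ CARD('d) \<le> 2 ^ J * t" unfolding J_def by (rule LeastI_ex)
  define F where "F j = {x. a (2 ^ Suc j * t) < G x}" for j
  have [measurable]: "F i \<in> sets borel" for i unfolding F_def by measurable
  have F: "emeasure lborel (F i) \<le> ennreal (2 ^ Suc i * t)" for i
    unfolding F_def a_def by (rule emeasure_level) simp
  let ?Q = "side_cube z l"
  have lD: "l powr ?D = l ^ CARD('d)" using l by (simp add: powr_realpow)
  have "(\<integral>\<^sup>+y\<in>?Q. G y * indicator {y. G y \<le> a t} y \<partial>lborel) \<le>
    (\<integral>\<^sup>+y. a (2 ^ J * t) * indicator ?Q y + (\<Sum>j<J. a (2 ^ j * t) * indicator (F j) y) \<partial>lborel)"
  proof (rule nn_integral_mono)
    fix y
    show "G y * indicator {y. G y \<le> a t} y * indicator ?Q y \<le> a (2 ^ J * t) * indicator ?Q y + (\<Sum>j<J. a (2 ^ j * t) * indicator (F j) y)"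
      using level_sets_low[of G y a t J] unfolding F_def by (cases "y \<in> ?Q"; cases "G y \<le> a t") auto
  qed
  also have "\<dots> = (\<integral>\<^sup>+y. a (2 ^ J * t) * indicator ?Q y \<partial>lborel) + (\<integral>\<^sup>+y. (\<Sum>j<J. a (2 ^ j * t) * indicator (F j) y) \<partial>lborel)"
    by (rule nn_integral_add) measurable
  also have "(\<integral>\<^sup>+y. (\<Sum>j<J. a (2 ^ j * t) * indicator (F j) y) \<partial>lborel) = (\<Sum>j<J. \<integral>\<^sup>+y. a (2 ^ j * t) * indicator (F j) y \<partial>lborel)"
    by (rule nn_integral_sum) measurable
  also have "\<dots> = (\<Sum>j<J. a (2 ^ j * t) * emeasure lborel (F j))"
    by (intro sum.cong refl nn_integral_cmult_indicator) simp
  also have "(\<integral>\<^sup>+y. a (2 ^ J * t) * indicator ?Q y \<partial>lborel) = a (2 ^ J * t) * ennreal (l ^ CARD('d))"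
    by (subst nn_integral_cmult_indicator) (auto simp: emeasure_side_cube l)
  also have "a (2 ^ J * t) * ennreal (l ^ CARD('d)) + (\<Sum>j<J. a (2 ^ j * t) * emeasure lborel (F j)) \<le>
     ennreal ((2 ^ J) powr (- 1 / ?D)) * S * ennreal (l ^ CARD('d)) +
     (\<Sum>j<J. ennreal ((2 ^ j) powr (- 1 / ?D)) * S * ennreal (2 ^ Suc j * t))"
    by (intro add_mono mult_mono aS F sum_mono order_refl) auto
  also have "\<dots> = (ennreal ((2 ^ J) powr (- 1 / ?D) * l ^ CARD('d)) + ennreal (\<Sum>j<J. (2 ^ j) powr (- 1 / ?D) * (2 ^ Suc j * t))) * S"
    using t l by (simp add: ennreal_mult mult_ac sum_distrib_left distrib_left sum_ennreal[symmetric] del: sum_ennreal power_Suc)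
  also have "\<dots> \<le> (ennreal (t powr (1 / ?D) * l powr (?D - 1)) + ennreal (19 * (t powr (1 / ?D) * l powr (?D - 1)))) * S"
  proof (intro mult_right_mono add_mono ennreal_leI)
    have "(2 ^ J) powr (- 1 / ?D) = (2 ^ J * t) powr (- 1 / ?D) * t powr (1 / ?D)"
      using t by (simp add: powr_mult powr_minus)
    also have "\<dots> \<le> (l powr ?D) powr (- 1 / ?D) * t powr (1 / ?D)"
      unfolding lD using J l d by (intro mult_right_mono powr_mono2') auto
    also have "\<dots> = t powr (1 / ?D) / l"
      using l d by (simp add: powr_powr powr_minus field_simps)
    finally have "(2 ^ J) powr (- 1 / ?D) * l ^ CARD('d) \<le> t powr (1 / ?D) / l * l ^ CARD('d)"
      using l by (intro mult_right_mono) auto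
    then show "(2 ^ J) powr (- 1 / ?D) * l ^ CARD('d) \<le> t powr (1 / ?D) * l powr (?D - 1)"
      using l by (simp add: powr_diff lD)
    define q where "q = 2 powr (1 - 1 / ?D)"
    \<comment> \<open>The ratio of the geometric sum is kept away from 1: \<open>d >= 2\<close>
      gives \<open>q >= sqrt 2 >= 7/5\<close>, hence \<open>q - 1 >= 2/5\<close> whatever the
      dimension.\<close>
    have q: "7 / 5 \<le> q" "q \<le> 2"
    proof -
      have "7 / 5 \<le> (2 :: real) powr (1 / 2)"
        using real_le_rsqrt[of "7 / 5" 2] by (simp add: powr_half_sqrt power2_eq_square)
      also have "\<dots> \<le> q" unfolding q_def using d by (intro powr_mono) (auto simp: field_simps)
      finally show "7 / 5 \<le> q" .
      have "q \<le> 2 powr 1" unfolding q_def by (intro powr_mono) auto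
      then show "q \<le> 2" by simp
    qed
    have qj: "q ^ j = (2 ^ j) powr (1 - 1 / ?D)" for j
      unfolding q_def by (simp add: powr_powr powr_realpow[symmetric] mult.commute)
    have "(\<Sum>j<J. (2 ^ j) powr (- 1 / ?D) * (2 ^ Suc j * t)) = (\<Sum>j<J. 2 * t * q ^ j)"
    proof (intro sum.cong refl)
      fix j
      show "(2 ^ j) powr (- 1 / ?D) * (2 ^ Suc j * t) = 2 * t * q ^ j"
        using powr_add[of "2 ^ j :: real" 1 "- 1 / ?D"] unfolding qj by simp
    qed
    also have "\<dots> = 2 * t * (\<Sum>j<J. q ^ j)" by (simp add: sum_distrib_left)
    also have "(\<Sum>j<J. q ^ j) = (q ^ J - 1) / (q - 1)"
      using q by (simp add: geometric_sum)
    also have "2 * t * ((q ^ J - 1) / (q - 1)) \<le> 19 * (t powr (1 / ?D) * l powr (?D - 1))"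
    \<comment> \<open>For \<open>J = 0\<close> the sum is empty. For \<open>J = Suc n\<close> the
      minimality of \<open>J\<close> gives \<open>2^n t < l^d\<close>, which bounds the last and
      dominating term.\<close>
    proof (cases J)
      case (Suc n)
      then have n: "2 ^ n * t < l ^ CARD('d)"
        using not_less_Least[of n "\<lambda>J. l ^ CARD('d) \<le> 2 ^ J * t"] unfolding J_def[symmetric] by simp
      have "q ^ n * t = (2 ^ n * t) powr (1 - 1 / ?D) * t powr (1 / ?D)"
        unfolding qj using t by (simp add: powr_mult powr_diff)
      also have "\<dots> \<le> (l powr ?D) powr (1 - 1 / ?D) * t powr (1 / ?D)"
        unfolding lD using n t d by (intro mult_right_mono powr_mono2) auto
      also have "\<dots> = t powr (1 / ?D) * l powr (?D - 1)"
        using d by (simp add: powr_powr right_diff_distrib)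
      finally have *: "q ^ n * t \<le> t powr (1 / ?D) * l powr (?D - 1)" .
      have "(q ^ J - 1) / (q - 1) \<le> 2 * q ^ n / (2 / 5)"
        using q Suc by (intro frac_le) (auto simp: mult_right_mono intro: order_trans[of _ "q * q ^ n"])
      then have "2 * t * ((q ^ J - 1) / (q - 1)) \<le> 2 * t * (2 * q ^ n / (2 / 5))"
        using t by (intro mult_left_mono) auto
      also have "\<dots> = 10 * (q ^ n * t)" by simp
      also have "\<dots> \<le> 10 * (t powr (1 / ?D) * l powr (?D - 1))" using * by (intro mult_left_mono) auto
      also have "\<dots> \<le> 19 * (t powr (1 / ?D) * l powr (?D - 1))" by (intro mult_right_mono) auto
      finally show ?thesis .
    qed simp
    finally show "(\<Sum>j<J. (2 ^ j) powr (- 1 / ?D) * (2 ^ Suc j * t)) \<le> 19 * (t powr (1 / ?D) * l powr (?D - 1))" .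
  qed auto
  also have "\<dots> = ennreal (20 * (t powr (1 / ?D) * l powr (?D - 1))) * S"
    by (simp add: ennreal_plus[symmetric] mult.commute del: ennreal_plus)
  finally have "ennreal (l powr (1 - ?D)) * (\<integral>\<^sup>+y\<in>?Q. G y * indicator {y. G y \<le> a t} y \<partial>lborel) \<le>
     ennreal (l powr (1 - ?D)) * (ennreal (20 * (t powr (1 / ?D) * l powr (?D - 1))) * S)"
    by (rule mult_left_mono) simp
  also have "\<dots> = ennreal (20 * t powr (1 / ?D)) * S"
  proof -
    have "l powr (1 - ?D) * (20 * (t powr (1 / ?D) * l powr (?D - 1))) = 20 * t powr (1 / ?D)"
      using l by (simp add: powr_diff)
    then show ?thesis
      by (simp only: mult.assoc[symmetric, of _ _ S] ennreal_mult'[symmetric, OF powr_ge_zero])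
  qed
  finally show ?thesis unfolding S_def .
qed

definition frac_const :: "'d::finite itself \<Rightarrow> real" where
  "frac_const _ = 20 + real CARD('d) powr (real CARD('d) - 1) * kernel_const TYPE('d)"

text \<open>\<open>G\<close> is split at the height \<open>a t\<close>. The low part obeys
  \<open>cube_integral_low_part\<close> on every cube, which contributes the 20 in
  \<open>frac_const\<close>; on cubes through \<open>x\<close> the high part is dominated by its
  Riesz potential, and this is small off \<open>B\<close>.\<close>

lemma frac_max_outer_bound:
  fixes G :: "real ^ 'd::finite \<Rightarrow> ennreal"
  assumes [measurable]: "G \<in> borel_measurable borel" and t: "0 < t" and d: "2 \<le> CARD('d)"
  shows "\<exists>B\<in>sets lebesgue. emeasure lebesgue B \<le> ennreal t \<and>
    (\<forall>x. x \<notin> B \<longrightarrow> frac_max G x \<le> ennreal (frac_const TYPE('d)) * fracmax_bound (real CARD('d)) (rearrangement UNIV G) t)"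
proof -
  let ?D = "real CARD('d)"
  define a where "a = rearrangement UNIV G"
  define S where "S = (SUP j. ennreal ((2 ^ j) powr (1 / ?D)) * a (2 ^ j * t))"
  define c where "c = ?D powr (?D - 1) * kernel_const TYPE('d)"
  have c: "0 \<le> c" unfolding c_def using kernel_const_pos[where ?'d='d] by simp
  let ?H = "\<lambda>x. G x * indicator {x. a t < G x} x"
  let ?L = "\<lambda>x. G x * indicator {x. G x \<le> a t} x"
  obtain B where B: "B \<in> sets borel" "emeasure lborel B \<le> ennreal t"
    "\<And>x. x \<notin> B \<Longrightarrow> riesz ?H x \<le> ennreal (kernel_const TYPE('d) * t powr (1 / ?D)) * tail_sum a t"
    using riesz_high_part[OF assms] unfolding a_def by blast
  have "frac_max G x \<le> ennreal (frac_const TYPE('d)) * fracmax_bound ?D a t" if x: "x \<notin> B" for x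
    unfolding frac_max_def
  proof (rule SUP_least, clarify)
    fix z l assume l: "0 < (l :: real)" and z: "x \<in> side_cube z l"
    let ?Q = "side_cube z l"
    have "(\<integral>\<^sup>+y\<in>?Q. G y \<partial>lborel) = (\<integral>\<^sup>+y. ?L y * indicator ?Q y + ?H y * indicator ?Q y \<partial>lborel)"
      by (intro nn_integral_cong) (auto split: split_indicator)
    also have "\<dots> = (\<integral>\<^sup>+y\<in>?Q. ?L y \<partial>lborel) + (\<integral>\<^sup>+y\<in>?Q. ?H y \<partial>lborel)"
      by (rule nn_integral_add) measurable
    finally have "ennreal (l powr (1 - ?D)) * (\<integral>\<^sup>+y\<in>?Q. G y \<partial>lborel) =
        ennreal (l powr (1 - ?D)) * (\<integral>\<^sup>+y\<in>?Q. ?L y \<partial>lborel) + ennreal (l powr (1 - ?D)) * (\<integral>\<^sup>+y\<in>?Q. ?H y \<partial>lborel)"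
      by (simp add: distrib_left)
    also have "\<dots> \<le> ennreal (20 * t powr (1 / ?D)) * S + ennreal (?D powr (?D - 1)) * (ennreal (kernel_const TYPE('d) * t powr (1 / ?D)) * tail_sum a t)"
    proof (rule add_mono)
      show "ennreal (l powr (1 - ?D)) * (\<integral>\<^sup>+y\<in>?Q. ?L y \<partial>lborel) \<le> ennreal (20 * t powr (1 / ?D)) * S"
        unfolding S_def a_def by (rule cube_integral_low_part) fact+
      have "ennreal (l powr (1 - ?D)) * (\<integral>\<^sup>+y\<in>?Q. ?H y \<partial>lborel) \<le> ennreal (?D powr (?D - 1)) * riesz ?H x"
        by (rule cube_integral_le_riesz) (use l z d in auto)
      also have "\<dots> \<le> ennreal (?D powr (?D - 1)) * (ennreal (kernel_const TYPE('d) * t powr (1 / ?D)) * tail_sum a t)"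
        by (intro mult_left_mono B(3) x) auto
      finally show "ennreal (l powr (1 - ?D)) * (\<integral>\<^sup>+y\<in>?Q. ?H y \<partial>lborel) \<le> \<dots>" .
    qed
    also have "\<dots> = ennreal 20 * (ennreal (t powr (1 / ?D)) * S) + ennreal c * (ennreal (t powr (1 / ?D)) * tail_sum a t)"
      using kernel_const_pos[where ?'d='d] by (simp add: c_def ennreal_mult mult.assoc)
    also have "\<dots> \<le> ennreal (20 + c) * (ennreal (t powr (1 / ?D)) * S) + ennreal (20 + c) * (ennreal (t powr (1 / ?D)) * tail_sum a t)"
      using c by (intro add_mono mult_right_mono ennreal_leI) auto
    also have "\<dots> = ennreal (frac_const TYPE('d)) * fracmax_bound ?D a t"
      by (simp add: fracmax_bound_def S_def[symmetric] frac_const_def c_def distrib_left)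
    finally show "ennreal (l powr (1 - ?D)) * (\<integral>\<^sup>+y\<in>?Q. G y \<partial>lborel) \<le> ennreal (frac_const TYPE('d)) * fracmax_bound ?D a t" .
  qed
  then show ?thesis using B(1,2) unfolding a_def by (intro bexI[of _ B]) auto
qed

section \<open>Bounds in the Lorentz functional, uniform in the small parameter\<close>

lemma half_powr_le: 
  fixes x :: real
  assumes "0 \<le> x" "x \<le> 1"
  shows "(1 / 2) powr x \<le> 1 - x / 2"
  using Youngs_inequality_0[of x "1 - x" "1 / 2" 1] assms by simp

lemma half_powr_less_1: "0 < x \<Longrightarrow> (1 / 2 :: real) powr x < 1"
  using powr_less_mono'[of "1 / 2" 0 x] by simp

lemma half_powr: "(1 / 2 :: real) powr x = 2 powr (- x)"
  by (simp add: powr_divide powr_minus_divide)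

lemma two_powr_power: "(2 powr x) ^ n = (2 :: real) powr (x * real n)"
  by (simp add: powr_powr[symmetric] powr_realpow)

lemma half_power: "(1 / 2 :: real) ^ n = 2 powr (- real n)"
  using half_powr[of "real n"] by (simp add: powr_realpow[symmetric])

context lorentz_exponent
begin

text \<open>A discrete Hardy inequality. By dilation the \<open>i\<close>-th term costs
  \<open>2^(-i) 2^((i+1) E)\<close>, at most \<open>2 * 2^(-delta i)\<close>: a geometric series as
  long as \<open>E\<close> stays below 1.\<close>

lemma lorentz_fun_tail_sum:
  assumes [measurable]: "a \<in> borel_measurable borel" and E: "E \<le> 1 - \<delta>" and \<delta>: "0 < \<delta>"
  shows "lorentz_fun E r (tail_sum a) \<le> ennreal (2 / (1 - (1 / 2) powr \<delta>)) * lorentz_fun E r a"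
proof -
  let ?q = "(1 / 2 :: real) powr \<delta>"
  have q: "0 \<le> ?q" "?q < 1" using half_powr_less_1[OF \<delta>] by auto
  have "lorentz_fun E r (tail_sum a) \<le> (\<Sum>i. lorentz_fun E r (\<lambda>t. ennreal ((1 / 2) ^ i) * a ((1 / 2) ^ Suc i * t)))"
    unfolding tail_sum_def by (rule lorentz_fun_suminf) measurable
  also have "\<dots> \<le> (\<Sum>i. ennreal (?q ^ i) * (ennreal 2 * lorentz_fun E r a))"
  proof (intro suminf_le)
    fix i
    have "lorentz_fun E r (\<lambda>t. ennreal ((1 / 2) ^ i) * a ((1 / 2) ^ Suc i * t)) =
        ennreal ((1 / 2) ^ i) * (ennreal (((1 / 2) ^ Suc i) powr - E) * lorentz_fun E r a)"
      by (subst lorentz_fun_cmult, measurable) (subst lorentz_fun_dilate, auto)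
    also have "\<dots> = ennreal ((1 / 2) ^ i * ((1 / 2) ^ Suc i) powr - E) * lorentz_fun E r a"
      by (simp add: mult.assoc[symmetric] ennreal_mult'[symmetric] del: power_Suc)
    also have "\<dots> \<le> ennreal (2 * ?q ^ i) * lorentz_fun E r a"
    proof (intro mult_right_mono ennreal_leI)
      have "(1 / 2) ^ i * ((1 / 2) ^ Suc i) powr - E = 2 powr (E * (real i + 1) - real i)"
        unfolding half_power powr_powr powr_add[symmetric] by (simp add: algebra_simps)
      also have "\<dots> \<le> 2 powr (1 + - \<delta> * real i)"
      proof (rule powr_mono)
        have "E * (real i + 1) \<le> (1 - \<delta>) * (real i + 1)" using E by (intro mult_right_mono) auto
        then show "E * (real i + 1) - real i \<le> 1 + - \<delta> * real i" using \<delta> by (simp add: algebra_simps)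
      qed simp
      also have "\<dots> = 2 * ?q ^ i"
        using powr_add[of 2 1 "- \<delta> * real i"] unfolding half_powr two_powr_power by simp
      finally show "(1 / 2) ^ i * ((1 / 2) ^ Suc i) powr - E \<le> 2 * ?q ^ i" .
    qed simp
    finally show "lorentz_fun E r (\<lambda>t. ennreal ((1 / 2) ^ i) * a ((1 / 2) ^ Suc i * t)) \<le> ennreal (?q ^ i) * (ennreal 2 * lorentz_fun E r a)"
      by (simp add: ennreal_mult' mult_ac)
  qed auto
  also have "\<dots> = ennreal (1 / (1 - ?q)) * (ennreal 2 * lorentz_fun E r a)"
    using q by (simp only: ennreal_suminf_multc suminf_geometric_ennreal)
  also have "\<dots> = ennreal (2 / (1 - ?q)) * lorentz_fun E r a"
    using q by (simp add: mult.assoc[symmetric] ennreal_mult''[symmetric] del: ennreal_numeral)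
  finally show ?thesis .
qed

lemma lorentz_fun_dyadic:
  assumes [measurable]: "a \<in> borel_measurable borel"
  shows "lorentz_fun E r (\<lambda>t. ennreal ((2 ^ j) powr b) * a (2 ^ j * t)) = ennreal (((1 / 2) powr (E - b)) ^ j) * lorentz_fun E r a"
proof -
  have "lorentz_fun E r (\<lambda>t. ennreal ((2 ^ j) powr b) * a (2 ^ j * t)) =
      ennreal ((2 ^ j) powr b) * (ennreal ((2 ^ j) powr - E) * lorentz_fun E r a)"
    by (subst lorentz_fun_cmult, measurable) (subst lorentz_fun_dilate, auto)
  also have "\<dots> = ennreal ((2 ^ j) powr b * (2 ^ j) powr - E) * lorentz_fun E r a"
    by (simp add: mult.assoc[symmetric] ennreal_mult[symmetric])
  also have "(2 ^ j) powr b * (2 ^ j) powr - E = ((1 / 2 :: real) powr (E - b)) ^ j"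
    unfolding half_powr two_powr_power
    by (simp add: powr_realpow[symmetric] powr_powr powr_add[symmetric] algebra_simps)
  finally show ?thesis .
qed

text \<open>Sums of two geometric series: ratio \<open>2^(-1/D)\<close> for the levels
  \<open>2^j t\<close>, ratio \<open>2^(-1/(2D))\<close> for the tail.\<close>

definition riesz_const :: "real \<Rightarrow> real" where
  "riesz_const D = 1 / (1 - (1 / 2) powr (1 / D)) + 2 / (1 - (1 / 2) powr (1 / (2 * D)))"

lemma riesz_const_pos: "0 < D \<Longrightarrow> 0 < riesz_const D"
  unfolding riesz_const_def by (intro add_pos_pos divide_pos_pos) (auto simp: half_powr_less_1)

text \<open>After the shift to the exponent \<open>e + 1/D\<close> the dyadic terms decay like
  \<open>2^(-j e)\<close>. The lower bound on \<open>e\<close> makes their sum uniform, the upper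
  bound does the same for the tail. An exponent \<open>e = epsilon / D\<close> violates the former,
  so the last step needs the maximal function.\<close>

lemma lorentz_fun_riesz_bound:
  assumes [measurable]: "a \<in> borel_measurable borel"
    and D: "0 < D" and e: "1 / D \<le> e" "e + 1 / D \<le> 1 - 1 / (2 * D)"
  shows "lorentz_fun e r (riesz_bound D a) \<le> ennreal (riesz_const D) * lorentz_fun (e + 1 / D) r a"
proof -
  let ?L = "lorentz_fun (e + 1 / D) r"
  let ?q = "(1 / 2 :: real) powr (1 / D)"
  have q: "0 \<le> ?q" "?q < 1" using half_powr_less_1[of "1 / D"] D by auto
  have q2: "0 < 1 - (1 / 2 :: real) powr (1 / (2 * D))" using half_powr_less_1[of "1 / (2 * D)"] D by auto
  have [measurable]: "tail_sum a \<in> borel_measurable borel"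
    unfolding tail_sum_def[abs_def] by measurable
  have "lorentz_fun e r (riesz_bound D a) = ?L (\<lambda>t. (\<Sum>j. ennreal ((2 ^ j) powr (1 / D)) * a (2 ^ j * t)) + tail_sum a t)"
    unfolding riesz_bound_def by (rule lorentz_fun_powr_shift)
  also have "\<dots> \<le> ?L (\<lambda>t. \<Sum>j. ennreal ((2 ^ j) powr (1 / D)) * a (2 ^ j * t)) + ?L (tail_sum a)"
    by (rule lorentz_fun_add) measurable
  also have "\<dots> \<le> (\<Sum>j. ?L (\<lambda>t. ennreal ((2 ^ j) powr (1 / D)) * a (2 ^ j * t))) + ennreal (2 / (1 - (1 / 2) powr (1 / (2 * D)))) * ?L a"
    using e D by (intro add_mono lorentz_fun_suminf lorentz_fun_tail_sum) auto
  also have "(\<Sum>j. ?L (\<lambda>t. ennreal ((2 ^ j) powr (1 / D)) * a (2 ^ j * t))) \<le> (\<Sum>j. ennreal (?q ^ j) * ?L a)"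
  proof (intro suminf_le)
    fix j
    have "(1 / 2 :: real) powr (e + 1 / D - 1 / D) \<le> ?q" using e by (intro powr_mono') auto
    then show "?L (\<lambda>t. ennreal ((2 ^ j) powr (1 / D)) * a (2 ^ j * t)) \<le> ennreal (?q ^ j) * ?L a"
      by (subst lorentz_fun_dyadic, measurable) (intro mult_right_mono ennreal_leI power_mono, auto)
  qed auto
  also have "\<dots> = ennreal (1 / (1 - ?q)) * ?L a"
    using q by (simp only: ennreal_suminf_multc suminf_geometric_ennreal)
  also have "\<dots> + ennreal (2 / (1 - (1 / 2) powr (1 / (2 * D)))) * ?L a = ennreal (riesz_const D) * ?L a"
    using q q2 by (simp add: riesz_const_def distrib_right[symmetric] ennreal_plus[symmetric] del: ennreal_plus)
  finally show ?thesis by (simp add: add_right_mono)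
qed

lemma lorentz_fun_fracmax_bound:
  assumes [measurable]: "a \<in> borel_measurable borel"
    and D: "2 \<le> D" and \<epsilon>: "0 < \<epsilon>" "\<epsilon> \<le> 1 / 2" "\<epsilon> * R \<le> D"
  shows "lorentz_fun (\<epsilon> / D) r (fracmax_bound D a) \<le>
    ennreal ((2 * D + 2 / (1 - (1 / 2) powr (1 / (2 * D)))) * \<epsilon> powr (- enn2real (1 / r))) * lorentz_fun ((1 + \<epsilon>) / D) r a"
proof -
  let ?E = "(1 + \<epsilon>) / D"
  let ?L = "lorentz_fun ?E r"
  define u where "u = \<epsilon> powr (- enn2real (1 / r))"
  have u: "1 \<le> u" unfolding u_def using \<epsilon> powr_mono'[of "- enn2real (1 / r)" 0 \<epsilon>] by simp
  have q2: "0 < 1 - (1 / 2 :: real) powr (1 / (2 * D))" using half_powr_less_1[of "1 / (2 * D)"] D by auto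
  have [measurable]: "tail_sum a \<in> borel_measurable borel"
    unfolding tail_sum_def[abs_def] by measurable
  have "?E = \<epsilon> / D + 1 / D" by (simp add: add_divide_distrib)
  then have "lorentz_fun (\<epsilon> / D) r (fracmax_bound D a) = ?L (\<lambda>t. (SUP j. ennreal ((2 ^ j) powr (1 / D)) * a (2 ^ j * t)) + tail_sum a t)"
    unfolding fracmax_bound_def by (simp only: lorentz_fun_powr_shift)
  also have "\<dots> \<le> ?L (\<lambda>t. SUP j. ennreal ((2 ^ j) powr (1 / D)) * a (2 ^ j * t)) + ?L (tail_sum a)"
    by (rule lorentz_fun_add) measurable
  also have "\<dots> \<le> ennreal (2 * D * u) * ?L a + ennreal (2 / (1 - (1 / 2) powr (1 / (2 * D))) * u) * ?L a"
  proof (rule add_mono)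
    \<comment> \<open>From \<open>epsilon <= 1/2\<close> and \<open>D >= 2\<close> one has
      \<open>1 + epsilon <= 3/2 <= D - 1/2\<close>.\<close>
    have "?E \<le> (D - 1 / 2) / D" using D \<epsilon> by (intro divide_right_mono) auto
    also have "\<dots> = 1 - 1 / (2 * D)" using D by (simp add: field_simps)
    finally have "?E \<le> 1 - 1 / (2 * D)" .
    then have "?L (tail_sum a) \<le> ennreal (2 / (1 - (1 / 2) powr (1 / (2 * D)))) * ?L a"
      using D by (intro lorentz_fun_tail_sum) auto
    also have "\<dots> \<le> ennreal (2 / (1 - (1 / 2) powr (1 / (2 * D))) * u) * ?L a"
      using u q2 mult_left_mono[of 1 u "2 / (1 - (1 / 2) powr (1 / (2 * D)))"] by (intro mult_right_mono ennreal_leI) auto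
    finally show "?L (tail_sum a) \<le> ennreal (2 / (1 - (1 / 2) powr (1 / (2 * D))) * u) * ?L a" .
    have b: "?L (\<lambda>t. ennreal ((2 ^ j) powr (1 / D)) * a (2 ^ j * t)) = ennreal (((1 / 2) powr (\<epsilon> / D)) ^ j) * ?L a" for j
      by (subst lorentz_fun_dyadic) (auto simp: add_divide_distrib)
    show "?L (\<lambda>t. SUP j. ennreal ((2 ^ j) powr (1 / D)) * a (2 ^ j * t)) \<le> ennreal (2 * D * u) * ?L a"
    proof (cases "r = top")
      case True
      have "?L (\<lambda>t. SUP j. ennreal ((2 ^ j) powr (1 / D)) * a (2 ^ j * t)) = (SUP j. ennreal (((1 / 2) powr (\<epsilon> / D)) ^ j) * ?L a)"
        unfolding lorentz_fun_SUP_top[OF True] b ..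
      also have "\<dots> \<le> ennreal (2 * D * u) * ?L a"
      proof (intro SUP_least mult_right_mono ennreal_leI)
        fix j
        have "(1 / 2 :: real) powr (\<epsilon> / D) \<le> 1" using half_powr_less_1[of "\<epsilon> / D"] D \<epsilon> by auto
        then have "((1 / 2 :: real) powr (\<epsilon> / D)) ^ j \<le> 1" by (intro power_le_one) auto
        also have "\<dots> \<le> 2 * D * u" using D u mult_mono[of 1 "2 * D" 1 u] by auto
        finally show "((1 / 2 :: real) powr (\<epsilon> / D)) ^ j \<le> 2 * D * u" .
      qed auto
      finally show ?thesis .
    next
      case False
      note R1 = R_ge_1[OF False]
      have u_R: "u = \<epsilon> powr (- (1 / R))"
        using False R1 unfolding u_def by (cases r) (auto simp: divide_ennreal ennreal_1[symmetric] simp del: ennreal_1)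
      define q where "q = (1 / 2 :: real) powr (\<epsilon> * R / D)"
      \<comment> \<open>The condition \<open>epsilon R <= D\<close> places the exponent in
        \<open>[0, 1]\<close>, the range of \<open>half_powr_le\<close>.\<close>
      have x: "0 < \<epsilon> * R / D" "\<epsilon> * R / D \<le> 1" using D \<epsilon> R1 by auto
      have q: "0 \<le> q" "q < 1" unfolding q_def using half_powr_less_1[OF x(1)] by auto
      have "?L (\<lambda>t. SUP j. ennreal ((2 ^ j) powr (1 / D)) * a (2 ^ j * t)) \<le>
         ennpowr (\<Sum>j. ennpowr (ennreal (((1 / 2) powr (\<epsilon> / D)) ^ j) * ?L a) R) (1 / R)"
        using lorentz_fun_SUP[OF _ False, of "\<lambda>j t. ennreal ((2 ^ j) powr (1 / D)) * a (2 ^ j * t)" ?E] unfolding b by simp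
      also have "(\<Sum>j. ennpowr (ennreal (((1 / 2) powr (\<epsilon> / D)) ^ j) * ?L a) R) = (\<Sum>j. ennreal (q ^ j) * ennpowr (?L a) R)"
      proof (intro suminf_cong)
        fix j
        have "(((1 / 2 :: real) powr (\<epsilon> / D)) ^ j) powr R = q ^ j"
          unfolding q_def half_powr two_powr_power by (simp add: powr_powr mult_ac)
        then show "ennpowr (ennreal (((1 / 2) powr (\<epsilon> / D)) ^ j) * ?L a) R = ennreal (q ^ j) * ennpowr (?L a) R"
          using R1 by (simp add: ennpowr_mult ennpowr_ennreal)
      qed
      also have "\<dots> = ennreal (1 / (1 - q)) * ennpowr (?L a) R"
        using q by (simp only: ennreal_suminf_multc suminf_geometric_ennreal)
      also have "ennpowr \<dots> (1 / R) = ennreal ((1 / (1 - q)) powr (1 / R)) * ?L a"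
        using R1 q by (simp add: ennpowr_mult ennpowr_ennreal ennpowr_ennpowr)
      also have "\<dots> \<le> ennreal (2 * D * u) * ?L a"
      proof (intro mult_right_mono ennreal_leI)
        \<comment> \<open>The origin of the rate: \<open>1 - q\<close> is at least a fixed multiple
          of \<open>epsilon\<close>, so the \<open>R\<close>-th root of the geometric sum is of
          order \<open>epsilon^(-1/R)\<close>. Since \<open>R >= 1\<close>, both the factor
          \<open>1 / R\<close> and the root of \<open>2 * D\<close> can be absorbed into
          \<open>2 * D\<close>.\<close>
        have "\<epsilon> * R / D / 2 \<le> 1 - q" unfolding q_def using half_powr_le[of "\<epsilon> * R / D"] x by auto
        then have "1 / (1 - q) \<le> 1 / (\<epsilon> * R / D / 2)" using x(1) by (intro divide_left_mono mult_pos_pos) auto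
        also have "\<dots> = 2 * D / R / \<epsilon>" using D \<epsilon> R1 by (simp add: field_simps)
        also have "\<dots> \<le> 2 * D / 1 / \<epsilon>" using D \<epsilon> R1 by (intro divide_right_mono divide_left_mono) auto
        finally have "(1 / (1 - q)) powr (1 / R) \<le> (2 * D / \<epsilon>) powr (1 / R)"
          using q R1 by (intro powr_mono2) auto
        also have "\<dots> = (2 * D) powr (1 / R) * u"
        proof -
          have "(x / y) powr s = x powr s * y powr (- s)" for x y s :: real
            by (simp add: powr_divide powr_minus_divide)
          then show ?thesis unfolding u_R .
        qed
        also have "\<dots> \<le> (2 * D) powr 1 * u"
          using D R1 u by (intro mult_right_mono powr_mono) auto
        finally show "(1 / (1 - q)) powr (1 / R) \<le> 2 * D * u" using D by simp
      qed auto
      finally show ?thesis .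
    qed
  qed
  also have "\<dots> = ennreal ((2 * D + 2 / (1 - (1 / 2) powr (1 / (2 * D)))) * u) * ?L a"
  proof -
    have "ennreal x * L + ennreal y * L = ennreal (x + y) * L" if "0 \<le> x" "0 \<le> y" for x y L
      using that by (simp add: distrib_right)
    from this[of "2 * D * u" "2 / (1 - (1 / 2) powr (1 / (2 * D))) * u" "?L a"] show ?thesis
      using D q2 u by (simp add: distrib_right)
  qed
  finally show ?thesis unfolding u_def .
qed

lemma lorentz_fun_rearrangement_mono_AE:
  fixes g G :: "real ^ 'd::finite \<Rightarrow> ennreal"
  assumes [measurable]: "G \<in> borel_measurable borel" and "AE x in lebesgue. x \<in> S \<longrightarrow> g x \<le> c * G x"
  shows "lorentz_fun e r (rearrangement S g) \<le> c * lorentz_fun e r (rearrangement UNIV G)"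
proof -
  have "G \<in> borel_measurable lebesgue" by (rule measurable_completion) simp
  then have "lorentz_fun e r (rearrangement S g) \<le> lorentz_fun e r (\<lambda>t. c * rearrangement UNIV G t)"
    by (intro lorentz_fun_mono rearrangement_mono_AE assms)
  then show ?thesis by (simp add: lorentz_fun_cmult)
qed

definition iter_const :: "'d::finite itself \<Rightarrow> real" where
  "iter_const _ = 2 * kernel_const TYPE('d) * riesz_const (real CARD('d))"

lemma iter_const_pos: "0 < iter_const TYPE('d::finite)"
  unfolding iter_const_def using kernel_const_pos[where ?'d='d] riesz_const_pos[of "real CARD('d)"]
  by (intro mult_pos_pos) auto

text \<open>Every potential raises the order \<open>j\<close> by one and costs one factor
  \<open>iter_const\<close>. With \<open>1 <= j\<close> and \<open>j + n < d\<close> all exponents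
  met on the way satisfy both conditions of \<open>lorentz_fun_riesz_bound\<close>.\<close>

lemma lorentz_fun_iterated_riesz:
  fixes H :: "real ^ 'd::finite \<Rightarrow> ennreal"
  assumes [measurable]: "H \<in> borel_measurable borel"
    and "1 \<le> j" "j + n < CARD('d)" "0 < \<epsilon>" "\<epsilon> \<le> 1 / 2"
  shows "lorentz_fun ((real j + \<epsilon>) / real CARD('d)) r (rearrangement UNIV ((riesz ^^ n) H)) \<le>
    ennreal (iter_const TYPE('d) ^ n) * lorentz_fun ((real (j + n) + \<epsilon>) / real CARD('d)) r (rearrangement UNIV H)"
  using assms(2,3)
proof (induction n arbitrary: j)
  case (Suc n)
  let ?D = "real CARD('d)"
  have [measurable]: "(riesz ^^ m) H \<in> borel_measurable borel" for m
    by (induction m) auto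
  let ?a = "rearrangement UNIV ((riesz ^^ n) H)"
  have D: "0 < ?D" by simp
  have e: "1 / ?D \<le> (real j + \<epsilon>) / ?D" "(real j + \<epsilon>) / ?D + 1 / ?D = (real (Suc j) + \<epsilon>) / ?D"
    using Suc.prems assms(4,5) by (auto simp: field_simps)
  have "(real (Suc j) + \<epsilon>) / ?D \<le> (?D - 1 / 2) / ?D"
    using Suc.prems assms(4,5) by (intro divide_right_mono) auto
  also have "\<dots> = 1 - 1 / (2 * ?D)" by (simp add: field_simps)
  finally have e': "(real (Suc j) + \<epsilon>) / ?D \<le> 1 - 1 / (2 * ?D)" .
  have "lorentz_fun ((real j + \<epsilon>) / ?D) r (rearrangement UNIV ((riesz ^^ Suc n) H)) \<le>
      lorentz_fun ((real j + \<epsilon>) / ?D) r (\<lambda>t. ennreal (2 * kernel_const TYPE('d)) * riesz_bound ?D ?a t)"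
    using Suc.prems by (intro lorentz_fun_mono) (simp, rule rearrangement_riesz, auto)
  also have "\<dots> = ennreal (2 * kernel_const TYPE('d)) * lorentz_fun ((real j + \<epsilon>) / ?D) r (riesz_bound ?D ?a)"
    by (rule lorentz_fun_cmult) (simp add: riesz_bound_def[abs_def] tail_sum_def)
  also have "\<dots> \<le> ennreal (2 * kernel_const TYPE('d)) * (ennreal (riesz_const ?D) * lorentz_fun ((real (Suc j) + \<epsilon>) / ?D) r ?a)"
    using lorentz_fun_riesz_bound[of ?a ?D "(real j + \<epsilon>) / ?D"] e e' by (intro mult_left_mono) auto
  also have "\<dots> = ennreal (iter_const TYPE('d)) * lorentz_fun ((real (Suc j) + \<epsilon>) / ?D) r ?a"
    using kernel_const_pos[where ?'d='d] by (simp add: iter_const_def ennreal_mult'[symmetric] mult.assoc[symmetric])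
  also have "\<dots> \<le> ennreal (iter_const TYPE('d)) * (ennreal (iter_const TYPE('d) ^ n) * lorentz_fun ((real (Suc j + n) + \<epsilon>) / ?D) r (rearrangement UNIV H))"
    using Suc.prems by (intro mult_left_mono Suc.IH) auto
  also have "\<dots> = ennreal (iter_const TYPE('d) ^ Suc n) * lorentz_fun ((real (j + Suc n) + \<epsilon>) / ?D) r (rearrangement UNIV H)"
    using iter_const_pos[where ?'d='d] by (simp add: ennreal_mult' mult.assoc)
  finally show ?case .
qed simp

text \<open>One factor for the maximal function, namely \<open>2 d\<close> from the supremum over
  dyadic levels plus the tail constant, and one \<open>iter_const\<close> for each of the
  \<open>k - 1\<close> potentials.\<close>

definition main_const :: "'d::finite itself \<Rightarrow> nat \<Rightarrow> real" where
  "main_const _ k = (2 * real CARD('d) + 2 / (1 - (1 / 2) powr (1 / (2 * real CARD('d))))) * iter_const TYPE('d) ^ (k - 1)"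

lemma main_const_pos: "0 < main_const TYPE('d::finite) k"
  unfolding main_const_def using iter_const_pos[where ?'d='d] half_powr_less_1[of "1 / (2 * real CARD('d))"]
  by (intro mult_pos_pos add_pos_pos) auto

lemma lorentz_fun_fracmax_iterated_riesz:
  fixes G H :: "real ^ 'd::finite \<Rightarrow> ennreal"
  assumes [measurable]: "G \<in> borel_measurable borel" "H \<in> borel_measurable borel"
    and k: "1 \<le> k" "k < CARD('d)" and \<epsilon>: "0 < \<epsilon>" "\<epsilon> \<le> 1 / 2" "\<epsilon> * R \<le> real CARD('d)"
    and G: "AE x in lebesgue. G x \<le> c * (riesz ^^ (k - 1)) H x"
  shows "lorentz_fun (\<epsilon> / real CARD('d)) r (fracmax_bound (real CARD('d)) (rearrangement UNIV G)) \<le>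
     ennreal (main_const TYPE('d) k * \<epsilon> powr (- enn2real (1 / r))) * (c * lorentz_fun ((real k + \<epsilon>) / real CARD('d)) r (rearrangement UNIV H))"
proof -
  let ?D = "real CARD('d)"
  let ?K = "2 * ?D + 2 / (1 - (1 / 2) powr (1 / (2 * ?D)))"
  let ?u = "\<epsilon> powr (- enn2real (1 / r))"
  have [measurable]: "(riesz ^^ m) H \<in> borel_measurable borel" for m
    by (induction m) auto
  have "lorentz_fun (\<epsilon> / ?D) r (fracmax_bound ?D (rearrangement UNIV G)) \<le> ennreal (?K * ?u) * lorentz_fun ((1 + \<epsilon>) / ?D) r (rearrangement UNIV G)"
    using k \<epsilon> by (intro lorentz_fun_fracmax_bound) auto
  also have "\<dots> \<le> ennreal (?K * ?u) * (c * lorentz_fun ((real 1 + \<epsilon>) / ?D) r (rearrangement UNIV ((riesz ^^ (k - 1)) H)))"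
    using G lorentz_fun_rearrangement_mono_AE[of "(riesz ^^ (k - 1)) H" UNIV G c "(real 1 + \<epsilon>) / ?D"]
    by (intro mult_left_mono) auto
  also have "\<dots> \<le> ennreal (?K * ?u) * (c * (ennreal (iter_const TYPE('d) ^ (k - 1)) * lorentz_fun ((real (1 + (k - 1)) + \<epsilon>) / ?D) r (rearrangement UNIV H)))"
    using k \<epsilon> by (intro mult_left_mono lorentz_fun_iterated_riesz) auto
  also have "\<dots> = ennreal (?K * ?u * iter_const TYPE('d) ^ (k - 1)) * (c * lorentz_fun ((real k + \<epsilon>) / ?D) r (rearrangement UNIV H))"
  proof -
    have "ennreal x * (c * (ennreal y * L)) = ennreal (x * y) * (c * L)" if "0 \<le> y" for x y L
      using that by (simp add: ennreal_mult'' mult_ac)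
    then show ?thesis using k iter_const_pos[where ?'d='d] by (simp del: One_nat_def)
  qed
  also have "?K * ?u * iter_const TYPE('d) ^ (k - 1) = main_const TYPE('d) k * ?u"
    by (simp add: main_const_def)
  finally show ?thesis .
qed

end

section \<open>Upper gradients and Poincare inequalities\<close>

lemma nn_integral_lborel_affine:
  fixes f :: "'a::euclidean_space \<Rightarrow> ennreal"
  assumes [measurable]: "f \<in> borel_measurable borel" and c: "c \<noteq> 0"
  shows "(\<integral>\<^sup>+x. f x \<partial>lborel) = ennreal (\<bar>c\<bar> ^ DIM('a)) * (\<integral>\<^sup>+x. f (t + c *\<^sub>R x) \<partial>lborel)"
  by (subst lborel_affine[OF c, of t]) (simp add: nn_integral_density nn_integral_distr nn_integral_cmult)

lemma nn_integral_lborel_translate: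
  fixes f :: "'a::euclidean_space \<Rightarrow> ennreal"
  assumes "f \<in> borel_measurable borel"
  shows "(\<integral>\<^sup>+x. f (t + x) \<partial>lborel) = (\<integral>\<^sup>+x. f x \<partial>lborel)"
  using nn_integral_lborel_affine[OF assms, of 1 t] by simp

text \<open>A line-integral form of \<open>G\<close> bounding the gradient. The exceptional null set
  may depend on \<open>h\<close>, so the notion is insensitive to the choice of representatives;
  smooth functions and weakly differentiable ones both have it.\<close>

definition upper_gradient ::
  "(real ^ 'd::finite) set \<Rightarrow> (real ^ 'd \<Rightarrow> 'b::euclidean_space) \<Rightarrow> (real ^ 'd \<Rightarrow> ennreal) \<Rightarrow> bool" where
  "upper_gradient U u G \<longleftrightarrow> u \<in> borel_measurable borel \<and> G \<in> borel_measurable borel \<and>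
     (\<forall>h. AE x in lborel. x \<in> U \<and> x + h \<in> U \<longrightarrow>
        ennreal (norm (u (x + h) - u x)) \<le> ennreal (norm h) * (\<integral>\<^sup>+s\<in>{0<..1}. G (x + s *\<^sub>R h) \<partial>lborel))"

lemma nn_integral_power_tail:
  assumes b: "0 < b" and n: "0 < n"
  shows "(\<integral>\<^sup>+s\<in>{b..}. ennreal (s powr (- real n - 1)) \<partial>lborel) = ennreal (b powr (- real n) / real n)"
proof -
  have "(\<integral>\<^sup>+s. ennreal (s powr (- real n - 1)) * indicator {b..} s \<partial>lborel) = ennreal (0 - (- (b powr (- real n)) / real n))"
  proof (rule nn_integral_FTC_atLeast)
    fix x assume "b \<le> x"
    then have "0 < x" using b by simp
    then show "((\<lambda>s. - (s powr (- real n)) / real n) has_real_derivative x powr (- real n - 1)) (at x)"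
      using n by (auto intro!: derivative_eq_intros)
  next
    have "((\<lambda>s. s powr (- real n)) \<longlongrightarrow> 0) at_top"
      using n by (intro tendsto_neg_powr filterlim_ident) auto
    then have "((\<lambda>s. - (s powr (- real n)) / real n) \<longlongrightarrow> - 0 / real n) at_top"
      using n by (intro tendsto_intros) auto
    then show "((\<lambda>s. - (s powr (- real n)) / real n) \<longlongrightarrow> 0) at_top" by simp
  qed auto
  then show ?thesis by simp
qed

text \<open>The proof integrates the line inequality over \<open>y = x + h\<close> and substitutes \<open>w = s h\<close>. Since
  \<open>|w| \<le> s M\<close>, integrating out \<open>s\<close> turns \<open>s\<^sup>-\<^sup>d\<^sup>-\<^sup>1 |w|\<close> into a multiple of the Riesz kernel.\<close>

lemma upper_gradient_convex_set:
  fixes u :: "real ^ 'd::finite \<Rightarrow> 'b::euclidean_space"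
  assumes ug: "upper_gradient U u G" and Q: "Q \<in> sets borel" "convex Q" "Q \<subseteq> U" and [measurable]: "U \<in> sets borel"
    and M: "0 < M" "\<And>x y. x \<in> Q \<Longrightarrow> y \<in> Q \<Longrightarrow> norm (x - y) \<le> M"
  shows "AE x in lborel. x \<in> Q \<longrightarrow> (\<integral>\<^sup>+y\<in>Q. ennreal (norm (u y - u x)) \<partial>lborel)
     \<le> ennreal (M ^ CARD('d)) * riesz (\<lambda>y. G y * indicator Q y) x"
proof -
  let ?D = "real CARD('d)"
  have [measurable]: "u \<in> borel_measurable borel" "G \<in> borel_measurable borel" "Q \<in> sets borel"
    using ug Q by (auto simp: upper_gradient_def)
  let ?P = "\<lambda>x h. x \<in> U \<and> x + h \<in> U \<longrightarrow>
        ennreal (norm (u (x + h) - u x)) \<le> ennreal (norm h) * (\<integral>\<^sup>+s\<in>{0<..1}. G (x + s *\<^sub>R h) \<partial>lborel)"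
  \<comment> \<open>The definition gives a null set of \<open>x\<close> for each \<open>h\<close>.
    Fubini turns this into a null set of \<open>h\<close> for almost every \<open>x\<close>, and
    then the inequality can be integrated in \<open>h\<close> at fixed \<open>x\<close>.\<close>
  have "AE h in lborel. AE x in lborel. ?P x h"
    using ug by (auto simp: upper_gradient_def)
  then have "AE x in lborel. AE h in lborel. ?P x h"
    by (subst lborel_pair.AE_commute) measurable
  then show ?thesis
  proof eventually_elim
    case (elim x)
    show ?case
    proof
      assume x: "x \<in> Q"
      define g where "g y = G y * indicator Q y" for y
      have [measurable]: "g \<in> borel_measurable borel" unfolding g_def by measurable
      let ?B = "\<lambda>h. indicator {h. norm h \<le> M} h :: ennreal"
      have "(\<integral>\<^sup>+y\<in>Q. ennreal (norm (u y - u x)) \<partial>lborel) = (\<integral>\<^sup>+h. ennreal (norm (u (x + h) - u x)) * indicator Q (x + h) \<partial>lborel)"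
        by (rule nn_integral_lborel_translate[symmetric]) measurable
      also have "\<dots> \<le> (\<integral>\<^sup>+h. (\<integral>\<^sup>+s. ennreal (norm h) * ?B h * g (x + s *\<^sub>R h) * indicator {0<..1} s \<partial>lborel) \<partial>lborel)"
      proof (rule nn_integral_mono_AE)
        show "AE h in lborel. ennreal (norm (u (x + h) - u x)) * indicator Q (x + h) \<le>
           (\<integral>\<^sup>+s. ennreal (norm h) * ?B h * g (x + s *\<^sub>R h) * indicator {0<..1} s \<partial>lborel)"
          using elim
        proof eventually_elim
          case (elim h)
          show ?case
          proof (cases "x + h \<in> Q")
            case True
            have h: "norm h \<le> M" using M(2)[OF True x] by simp
            have "x + s *\<^sub>R h \<in> Q" if "0 < s" "s \<le> 1" for s
              using convexD[OF Q(2) x True, of "1 - s" s] that by (simp add: algebra_simps)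
            then have "(\<integral>\<^sup>+s\<in>{0<..1}. G (x + s *\<^sub>R h) \<partial>lborel) = (\<integral>\<^sup>+s\<in>{0<..1}. g (x + s *\<^sub>R h) \<partial>lborel)"
              by (intro nn_integral_cong) (auto simp: g_def split: split_indicator)
            then show ?thesis
              using elim True x Q(3) h by (auto simp: nn_integral_cmult[symmetric] mult_ac)
          qed simp
        qed
      qed
      also have "\<dots> = (\<integral>\<^sup>+s. (\<integral>\<^sup>+h. ennreal (norm h) * ?B h * g (x + s *\<^sub>R h) * indicator {0<..1} s \<partial>lborel) \<partial>lborel)"
        by (rule lborel_pair.Fubini') measurable
      also have "\<dots> = (\<integral>\<^sup>+s. (\<integral>\<^sup>+w. ennreal ((1 / s) ^ CARD('d) * (norm w / s)) * indicator {w. norm w \<le> s * M} w * g (x + w) * indicator {0<..1} s \<partial>lborel) \<partial>lborel)"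
      proof (rule nn_integral_cong)
        fix s :: real
        show "(\<integral>\<^sup>+h. ennreal (norm h) * ?B h * g (x + s *\<^sub>R h) * indicator {0<..1} s \<partial>lborel) =
          (\<integral>\<^sup>+w. ennreal ((1 / s) ^ CARD('d) * (norm w / s)) * indicator {w. norm w \<le> s * M} w * g (x + w) * indicator {0<..1} s \<partial>lborel)"
        proof (cases "s \<in> {0<..1}")
          case True
          then have s: "0 < s" by auto
          have "(\<integral>\<^sup>+h. ennreal (norm h) * ?B h * g (x + s *\<^sub>R h) * indicator {0<..1} s \<partial>lborel) =
            ennreal ((1 / s) ^ CARD('d)) * (\<integral>\<^sup>+w. ennreal (norm ((1 / s) *\<^sub>R w)) * ?B ((1 / s) *\<^sub>R w) * g (x + s *\<^sub>R (1 / s) *\<^sub>R w) * indicator {0<..1} s \<partial>lborel)"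
            using s by (subst nn_integral_lborel_affine[where c="1 / s" and t=0]) (auto simp: power_divide)
          also have "\<dots> = (\<integral>\<^sup>+w. ennreal ((1 / s) ^ CARD('d)) * (ennreal (norm ((1 / s) *\<^sub>R w)) * ?B ((1 / s) *\<^sub>R w) * g (x + s *\<^sub>R (1 / s) *\<^sub>R w) * indicator {0<..1} s) \<partial>lborel)"
            by (rule nn_integral_cmult[symmetric]) measurable
          also have "\<dots> = (\<integral>\<^sup>+w. ennreal ((1 / s) ^ CARD('d) * (norm w / s)) * indicator {w. norm w \<le> s * M} w * g (x + w) * indicator {0<..1} s \<partial>lborel)"
          proof (rule nn_integral_cong)
            fix w :: "real ^ 'd"
            have 1: "norm ((1 / s) *\<^sub>R w) = norm w / s" using s by simp
            have 2: "?B ((1 / s) *\<^sub>R w) = indicator {w. norm w \<le> s * M} w"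
              using s by (auto simp: indicator_def field_simps)
            have 3: "ennreal ((1 / s) ^ CARD('d) * (norm w / s)) = ennreal ((1 / s) ^ CARD('d)) * ennreal (norm w / s)"
              using s by (intro ennreal_mult) auto
            have 4: "s *\<^sub>R (1 / s) *\<^sub>R w = w" using s by simp
            show "ennreal ((1 / s) ^ CARD('d)) * (ennreal (norm ((1 / s) *\<^sub>R w)) * ?B ((1 / s) *\<^sub>R w) * g (x + s *\<^sub>R (1 / s) *\<^sub>R w) * indicator {0<..1} s)
              = ennreal ((1 / s) ^ CARD('d) * (norm w / s)) * indicator {w. norm w \<le> s * M} w * g (x + w) * indicator {0<..1} s"
              by (simp only: 1 2 3 4 mult.assoc)
          qed
          finally show ?thesis .
        qed simp
      qed
      also have "\<dots> = (\<integral>\<^sup>+w. (\<integral>\<^sup>+s. ennreal ((1 / s) ^ CARD('d) * (norm w / s)) * indicator {w. norm w \<le> s * M} w * g (x + w) * indicator {0<..1} s \<partial>lborel) \<partial>lborel)"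
        by (rule lborel_pair.Fubini') measurable
      also have "\<dots> \<le> (\<integral>\<^sup>+w. ennreal (M ^ CARD('d)) * (ennreal (norm w powr (1 - ?D)) * g (x + w)) \<partial>lborel)"
      proof (rule nn_integral_mono_AE)
        show "AE w in lborel. (\<integral>\<^sup>+s. ennreal ((1 / s) ^ CARD('d) * (norm w / s)) * indicator {w. norm w \<le> s * M} w * g (x + w) * indicator {0<..1} s \<partial>lborel)
          \<le> ennreal (M ^ CARD('d)) * (ennreal (norm w powr (1 - ?D)) * g (x + w))"
          using AE_lborel_singleton[of "0 :: real ^ 'd"]
        proof eventually_elim
          case (elim w)
          then have w: "0 < norm w" by simp
          have "(\<integral>\<^sup>+s. ennreal ((1 / s) ^ CARD('d) * (norm w / s)) * indicator {w. norm w \<le> s * M} w * g (x + w) * indicator {0<..1} s \<partial>lborel)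
            \<le> (\<integral>\<^sup>+s. ennreal (norm w) * g (x + w) * (ennreal (s powr (- ?D - 1)) * indicator {norm w / M..} s) \<partial>lborel)"
          proof (rule nn_integral_mono)
            fix s :: real
            show "ennreal ((1 / s) ^ CARD('d) * (norm w / s)) * indicator {w. norm w \<le> s * M} w * g (x + w) * indicator {0<..1} s
              \<le> ennreal (norm w) * g (x + w) * (ennreal (s powr (- ?D - 1)) * indicator {norm w / M..} s)"
            proof (cases "s \<in> {0<..1} \<and> norm w \<le> s * M")
              case True
              then have "(1 / s) ^ CARD('d) * (norm w / s) = norm w * s powr (- ?D - 1)"
                by (simp add: powr_diff powr_minus powr_realpow power_divide power_inverse divide_inverse)
              then have "ennreal ((1 / s) ^ CARD('d) * (norm w / s)) = ennreal (norm w) * ennreal (s powr (- ?D - 1))"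
                by (simp only: ennreal_mult'[OF norm_ge_zero])
              then show ?thesis
                using True M(1) by (simp add: pos_divide_le_eq mult_ac)
            qed auto
          qed
          also have "\<dots> = ennreal (norm w) * g (x + w) * ennreal ((norm w / M) powr (- ?D) / ?D)"
            using w M(1) by (subst nn_integral_cmult) (auto simp: nn_integral_power_tail)
          also have "\<dots> = ennreal (norm w * ((norm w / M) powr (- ?D) / ?D)) * g (x + w)"
            by (simp only: ennreal_mult'[OF norm_ge_zero] mult_ac)
          also have "\<dots> \<le> ennreal (M ^ CARD('d) * norm w powr (1 - ?D)) * g (x + w)"
          proof (intro mult_right_mono ennreal_leI)
            have "norm w * ((norm w / M) powr (- ?D) / ?D) \<le> norm w * ((norm w / M) powr (- ?D) / 1)"
              using w by (intro mult_left_mono divide_left_mono) (auto simp: Suc_le_eq)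
            also have "\<dots> = M ^ CARD('d) * norm w powr (1 - ?D)"
              using w M(1) by (simp add: powr_divide powr_minus_divide powr_realpow powr_diff)
            finally show "norm w * ((norm w / M) powr (- ?D) / ?D) \<le> M ^ CARD('d) * norm w powr (1 - ?D)" .
          qed simp
          also have "\<dots> = ennreal (M ^ CARD('d)) * (ennreal (norm w powr (1 - ?D)) * g (x + w))"
            using M(1) by (simp add: ennreal_mult mult.assoc)
          finally show ?case .
        qed
      qed
      also have "\<dots> = ennreal (M ^ CARD('d)) * (\<integral>\<^sup>+w. ennreal (norm w powr (1 - ?D)) * g (x + w) \<partial>lborel)"
        by (rule nn_integral_cmult) measurable
      also have "(\<integral>\<^sup>+w. ennreal (norm w powr (1 - ?D)) * g (x + w) \<partial>lborel) = (\<integral>\<^sup>+w. ennreal (norm (x - (x + w)) powr (1 - ?D)) * g (x + w) \<partial>lborel)"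
        by simp
      also have "\<dots> = riesz g x"
        unfolding riesz_def by (rule nn_integral_lborel_translate[of "\<lambda>y. ennreal (norm (x - y) powr (1 - ?D)) * g y"]) measurable
      finally show "(\<integral>\<^sup>+y\<in>Q. ennreal (norm (u y - u x)) \<partial>lborel) \<le> ennreal (M ^ CARD('d)) * riesz (\<lambda>y. G y * indicator Q y) x"
        unfolding g_def[abs_def] .
    qed
  qed
qed

lemma AE_side_cube_box: "AE x in lborel. x \<in> side_cube z l \<longrightarrow> x \<in> box z (z + (\<chi> i. l))"
proof -
  have "AE x in lborel. x \<notin> cbox z (z + (\<chi> i. l)) - box z (z + (\<chi> i. l))"
    by (intro AE_not_in null_sets_cbox_Diff_box)
  then show ?thesis by eventually_elim (auto simp: side_cube_def)
qed

text \<open>Cubes are closed, whereas the inequality along segments is known on the open box only.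
  The boundary is a null set, and \<open>d l\<close> bounds the diameter.\<close>

lemma upper_gradient_cube:
  fixes u :: "real ^ 'd::finite \<Rightarrow> 'b::euclidean_space"
  assumes ug: "upper_gradient U u G" and U: "U \<in> sets borel" and Q: "box z (z + (\<chi> i. l)) \<subseteq> U" and l: "0 < l"
  shows "AE x in lborel. x \<in> side_cube z l \<longrightarrow> (\<integral>\<^sup>+y\<in>side_cube z l. ennreal (norm (u y - u x)) \<partial>lborel)
     \<le> ennreal ((real CARD('d) * l) ^ CARD('d)) * riesz (\<lambda>y. G y * indicator (side_cube z l) y) x"
proof -
  let ?B = "box z (z + (\<chi> i. l))"
  have sub: "?B \<subseteq> side_cube z l" by (simp add: side_cube_def box_subset_cbox)
  have ae: "AE y in lborel. indicator (side_cube z l) y = (indicator ?B y :: ennreal)"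
    using AE_side_cube_box[of z l] by eventually_elim (use sub in \<open>auto simp: indicator_def\<close>)
  have "AE x in lborel. x \<in> ?B \<longrightarrow> (\<integral>\<^sup>+y\<in>?B. ennreal (norm (u y - u x)) \<partial>lborel)
     \<le> ennreal ((real CARD('d) * l) ^ CARD('d)) * riesz (\<lambda>y. G y * indicator ?B y) x"
    using l sub side_cube_diameter
    by (intro upper_gradient_convex_set[OF ug _ convex_box(2) Q U]) (blast | simp)+
  with AE_side_cube_box[of z l] show ?thesis
  proof eventually_elim
    case (elim x)
    have "(\<integral>\<^sup>+y\<in>side_cube z l. ennreal (norm (u y - u x)) \<partial>lborel) = (\<integral>\<^sup>+y\<in>?B. ennreal (norm (u y - u x)) \<partial>lborel)"
      by (intro nn_integral_cong_AE) (use ae in eventually_elim, simp)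
    moreover have "riesz (\<lambda>y. G y * indicator ?B y) x \<le> riesz (\<lambda>y. G y * indicator (side_cube z l) y) x"
      by (intro riesz_mono_AE) (use ae in eventually_elim, simp)
    ultimately show ?case
      using elim by (auto intro: order_trans[OF _ mult_left_mono])
  qed
qed

text \<open>\<open>d^d\<close> is the quotient of \<open>(d l)^d\<close> and the measure of the
  cube; \<open>kernel_const\<close> comes from integrating the potential over the cube.\<close>

definition poincare_const :: "'d::finite itself \<Rightarrow> real" where
  "poincare_const _ = real CARD('d) ^ CARD('d) * kernel_const TYPE('d)"

lemma poincare_const_pos: "0 < poincare_const TYPE('d::finite)"
  using kernel_const_pos[where ?'d='d] by (auto simp: poincare_const_def)

text \<open>Finiteness of the right-hand side forces \<open>u\<close> to be integrable over the cube, so that the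
  average is not a junk value.\<close>

lemma mean_oscillation_le:
  fixes u :: "real ^ 'd::finite \<Rightarrow> 'b::euclidean_space"
  assumes ug: "upper_gradient U u G" and U: "U \<in> sets borel" and Q: "box z (z + (\<chi> i. l)) \<subseteq> U" and l: "0 < l"
    and d: "2 \<le> CARD('d)"
  shows "mean_oscillation (side_cube z l) u \<le>
    ennreal (poincare_const TYPE('d)) * (ennreal (l powr (1 - real CARD('d))) * (\<integral>\<^sup>+y\<in>side_cube z l. G y \<partial>lborel))"
proof -
  let ?D = "real CARD('d)"
  let ?Q = "side_cube z l"
  let ?c = "poincare_const TYPE('d)"
  have [measurable]: "u \<in> borel_measurable borel" "G \<in> borel_measurable borel"
    using ug by (auto simp: upper_gradient_def)
  define A where "A = (\<integral>\<^sup>+y\<in>?Q. G y \<partial>lborel)"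
  define V where "V = l ^ CARD('d)"
  have V: "0 < V" "emeasure lborel ?Q = ennreal V" using l by (auto simp: V_def emeasure_side_cube)
  show ?thesis
  proof (cases "A = top")
    case True
    then show ?thesis using l poincare_const_pos[where ?'d='d] unfolding A_def[symmetric] by (simp add: ennreal_mult_top)
  next
    case False
    define g where "g y = G y * indicator ?Q y" for y
    have [measurable]: "g \<in> borel_measurable borel" unfolding g_def by measurable
    have gA: "(\<integral>\<^sup>+y. g y \<partial>lborel) = A" by (simp add: g_def A_def)
    have VD: "V powr (1 / ?D) = l" using l by (simp add: V_def powr_realpow[symmetric] powr_powr)
    have rz: "(\<integral>\<^sup>+x\<in>?Q. riesz g x \<partial>lborel) \<le> ennreal (kernel_const TYPE('d) * l) * A"
      using nn_integral_riesz[of g ?Q V] V d unfolding gA VD by simp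
    also have "\<dots> < top" using False by (simp add: ennreal_mult_less_top less_top)
    finally have "(\<integral>\<^sup>+x\<in>?Q. riesz g x \<partial>lborel) \<noteq> \<infinity>" by (simp add: less_top)
    then have "AE x in lborel. riesz g x * indicator ?Q x \<noteq> \<infinity>"
      by (intro nn_integral_noteq_infinite) measurable
    then have fin: "AE x in lborel. x \<in> ?Q \<longrightarrow> riesz g x < top"
      by eventually_elim (auto simp: less_top)
    have K: "AE x in lborel. x \<in> ?Q \<longrightarrow> (\<integral>\<^sup>+y\<in>?Q. ennreal (norm (u y - u x)) \<partial>lborel) \<le> ennreal ((?D * l) ^ CARD('d)) * riesz g x"
      using upper_gradient_cube[OF ug U Q l] unfolding g_def .
    \<comment> \<open>A single such point suffices: \<open>u\<close> then differs on the cube from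
      the constant \<open>u x0\<close> by an integrable function. It exists because the potential is
      finite almost everywhere on a set of positive measure.\<close>
    have "\<exists>x\<in>?Q. (\<integral>\<^sup>+y\<in>?Q. ennreal (norm (u y - u x)) \<partial>lborel) < top"
    proof (rule ccontr)
      assume not: "\<not> ?thesis"
      have "AE x in lborel. x \<notin> ?Q"
        using fin K
      proof eventually_elim
        case (elim x)
        show ?case
        proof
          assume x: "x \<in> ?Q"
          have "ennreal ((?D * l) ^ CARD('d)) * riesz g x < top"
            using elim x by (simp add: ennreal_mult_less_top)
          then show False using elim x not by (meson le_less_trans)
        qed
      qed
      then have "emeasure lborel ?Q = 0" by (subst AE_iff_measurable[symmetric, where P="\<lambda>x. x \<notin> ?Q"]) auto
      then show False using V by simp
    qed
    then obtain x0 where x0: "x0 \<in> ?Q" "(\<integral>\<^sup>+y\<in>?Q. ennreal (norm (u y - u x0)) \<partial>lborel) < top" by blast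
    have Qfin: "emeasure lborel ?Q < \<infinity>" using V by simp
    have int0: "set_integrable lborel ?Q (\<lambda>y. u y - u x0)"
      unfolding set_integrable_def
    proof (rule integrableI_bounded)
      have "(\<integral>\<^sup>+y. ennreal (norm (indicator ?Q y *\<^sub>R (u y - u x0))) \<partial>lborel) = (\<integral>\<^sup>+y\<in>?Q. ennreal (norm (u y - u x0)) \<partial>lborel)"
        by (intro nn_integral_cong) (auto split: split_indicator)
      then show "(\<integral>\<^sup>+y. ennreal (norm (indicator ?Q y *\<^sub>R (u y - u x0))) \<partial>lborel) < \<infinity>" using x0 by simp
    qed measurable
    have const: "set_integrable lborel ?Q (\<lambda>_. c)" for c :: 'b
      unfolding set_integrable_def using Qfin by (intro integrable_scaleR_left integrable_real_indicator) auto
    have intu: "set_integrable lborel ?Q u"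
      using set_integral_add(1)[OF int0 const[of "u x0"]] by simp
    have measQ: "measure lebesgue ?Q = V"
      using V by (simp add: measure_def emeasure_completion_borel)
    have avg: "average ?Q u = (1 / V) *\<^sub>R (LINT x:?Q|lborel. u x)"
      unfolding average_def measQ set_lebesgue_integral_def by (simp add: integral_completion)
    \<comment> \<open>\<open>u y\<close> minus the average is the average of
      \<open>u y - u x\<close> over \<open>x\<close>, which is the integral that \<open>K\<close>
      controls.\<close>
    have ptw: "ennreal (norm (u y - average ?Q u)) \<le> ennreal (1 / V) * (\<integral>\<^sup>+x\<in>?Q. ennreal (norm (u x - u y)) \<partial>lborel)" for y
    proof -
      have "(LINT x:?Q|lborel. u x - u y) = (LINT x:?Q|lborel. u x) - V *\<^sub>R u y"
        using intu const[of "u y"] V(2) V(1) by (subst set_integral_diff) (auto simp: set_lebesgue_integral_def measure_def)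
      then have "u y - average ?Q u = - ((1 / V) *\<^sub>R (LINT x:?Q|lborel. u x - u y))"
        using V(1) unfolding avg by (simp add: scaleR_diff_right)
      then have "norm (u y - average ?Q u) = (1 / V) * norm (LINT x:?Q|lborel. u x - u y)"
        using V(1) by simp
      then have "ennreal (norm (u y - average ?Q u)) = ennreal (1 / V) * ennreal (norm (LINT x:?Q|lborel. u x - u y))"
        using V(1) by (simp add: ennreal_mult[symmetric])
      also have "ennreal (norm (LINT x:?Q|lborel. u x - u y)) \<le> (\<integral>\<^sup>+x. norm (indicator ?Q x *\<^sub>R (u x - u y)) \<partial>lborel)"
        unfolding set_lebesgue_integral_def using set_integral_diff(1)[OF intu const[of "u y"]]
        by (intro integral_norm_bound_ennreal) (simp add: set_integrable_def)
      also have "\<dots> = (\<integral>\<^sup>+x\<in>?Q. ennreal (norm (u x - u y)) \<partial>lborel)"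
        by (intro nn_integral_cong) (auto split: split_indicator)
      finally show ?thesis by (simp add: mult_left_mono)
    qed
    have "(\<integral>\<^sup>+y\<in>?Q. ennreal (norm (u y - average ?Q u)) \<partial>lebesgue) = (\<integral>\<^sup>+y\<in>?Q. ennreal (norm (u y - average ?Q u)) \<partial>lborel)"
      by (rule nn_integral_completion)
    also have "\<dots> \<le> (\<integral>\<^sup>+y. ennreal (?D ^ CARD('d)) * (riesz g y * indicator ?Q y) \<partial>lborel)"
    proof (rule nn_integral_mono_AE)
      show "AE y in lborel. ennreal (norm (u y - average ?Q u)) * indicator ?Q y \<le> ennreal (?D ^ CARD('d)) * (riesz g y * indicator ?Q y)"
        using K
      proof eventually_elim
        case (elim y)
        show ?case
        proof (cases "y \<in> ?Q")
          case True
          have "ennreal (norm (u y - average ?Q u)) \<le> ennreal (1 / V) * (ennreal ((?D * l) ^ CARD('d)) * riesz g y)"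
            using True elim by (intro order_trans[OF ptw] mult_left_mono) auto
          also have "\<dots> = ennreal (1 / V * (?D * l) ^ CARD('d)) * riesz g y"
            using V(1) by (simp only: mult.assoc[symmetric]) (simp add: ennreal_mult'[symmetric])
          also have "1 / V * (?D * l) ^ CARD('d) = ?D ^ CARD('d)"
            using l by (simp add: V_def power_mult_distrib)
          finally show ?thesis using True by simp
        qed simp
      qed
    qed
    also have "\<dots> = ennreal (?D ^ CARD('d)) * (\<integral>\<^sup>+y\<in>?Q. riesz g y \<partial>lborel)"
      by (rule nn_integral_cmult) measurable
    also have "\<dots> \<le> ennreal (?D ^ CARD('d)) * (ennreal (kernel_const TYPE('d) * l) * A)"
      by (intro mult_left_mono rz) simp
    also have "\<dots> = ennreal (?c * l) * A"
      using l kernel_const_pos[where ?'d='d] by (simp add: mult.assoc[symmetric] ennreal_mult'[symmetric] poincare_const_def)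
    finally have "mean_oscillation ?Q u \<le> ennreal (?c * l) * A / emeasure lebesgue ?Q"
      unfolding mean_oscillation_def by (rule divide_right_mono_ennreal)
    also have "\<dots> = ennreal (?c * l) * A / ennreal V" using V by (simp add: emeasure_completion_borel)
    also have "\<dots> = ennreal (?c * l / V) * A"
      using V l poincare_const_pos[where ?'d='d] by (simp add: divide_ennreal[symmetric] ennreal_times_divide mult.commute)
    also have "?c * l / V = ?c * l powr (1 - ?D)"
      using l by (simp add: V_def powr_diff powr_realpow)
    finally show ?thesis
      using l poincare_const_pos[where ?'d='d] unfolding A_def by (simp add: ennreal_mult mult.assoc)
  qed
qed

text \<open>Average \<open>|u x| <= |u y| + |u y - u x|\<close> over \<open>y\<close> in the
  cube.\<close>

lemma upper_gradient_pointwise_cube: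
  fixes u :: "real ^ 'd::finite \<Rightarrow> 'b::euclidean_space"
  assumes ug: "upper_gradient U u G" and U: "U \<in> sets borel" and Q: "box z (z + (\<chi> i. l)) \<subseteq> U" and l: "0 < l"
  shows "AE x in lborel. x \<in> side_cube z l \<longrightarrow> ennreal (norm (u x)) \<le>
     ennreal (1 / l ^ CARD('d)) * (\<integral>\<^sup>+y\<in>side_cube z l. ennreal (norm (u y)) \<partial>lborel) +
     ennreal (real CARD('d) ^ CARD('d)) * riesz (\<lambda>y. G y * indicator (side_cube z l) y) x"
  using upper_gradient_cube[OF assms]
proof eventually_elim
  case (elim x)
  let ?D = "real CARD('d)"
  let ?Q = "side_cube z l"
  define V where "V = l ^ CARD('d)"
  have V: "0 < V" "emeasure lborel ?Q = ennreal V" using l by (auto simp: V_def emeasure_side_cube)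
  have [measurable]: "u \<in> borel_measurable borel"
    using ug by (auto simp: upper_gradient_def)
  show ?case
  proof
    assume x: "x \<in> ?Q"
    have "ennreal V * ennreal (norm (u x)) = (\<integral>\<^sup>+y\<in>?Q. ennreal (norm (u x)) \<partial>lborel)"
      using V by (simp add: nn_integral_cmult_indicator mult.commute)
    also have "\<dots> \<le> (\<integral>\<^sup>+y. ennreal (norm (u y)) * indicator ?Q y + ennreal (norm (u y - u x)) * indicator ?Q y \<partial>lborel)"
    proof (intro nn_integral_mono)
      fix y
      have "norm (u x) \<le> norm (u y) + norm (u y - u x)"
        by (metis norm_minus_commute norm_triangle_sub add.commute)
      then have "ennreal (norm (u x)) \<le> ennreal (norm (u y)) + ennreal (norm (u y - u x))"
        by (subst ennreal_plus[symmetric]) (simp_all add: ennreal_leI del: ennreal_plus)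
      then show "ennreal (norm (u x)) * indicator ?Q y \<le> ennreal (norm (u y)) * indicator ?Q y + ennreal (norm (u y - u x)) * indicator ?Q y"
        by (auto split: split_indicator)
    qed
    also have "\<dots> = (\<integral>\<^sup>+y\<in>?Q. ennreal (norm (u y)) \<partial>lborel) + (\<integral>\<^sup>+y\<in>?Q. ennreal (norm (u y - u x)) \<partial>lborel)"
      by (rule nn_integral_add) measurable
    also have "\<dots> \<le> (\<integral>\<^sup>+y\<in>?Q. ennreal (norm (u y)) \<partial>lborel) + ennreal ((?D * l) ^ CARD('d)) * riesz (\<lambda>y. G y * indicator ?Q y) x"
      using elim x by (intro add_left_mono) auto
    finally have "ennreal (1 / V) * (ennreal V * ennreal (norm (u x))) \<le> ennreal (1 / V) * \<dots>"
      by (rule mult_left_mono) simp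
    also have "ennreal (1 / V) * (ennreal V * ennreal (norm (u x))) = ennreal (norm (u x))"
      using V(1) by (simp add: ennreal_mult[symmetric])
    also have "ennreal (1 / V) * ((\<integral>\<^sup>+y\<in>?Q. ennreal (norm (u y)) \<partial>lborel) + ennreal ((?D * l) ^ CARD('d)) * riesz (\<lambda>y. G y * indicator ?Q y) x)
      = ennreal (1 / V) * (\<integral>\<^sup>+y\<in>?Q. ennreal (norm (u y)) \<partial>lborel) + ennreal (1 / V * (?D * l) ^ CARD('d)) * riesz (\<lambda>y. G y * indicator ?Q y) x"
      using V(1) by (simp only: distrib_left mult.assoc[symmetric]) (simp add: ennreal_mult'[symmetric])
    also have "1 / V * (?D * l) ^ CARD('d) = ?D ^ CARD('d)"
      using l by (simp add: V_def power_mult_distrib)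
    finally show "ennreal (norm (u x)) \<le> ennreal (1 / l ^ CARD('d)) * (\<integral>\<^sup>+y\<in>?Q. ennreal (norm (u y)) \<partial>lborel) +
       ennreal (?D ^ CARD('d)) * riesz (\<lambda>y. G y * indicator ?Q y) x"
      unfolding V_def .
  qed
qed

text \<open>To iterate, the mean value must be a potential as well. It is, by
  \<open>cube_integral_le_riesz\<close> applied to \<open>|u|\<close>, at the price of a factor
  \<open>1 / l\<close> and of the term of order zero in the density.\<close>

lemma upper_gradient_pointwise_riesz_cube:
  fixes u :: "real ^ 'd::finite \<Rightarrow> 'b::euclidean_space"
  assumes ug: "upper_gradient U u G" and U: "U \<in> sets borel" and Q: "box z (z + (\<chi> i. l)) \<subseteq> U" and l: "0 < l"
    and d: "2 \<le> CARD('d)"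
  shows "AE x in lborel. x \<in> side_cube z l \<longrightarrow> ennreal (norm (u x)) \<le>
     ennreal (real CARD('d) ^ CARD('d) * (1 + 1 / l)) *
       riesz (\<lambda>y. (ennreal (norm (u y)) + G y) * indicator (side_cube z l) y) x"
  using upper_gradient_pointwise_cube[OF ug U Q l]
proof eventually_elim
  case (elim x)
  let ?D = "real CARD('d)"
  let ?Q = "side_cube z l"
  have [measurable]: "u \<in> borel_measurable borel" "G \<in> borel_measurable borel"
    using ug by (auto simp: upper_gradient_def)
  let ?u = "\<lambda>y. ennreal (norm (u y)) * indicator ?Q y" and ?g = "\<lambda>y. G y * indicator ?Q y"
  let ?K = "?D ^ CARD('d) * (1 + 1 / l)"
  show ?case
  proof
    assume x: "x \<in> ?Q"
    have DD: "?D powr (?D - 1) \<le> ?D ^ CARD('d)"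
      by (subst powr_realpow[symmetric]) (auto intro!: powr_mono simp: Suc_le_eq)
    have "ennreal (l powr (1 - ?D)) * (\<integral>\<^sup>+y\<in>?Q. ?u y \<partial>lborel) \<le> ennreal (?D powr (?D - 1)) * riesz ?u x"
      by (rule cube_integral_le_riesz) (use l x d in auto)
    then have "ennreal (1 / l) * (ennreal (l powr (1 - ?D)) * (\<integral>\<^sup>+y\<in>?Q. ?u y \<partial>lborel)) \<le> ennreal (1 / l) * (ennreal (?D powr (?D - 1)) * riesz ?u x)"
      by (rule mult_left_mono) simp
    also have "ennreal (1 / l) * (ennreal (l powr (1 - ?D)) * (\<integral>\<^sup>+y\<in>?Q. ?u y \<partial>lborel)) = ennreal (1 / l ^ CARD('d)) * (\<integral>\<^sup>+y\<in>?Q. ennreal (norm (u y)) \<partial>lborel)"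
    proof -
      have "1 / l * l powr (1 - ?D) = 1 / l ^ CARD('d)" using l by (simp add: powr_diff powr_realpow)
      moreover have "(\<integral>\<^sup>+y\<in>?Q. ?u y \<partial>lborel) = (\<integral>\<^sup>+y\<in>?Q. ennreal (norm (u y)) \<partial>lborel)"
        by (intro nn_integral_cong) (auto split: split_indicator)
      ultimately show ?thesis using l by (simp add: mult.assoc[symmetric] ennreal_mult[symmetric])
    qed
    also have "ennreal (1 / l) * (ennreal (?D powr (?D - 1)) * riesz ?u x) = ennreal (1 / l * ?D powr (?D - 1)) * riesz ?u x"
      using l by (simp only: mult.assoc[symmetric]) (simp add: ennreal_mult'[symmetric])
    also have "\<dots> \<le> ennreal ?K * riesz ?u x"
    proof (intro mult_right_mono ennreal_leI)
      have "1 / l * ?D powr (?D - 1) \<le> (1 + 1 / l) * ?D ^ CARD('d)"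
        using l DD by (intro mult_mono) auto
      then show "1 / l * ?D powr (?D - 1) \<le> ?K" by (simp add: mult.commute)
    qed simp
    finally have "ennreal (norm (u x)) \<le> ennreal ?K * riesz ?u x + ennreal (?D ^ CARD('d)) * riesz ?g x"
      using elim x by (meson add_right_mono order_trans)
    also have "\<dots> \<le> ennreal ?K * riesz ?u x + ennreal ?K * riesz ?g x"
      using l by (intro add_left_mono mult_right_mono ennreal_leI) (auto simp: distrib_left)
    also have "\<dots> = ennreal ?K * riesz (\<lambda>y. ?u y + ?g y) x"
      by (subst riesz_add) (auto simp: distrib_left)
    finally show "ennreal (norm (u x)) \<le> ennreal ?K * riesz (\<lambda>y. (ennreal (norm (u y)) + G y) * indicator ?Q y) x"
      by (simp add: distrib_right)
  qed
qed

text \<open>On cubes growing to the whole space the mean value of an integrable function tends to 0,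
  and only the potential of the gradient remains.\<close>

lemma upper_gradient_pointwise_riesz:
  fixes u :: "real ^ 'd::finite \<Rightarrow> 'b::euclidean_space"
  assumes ug: "upper_gradient UNIV u G" and fin: "(\<integral>\<^sup>+y. ennreal (norm (u y)) \<partial>lborel) < top"
  shows "AE x in lborel. ennreal (norm (u x)) \<le> ennreal (real CARD('d) ^ CARD('d)) * riesz G x"
proof -
  let ?z = "\<lambda>n. (\<chi> i. - real (Suc n)) :: real ^ 'd" and ?l = "\<lambda>n. 2 * real (Suc n)"
  obtain A where A: "(\<integral>\<^sup>+y. ennreal (norm (u y)) \<partial>lborel) = ennreal A" "0 \<le> A"
    using fin by (cases "\<integral>\<^sup>+y. ennreal (norm (u y)) \<partial>lborel") auto
  have "AE x in lborel. \<forall>n. x \<in> side_cube (?z n) (?l n) \<longrightarrow> ennreal (norm (u x)) \<le>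
     ennreal (1 / ?l n ^ CARD('d)) * (\<integral>\<^sup>+y\<in>side_cube (?z n) (?l n). ennreal (norm (u y)) \<partial>lborel) +
     ennreal (real CARD('d) ^ CARD('d)) * riesz (\<lambda>y. G y * indicator (side_cube (?z n) (?l n)) y) x"
    unfolding AE_all_countable
    by (intro allI upper_gradient_pointwise_cube[OF ug]) auto
  then show ?thesis
  proof eventually_elim
    case (elim x)
    let ?R = "ennreal (real CARD('d) ^ CARD('d)) * riesz G x"
    have ev: "\<forall>\<^sub>F n in sequentially. ennreal (norm (u x)) \<le> ennreal (1 / ?l n ^ CARD('d) * A) + ?R"
    proof -
      obtain N where N: "norm x \<le> real N" using real_arch_simple by blast
      show ?thesis
      proof (rule eventually_sequentiallyI[of N])
        fix n assume n: "N \<le> n"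
        have "\<bar>x $ i\<bar> \<le> real (Suc n)" for i
          using component_le_norm_cart[of x i] N n by linarith
        then have "x \<in> side_cube (?z n) (?l n)" by (auto simp: mem_side_cube abs_le_iff) (smt (verit))+
        then have "ennreal (norm (u x)) \<le>
           ennreal (1 / ?l n ^ CARD('d)) * (\<integral>\<^sup>+y\<in>side_cube (?z n) (?l n). ennreal (norm (u y)) \<partial>lborel) +
           ennreal (real CARD('d) ^ CARD('d)) * riesz (\<lambda>y. G y * indicator (side_cube (?z n) (?l n)) y) x"
          using elim by blast
        also have "\<dots> \<le> ennreal (1 / ?l n ^ CARD('d)) * ennreal A + ?R"
          unfolding A(1)[symmetric]
          by (intro add_mono mult_left_mono nn_integral_mono riesz_mono_AE) (auto split: split_indicator)
        also have "ennreal (1 / ?l n ^ CARD('d)) * ennreal A = ennreal (1 / ?l n ^ CARD('d) * A)"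
          using A(2) by (intro ennreal_mult[symmetric]) auto
        finally show "ennreal (norm (u x)) \<le> ennreal (1 / ?l n ^ CARD('d) * A) + ?R" .
      qed
    qed
    have "(\<lambda>n. 1 / ?l n ^ CARD('d) * A) \<longlonglongrightarrow> 0"
    proof (rule tendsto_mult_left_zero, rule tendsto_sandwich[where f="\<lambda>_. 0" and h="\<lambda>n. inverse (real (Suc n))"])
      have "1 / ?l n ^ CARD('d) \<le> inverse (real (Suc n))" for n
      proof -
        have "real (Suc n) \<le> ?l n ^ 1" by simp
        also have "\<dots> \<le> ?l n ^ CARD('d)" by (intro power_increasing) (auto simp: Suc_le_eq)
        finally show ?thesis by (simp add: field_simps)
      qed
      then show "\<forall>\<^sub>F n in sequentially. 1 / ?l n ^ CARD('d) \<le> inverse (real (Suc n))" by simp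
    qed (use LIMSEQ_inverse_real_of_nat in auto)
    then have "(\<lambda>n. ennreal (1 / ?l n ^ CARD('d) * A) + ?R) \<longlonglongrightarrow> ennreal 0 + ?R"
      by (intro tendsto_add tendsto_ennrealI tendsto_const)
    from LIMSEQ_le_const[OF this] ev show ?case
      by (auto simp: eventually_sequentially)
  qed
qed

section \<open>Tensor products of one-dimensional bump functions\<close>

text \<open>These products suffice as test functions: they recover every integral over a box, and
  the order of differentiation is visibly irrelevant for them.\<close>

lemma power_le_fact_exp: "0 \<le> x \<Longrightarrow> x ^ n \<le> fact n * exp (x :: real)"
proof -
  assume x: "0 \<le> x"
  have s: "summable (\<lambda>k. x ^ k /\<^sub>R fact k)" by (rule summable_exp_generic)
  have "(\<Sum>k\<in>{n}. x ^ k /\<^sub>R fact k) \<le> exp x"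
    unfolding exp_def using x by (intro sum_le_suminf s) auto
  then show ?thesis by (simp add: field_simps)
qed

text \<open>Chosen to be closed under differentiation: with \<open>w = (t - a) (b - t)\<close> the
  derivative of \<open>p / w^m * exp (- c / w)\<close> has the same form with another polynomial and
  the power \<open>m + 2\<close>.\<close>

definition bump :: "real \<Rightarrow> real \<Rightarrow> real \<Rightarrow> real poly \<Rightarrow> nat \<Rightarrow> real \<Rightarrow> real" where
  "bump c a b p m t =
     (if a < t \<and> t < b then poly p t / ((t - a) * (b - t)) ^ m * exp (- c / ((t - a) * (b - t))) else 0)"

text \<open>The exponential beats every power of \<open>1 / w\<close>. Vanishing to second order at
  each point outside the open interval makes the derivative zero there, the endpoints
  included.\<close>

lemma bump_quadratic_bound:
  assumes c: "0 < c" and ab: "a < b" and t0: "\<not> (a < t0 \<and> t0 < b)"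
  obtains K where "\<And>t. \<bar>bump c a b p m t\<bar> \<le> K * (t - t0)\<^sup>2"
proof -
  have "compact (poly p ` {a..b})"
    by (intro compact_continuous_image continuous_intros) auto
  then obtain P where P: "\<And>t. t \<in> {a..b} \<Longrightarrow> \<bar>poly p t\<bar> \<le> P"
    by (metis bounded_iff compact_imp_bounded imageI real_norm_def)
  have P0: "0 \<le> P" using P[of a] ab by auto
  \<comment> \<open>From \<open>(c / w)^(m+2) <= (m+2)! exp (c / w)\<close>. The excess of two in
    the power leaves \<open>w^2\<close> after the division by \<open>w^m\<close>.\<close>
  define C where "C = fact (m + 2) / c ^ (m + 2)"
  have C0: "0 < C" using c by (simp add: C_def)
  have "\<bar>bump c a b p m t\<bar> \<le> P * C * (b - a)\<^sup>2 * (t - t0)\<^sup>2" for t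
  proof (cases "a < t \<and> t < b")
    case True
    define w where "w = (t - a) * (b - t)"
    have w: "0 < w" using True by (simp add: w_def)
    have "(c / w) ^ (m + 2) \<le> fact (m + 2) * exp (c / w)"
      using c w by (intro power_le_fact_exp) auto
    then have "exp (- c / w) \<le> C * w ^ (m + 2)"
      using c w by (simp add: C_def exp_minus power_divide field_simps del: fact_Suc)
    then have e: "exp (- c / w) / w ^ m \<le> C * w\<^sup>2"
      using w by (simp add: power_add field_simps power2_eq_square)
    have "w \<le> (b - a) * \<bar>t - t0\<bar>"
    proof (cases "t0 \<le> a")
      case True
      have "w \<le> (t - t0) * (b - a)" unfolding w_def using True \<open>a < t \<and> t < b\<close> by (intro mult_mono) auto
      then show ?thesis using True \<open>a < t \<and> t < b\<close> by (simp add: mult.commute)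
    next
      case False
      then have "b \<le> t0" using t0 by auto
      then have "w \<le> (b - a) * (t0 - t)" unfolding w_def using \<open>a < t \<and> t < b\<close> by (intro mult_mono) auto
      then show ?thesis using \<open>b \<le> t0\<close> \<open>a < t \<and> t < b\<close> by simp
    qed
    then have "w\<^sup>2 \<le> ((b - a) * \<bar>t - t0\<bar>)\<^sup>2" using w by (intro power_mono) auto
    then have w2: "w\<^sup>2 \<le> (b - a)\<^sup>2 * (t - t0)\<^sup>2" by (simp add: power_mult_distrib)
    have "\<bar>bump c a b p m t\<bar> = \<bar>poly p t\<bar> * (exp (- c / w) / w ^ m)"
      using True w by (simp add: bump_def w_def[symmetric] abs_mult)
    also have "\<dots> \<le> P * (C * ((b - a)\<^sup>2 * (t - t0)\<^sup>2))"
      using True P0 C0 w by (intro mult_mono P order_trans[OF e] mult_left_mono w2) auto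
    finally show ?thesis by (simp add: mult_ac)
  next
    case False
    then have "bump c a b p m t = 0" unfolding bump_def by (rule if_not_P)
    then show ?thesis using P0 C0 by simp
  qed
  then show ?thesis by (rule that)
qed

lemma DERIV_zero_of_quadratic_bound:
  fixes f :: "real \<Rightarrow> real"
  assumes "\<And>t. \<bar>f t\<bar> \<le> K * (t - t0)\<^sup>2"
  shows "DERIV f t0 :> 0"
proof -
  have 0: "f t0 = 0" using assms[of t0] by simp
  have "((\<lambda>h. (f (t0 + h) - f t0) / h) \<longlongrightarrow> 0) (at 0)"
  proof (rule Lim_null_comparison)
    show "\<forall>\<^sub>F h in at 0. norm ((f (t0 + h) - f t0) / h) \<le> K * \<bar>h\<bar>"
    proof (rule eventually_at_topological[THEN iffD2], intro exI[of _ UNIV] conjI ballI impI)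
      fix h :: real assume "h \<noteq> 0"
      then show "norm ((f (t0 + h) - f t0) / h) \<le> K * \<bar>h\<bar>"
        using assms[of "t0 + h"] 0 by (simp add: divide_le_eq abs_mult power2_eq_square mult.assoc)
    qed auto
    show "((\<lambda>h. K * \<bar>h\<bar>) \<longlongrightarrow> 0) (at 0)" by (auto intro!: tendsto_eq_intros)
  qed
  then show ?thesis by (simp add: DERIV_def)
qed

lemma DERIV_bump:
  assumes c: "0 < c" and ab: "a < b"
  obtains q where "\<And>t. DERIV (bump c a b p m) t :> bump c a b q (m + 2) t"
proof -
  define w where "w = [:- a, 1:] * [:b, - 1:]"
  \<comment> \<open>The numerator produced by the quotient and chain rules over the common
    denominator \<open>w^(m+2)\<close>.\<close>
  define q where "q = pderiv p * w ^ 2 - smult (real m) (p * pderiv w * w) + smult c (p * pderiv w)"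
  have pw: "poly w t = (t - a) * (b - t)" for t by (simp add: w_def algebra_simps)
  have "DERIV (bump c a b p m) t :> bump c a b q (m + 2) t" for t
  proof (cases "a < t \<and> t < b")
    case True
    have w0: "poly w t \<noteq> 0" using True by (simp add: pw)
    have "DERIV (\<lambda>t. poly p t / poly w t ^ m * exp (- c / poly w t)) t :> bump c a b q (m + 2) t"
    proof -
      define P where "P = poly p t"
      define P' where "P' = poly (pderiv p) t"
      define W where "W = poly w t"
      define W' where "W' = poly (pderiv w) t"
      have dp: "DERIV (poly p) t :> P'" "DERIV (poly w) t :> W'" unfolding P'_def W'_def by (auto intro: poly_DERIV)
      have "DERIV (\<lambda>t. poly p t / poly w t ^ m * exp (- c / poly w t)) t :>
        (P' * W ^ m - P * (real m * W ^ (m - Suc 0) * W')) / (W ^ m * W ^ m) * exp (- c / W) +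
        exp (- c / W) * (c * W' / (W * W)) * (P / W ^ m)"
        using w0 unfolding P_def W_def
        by (auto intro!: derivative_eq_intros dp[unfolded P'_def W'_def] simp: W_def P'_def W'_def field_simps)
      also have "(P' * W ^ m - P * (real m * W ^ (m - Suc 0) * W')) / (W ^ m * W ^ m) * exp (- c / W) +
        exp (- c / W) * (c * W' / (W * W)) * (P / W ^ m)
        = (P' * W\<^sup>2 - real m * (P * W' * W) + c * (P * W')) / W ^ (m + 2) * exp (- c / W)"
        using w0 unfolding W_def[symmetric]
        by (cases m) (simp_all add: field_simps power2_eq_square)
      also have "\<dots> = bump c a b q (m + 2) t"
        using True unfolding bump_def q_def by (simp add: P_def P'_def W_def W'_def pw)
      finally show ?thesis .
    qed
    moreover have "\<forall>\<^sub>F s in nhds t. poly p s / poly w s ^ m * exp (- c / poly w s) = bump c a b p m s"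
    proof -
      have "\<forall>\<^sub>F s in nhds t. s \<in> {a<..<b}" using True by (intro eventually_nhds_in_open) auto
      then show ?thesis by eventually_elim (simp add: bump_def pw)
    qed
    ultimately show ?thesis by (subst (asm) DERIV_cong_ev[OF refl _ refl])
  next
    case False
    then obtain K where "\<And>s. \<bar>bump c a b p m s\<bar> \<le> K * (s - t)\<^sup>2"
      using bump_quadratic_bound[OF c ab] by metis
    then have "DERIV (bump c a b p m) t :> 0" by (rule DERIV_zero_of_quadratic_bound)
    moreover have "bump c a b q (m + 2) t = 0" unfolding bump_def using False by (rule if_not_P)
    ultimately show ?thesis by simp
  qed
  then show ?thesis by (rule that)
qed

definition bump_class :: "real \<Rightarrow> real \<Rightarrow> (real \<Rightarrow> real) \<Rightarrow> bool" where
  "bump_class a b f \<longleftrightarrow> (\<exists>c p m. 0 < c \<and> a < b \<and> f = bump c a b p m)"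

lemma bump_class_deriv:
  assumes "bump_class a b f"
  shows "DERIV f t :> deriv f t" "bump_class a b (deriv f)"
proof -
  obtain c p m where f: "0 < c" "a < b" "f = bump c a b p m" using assms by (auto simp: bump_class_def)
  obtain q where q: "\<And>t. DERIV f t :> bump c a b q (m + 2) t" using DERIV_bump[OF f(1,2)] f(3) by metis
  then have "deriv f = bump c a b q (m + 2)" by (auto intro: DERIV_imp_deriv)
  then show "DERIV f t :> deriv f t" "bump_class a b (deriv f)"
    using q f by (auto simp: bump_class_def)
qed

lemma bump_class_support: "bump_class a b f \<Longrightarrow> f t \<noteq> 0 \<Longrightarrow> a < t \<and> t < b"
  by (auto simp: bump_class_def bump_def split: if_splits)

lemma bump_class_iterated_deriv: "bump_class a b f \<Longrightarrow> bump_class a b ((deriv ^^ n) f)"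
  by (induction n) (auto intro: bump_class_deriv)

definition tensor :: "('d::finite \<Rightarrow> real \<Rightarrow> real) \<Rightarrow> real ^ 'd \<Rightarrow> real" where
  "tensor h x = (\<Prod>i\<in>UNIV. h i (x $ i))"

definition bump_family :: "real ^ 'd::finite \<Rightarrow> real ^ 'd \<Rightarrow> ('d \<Rightarrow> real \<Rightarrow> real) \<Rightarrow> bool" where
  "bump_family a b h \<longleftrightarrow> (\<forall>i. bump_class (a $ i) (b $ i) (h i))"

lemma bump_family_deriv: "bump_family a b h \<Longrightarrow> bump_family a b (h(j := deriv (h j)))"
  by (auto simp: bump_family_def intro: bump_class_deriv)

lemma bump_family_iterated_deriv: "bump_family a b h \<Longrightarrow> bump_family a b (\<lambda>i. (deriv ^^ \<alpha> i) (h i))"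
  by (auto simp: bump_family_def intro: bump_class_iterated_deriv)

lemma tensor_has_derivative:
  assumes "bump_family a b h"
  shows "(tensor h has_derivative (\<lambda>v. \<Sum>j\<in>UNIV. v $ j * tensor (h(j := deriv (h j))) x)) (at x)"
proof -
  have d: "((\<lambda>x :: real ^ 'a. h i (x $ i)) has_derivative (\<lambda>v. v $ i * deriv (h i) (x $ i))) (at x)" for i
  proof -
    have "DERIV (h i) (x $ i) :> deriv (h i) (x $ i)"
      using assms bump_class_deriv(1) unfolding bump_family_def by blast
    from DERIV_compose_FDERIV[OF this bounded_linear_imp_has_derivative[OF bounded_linear_vec_nth]]
    show ?thesis .
  qed
  have "((\<lambda>x. \<Prod>i\<in>UNIV. h i (x $ i)) has_derivative
      (\<lambda>v. \<Sum>i\<in>UNIV. v $ i * deriv (h i) (x $ i) * (\<Prod>j\<in>UNIV - {i}. h j (x $ j)))) (at x)"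
    by (rule has_derivative_prod) (rule d)
  moreover have "tensor (h(j := deriv (h j))) x = deriv (h j) (x $ j) * (\<Prod>i\<in>UNIV - {j}. h i (x $ i))" for j
    unfolding tensor_def by (subst prod.remove[of _ j]) (auto intro!: prod.cong)
  ultimately show ?thesis by (simp add: tensor_def[abs_def] mult.assoc)
qed

lemma partial_deriv_tensor:
  assumes "bump_family a b h"
  shows "partial_deriv j (tensor h) = tensor (h(j := deriv (h j)))"
proof
  fix x
  have "frechet_derivative (tensor h) (at x) = (\<lambda>v. \<Sum>j\<in>UNIV. v $ j * tensor (h(j := deriv (h j))) x)"
    using frechet_derivative_at[OF tensor_has_derivative[OF assms]] by simp
  then show "partial_deriv j (tensor h) x = tensor (h(j := deriv (h j))) x"
    by (simp add: partial_deriv_def axis_def if_distrib[of "\<lambda>c. c * _"] cong: if_cong)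
qed

lemma iter_partial_tensor:
  assumes "bump_family a b h"
  shows "iter_partial js (tensor h) = tensor (\<lambda>i. (deriv ^^ count_list js i) (h i))"
proof (induction js)
  case (Cons j js)
  have "iter_partial (j # js) (tensor h) = partial_deriv j (tensor (\<lambda>i. (deriv ^^ count_list js i) (h i)))"
    using Cons by (simp add: iter_partial_def)
  also have "\<dots> = tensor (\<lambda>i. (deriv ^^ count_list (j # js) i) (h i))"
    by (subst partial_deriv_tensor[OF bump_family_iterated_deriv[OF assms]])
      (auto intro!: arg_cong[of _ _ tensor])
  finally show ?case .
qed (simp add: iter_partial_def)

lemma ex_count_list: "\<exists>js. \<forall>i :: 'd::finite. count_list js i = \<alpha> i"
proof -
  obtain xs :: "'d list" where xs: "set xs = UNIV" "distinct xs" using finite_distinct_list[OF finite] by blast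
  have rep: "count_list (replicate n j) i = (if i = j then n else 0)" for n and i j :: 'd
    by (induction n) auto
  have "count_list (concat (map (\<lambda>i. replicate (\<alpha> i) i) ys)) i = (if i \<in> set ys then \<alpha> i else 0)"
    if "distinct ys" for ys i
    using that by (induction ys) (auto simp: count_list_append rep)
  from this[OF xs(2)] show ?thesis using xs(1) by auto
qed

lemma some_count_list:
  fixes \<alpha> :: "'d::finite \<Rightarrow> nat"
  shows "count_list (SOME js. \<forall>i. count_list js i = \<alpha> i) i = \<alpha> i"
  using someI_ex[OF ex_count_list[of \<alpha>]] by blast

lemma multi_deriv_tensor:
  assumes "bump_family a b h"
  shows "multi_deriv \<alpha> (tensor h) = tensor (\<lambda>i. (deriv ^^ \<alpha> i) (h i))"
  unfolding multi_deriv_def iter_partial_tensor[OF assms] some_count_list ..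

lemma tensor_support:
  assumes "bump_family a b h" "tensor h x \<noteq> 0"
  shows "x \<in> box a b"
proof -
  have "a $ i < x $ i \<and> x $ i < b $ i" for i
    using assms by (intro bump_class_support[of _ _ "h i"]) (auto simp: bump_family_def tensor_def)
  then show ?thesis by (auto simp: mem_box_cart)
qed

lemma tensor_test_fun:
  assumes h: "bump_family a b h" and U: "cbox a b \<subseteq> U"
  shows "tensor h \<in> test_fun U"
proof -
  have "closure {x. tensor h x \<noteq> 0} \<subseteq> cbox a b"
    using tensor_support[OF h] box_subset_cbox[of a b] by (intro closure_minimal) auto
  moreover have "iter_partial js (tensor h) differentiable (at x)" for js x
    unfolding iter_partial_tensor[OF h]
    using tensor_has_derivative[OF bump_family_iterated_deriv[OF h]] by (auto simp: differentiable_def)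
  ultimately show ?thesis
    using U compact_cbox[of a b] bounded_subset[OF bounded_cbox] 
    by (auto simp: test_fun_def compact_eq_bounded_closed)
qed

lemma continuous_tensor:
  assumes "bump_family a b h"
  shows "continuous_on UNIV (tensor h)"
  using tensor_has_derivative[OF assms] by (auto intro!: continuous_at_imp_continuous_on has_derivative_continuous)

lemma bounded_tensor:
  assumes "bump_family a b h"
  obtains K where "0 < K" "\<And>x. \<bar>tensor h x\<bar> \<le> K"
proof -
  have "compact (tensor h ` cbox a b)"
    by (intro compact_continuous_image continuous_on_subset[OF continuous_tensor[OF assms]]) auto
  then obtain K where K: "0 < K" "\<And>x. x \<in> cbox a b \<Longrightarrow> \<bar>tensor h x\<bar> \<le> K"
    using bounded_pos[of "tensor h ` cbox a b"] compact_imp_bounded by auto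
  then have "\<bar>tensor h x\<bar> \<le> K" for x
    using tensor_support[OF assms, of x] box_subset_cbox[of a b] by (cases "tensor h x = 0") auto
  with K(1) show ?thesis by (rule that)
qed

text \<open>The factors \<open>exp (- 1 / ((n+1) w))\<close> increase to 1 inside the interval, so
  the products approximate the indicator of the open box from below.\<close>

definition box_bump :: "real ^ 'd::finite \<Rightarrow> real ^ 'd \<Rightarrow> nat \<Rightarrow> 'd \<Rightarrow> real \<Rightarrow> real" where
  "box_bump a b n i = bump (1 / real (Suc n)) (a $ i) (b $ i) 1 0"

lemma box_bump_family: "(\<And>i. a $ i < b $ i) \<Longrightarrow> bump_family a b (box_bump a b n)"
  unfolding bump_family_def bump_class_def box_bump_def
  by (intro allI exI[of _ "1 / real (Suc n)"] exI[of _ 1] exI[of _ 0]) auto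

lemma box_bump_bounds: "0 \<le> tensor (box_bump a b n) x" "tensor (box_bump a b n) x \<le> 1"
  unfolding tensor_def box_bump_def bump_def
  by (auto intro!: prod_nonneg prod_le_1)

lemma box_bump_tendsto: "(\<lambda>n. tensor (box_bump a b n) x) \<longlonglongrightarrow> indicator (box a b) x"
proof (cases "x \<in> box a b")
  case True
  have "(\<lambda>n. box_bump a b n i (x $ i)) \<longlonglongrightarrow> 1" for i
  proof -
    let ?w = "(x $ i - a $ i) * (b $ i - x $ i)"
    have i: "a $ i < x $ i" "x $ i < b $ i" using True by (auto simp: mem_box_cart)
    have "(\<lambda>n. - (inverse (real (Suc n))) / ?w) \<longlonglongrightarrow> - 0 / ?w"
      using i by (intro tendsto_intros LIMSEQ_inverse_real_of_nat) auto
    then have "(\<lambda>n. exp (- (inverse (real (Suc n))) / ?w)) \<longlonglongrightarrow> exp (- 0 / ?w)"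
      by (rule tendsto_exp)
    then show ?thesis using i by (simp add: box_bump_def bump_def inverse_eq_divide)
  qed
  then have "(\<lambda>n. tensor (box_bump a b n) x) \<longlonglongrightarrow> (\<Prod>i\<in>(UNIV :: 'a set). 1)"
    unfolding tensor_def by (intro tendsto_prod)
  then show ?thesis using True by simp
next
  case False
  then obtain i where "\<not> (a $ i < x $ i \<and> x $ i < b $ i)" by (auto simp: mem_box_cart)
  then have "box_bump a b n i (x $ i) = 0" for n by (auto simp: box_bump_def bump_def)
  then have "tensor (box_bump a b n) x = 0" for n unfolding tensor_def by (intro prod_zero) auto
  then show ?thesis using False by simp
qed

section \<open>Weak gradients are upper gradients\<close>

lemma integral_lborel_translate:
  fixes f :: "'a::euclidean_space \<Rightarrow> 'b::euclidean_space"
  assumes [measurable]: "f \<in> borel_measurable borel"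
  shows "(\<integral>x. f (x + t) \<partial>lborel) = (\<integral>x. f x \<partial>lborel)"
    and "integrable lborel (\<lambda>x. f (x + t)) \<longleftrightarrow> integrable lborel f"
proof -
  have eq: "lborel = distr lborel borel (\<lambda>x. x + t)"
  proof -
    have "(\<lambda>x. x + t) = (+) t" by (auto simp: add.commute)
    then show ?thesis by (simp add: lborel_distr_plus)
  qed
  show "(\<integral>x. f (x + t) \<partial>lborel) = (\<integral>x. f x \<partial>lborel)"
    by (subst (2) eq, subst integral_distr) auto
  show "integrable lborel (\<lambda>x. f (x + t)) \<longleftrightarrow> integrable lborel f"
    by (subst (2) eq, subst integrable_distr_eq) auto
qed

text \<open>Dominated convergence along \<open>box_bump\<close>, with the indicator of the closed
  box as majorant. The two boxes differ by a null set, and a degenerate box is itself null.\<close>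

lemma fundamental_lemma_cbox:
  fixes v :: "real ^ 'd::finite \<Rightarrow> 'b::euclidean_space"
  assumes [measurable]: "v \<in> borel_measurable borel" and int: "integrable lborel (\<lambda>x. indicator (cbox a b) x *\<^sub>R v x)"
    and zero: "\<And>h. bump_family a b h \<Longrightarrow> (\<integral>x. tensor h x *\<^sub>R v x \<partial>lborel) = 0"
  shows "(\<integral>x. indicator (cbox a b) x *\<^sub>R v x \<partial>lborel) = 0"
proof (cases "\<forall>i. a $ i < b $ i")
  case True
  have fam: "bump_family a b (box_bump a b n)" for n using True by (intro box_bump_family) auto
  have [measurable]: "tensor (box_bump a b n) \<in> borel_measurable borel" for n
    by (rule borel_measurable_continuous_onI[OF continuous_tensor[OF fam]])
  have "(\<lambda>n. \<integral>x. tensor (box_bump a b n) x *\<^sub>R v x \<partial>lborel) \<longlonglongrightarrow> (\<integral>x. indicator (box a b) x *\<^sub>R v x \<partial>lborel)"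
  proof (rule integral_dominated_convergence[where w="\<lambda>x. norm (indicator (cbox a b) x *\<^sub>R v x)"])
    show "AE x in lborel. (\<lambda>n. tensor (box_bump a b n) x *\<^sub>R v x) \<longlonglongrightarrow> indicator (box a b) x *\<^sub>R v x"
      by (intro AE_I2 tendsto_scaleR box_bump_tendsto tendsto_const)
    show "AE x in lborel. norm (tensor (box_bump a b n) x *\<^sub>R v x) \<le> norm (indicator (cbox a b) x *\<^sub>R v x)" for n
    proof (intro AE_I2)
      fix x
      show "norm (tensor (box_bump a b n) x *\<^sub>R v x) \<le> norm (indicator (cbox a b) x *\<^sub>R v x)"
      proof (cases "tensor (box_bump a b n) x = 0")
        case False
        then have "x \<in> cbox a b" using tensor_support[OF fam] box_subset_cbox[of a b] by blast
        then show ?thesis using box_bump_bounds[of a b n x] by (simp add: mult_left_le_one_le)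
      qed simp
    qed
    show "integrable lborel (\<lambda>x. norm (indicator (cbox a b) x *\<^sub>R v x))" by (rule integrable_norm[OF int])
  qed measurable
  then have "(\<integral>x. indicator (box a b) x *\<^sub>R v x \<partial>lborel) = 0"
    unfolding zero[OF fam] by (simp add: LIMSEQ_const_iff)
  moreover have "(\<integral>x. indicator (cbox a b) x *\<^sub>R v x \<partial>lborel) = (\<integral>x. indicator (box a b) x *\<^sub>R v x \<partial>lborel)"
  proof (rule integral_cong_AE)
    have "AE x in lborel. x \<notin> cbox a b - box a b" by (intro AE_not_in null_sets_cbox_Diff_box)
    then show "AE x in lborel. indicator (cbox a b) x *\<^sub>R v x = indicator (box a b) x *\<^sub>R v x"
      by eventually_elim (use box_subset_cbox[of a b] in \<open>auto simp: indicator_def\<close>)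
  qed auto
  ultimately show ?thesis by simp
next
  case False
  then obtain i where i: "\<not> a $ i < b $ i" by auto
  have "x \<notin> box a b" for x
  proof
    assume "x \<in> box a b"
    then have "a $ i < x $ i" "x $ i < b $ i" by (auto simp: mem_box_cart)
    with i show False by linarith
  qed
  then have "box a b = {}" by auto
  have "AE x in lborel. x \<notin> cbox a b - box a b" by (intro AE_not_in null_sets_cbox_Diff_box)
  then have "AE x in lborel. indicator (cbox a b) x *\<^sub>R v x = 0"
    by eventually_elim (use \<open>box a b = {}\<close> in auto)
  then show ?thesis by (rule integral_eq_zero_AE)
qed

text \<open>By Lebesgue differentiation over cubes with corner \<open>x\<close>, almost every value
  of \<open>v\<close> is a limit of averages over boxes inside \<open>V\<close>, and these averages
  vanish. Countably many boxes cover \<open>V\<close>.\<close>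

lemma fundamental_lemma:
  fixes v :: "real ^ 'd::finite \<Rightarrow> 'b::euclidean_space"
  assumes V: "open V" and [measurable]: "v \<in> borel_measurable borel"
    and int: "\<And>a b. cbox a b \<subseteq> V \<Longrightarrow> integrable lborel (\<lambda>x. indicator (cbox a b) x *\<^sub>R v x)"
    and zero: "\<And>a b h. cbox a b \<subseteq> V \<Longrightarrow> bump_family a b h \<Longrightarrow> (\<integral>x. tensor h x *\<^sub>R v x \<partial>lborel) = 0"
  shows "AE x in lborel. x \<in> V \<longrightarrow> v x = 0"
proof -
  have cb: "AE x in lborel. x \<in> cbox c e \<longrightarrow> v x = 0" if ce: "cbox c e \<subseteq> V" for c e
  proof -
    define f where "f x = indicator (cbox c e) x *\<^sub>R v x" for x
    have intf: "integrable lborel f" unfolding f_def using int[OF ce] .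
    then have setf: "set_integrable lborel S f" if "S \<in> sets borel" for S
      unfolding set_integrable_def using that by (intro integrable_mult_indicator) auto
    have "f integrable_on cbox a b" for a b
      using set_borel_integral_eq_integral(1)[OF setf] by simp
    then obtain N where N: "negligible N"
      "\<And>x e. x \<notin> N \<Longrightarrow> 0 < e \<Longrightarrow> \<exists>d>0. \<forall>h. 0 < h \<and> h < d \<longrightarrow>
          norm (integral (cbox x (x + h *\<^sub>R One)) f /\<^sub>R h ^ DIM(real ^ 'd) - f x) < e"
      by (rule integrable_ccontinuous_explicit) blast
    have "v x = 0" if x: "x \<in> box c e" "x \<notin> N" for x
    proof -
      have "norm (f x) < \<epsilon>" if \<epsilon>: "0 < \<epsilon>" for \<epsilon>
      proof -
        obtain d where d: "0 < d" "\<And>h. 0 < h \<Longrightarrow> h < d \<Longrightarrow> norm (integral (cbox x (x + h *\<^sub>R One)) f /\<^sub>R h ^ DIM(real ^ 'd) - f x) < \<epsilon>"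
          using N(2)[OF x(2) \<epsilon>] by blast
        define m where "m = Min (range (\<lambda>i. e $ i - x $ i))"
        have m: "0 < m" "\<And>i. m \<le> e $ i - x $ i"
          using x(1) unfolding m_def by (auto simp: mem_box_cart)
        define h where "h = min (d / 2) m"
        have h: "0 < h" "h < d" "h \<le> m" using d(1) m by (auto simp: h_def)
        have One: "(One :: real ^ 'd) $ i = 1" for i
        proof -
          have "axis i 1 \<in> (Basis :: (real ^ 'd) set)" by (simp add: axis_in_Basis_iff)
          then show ?thesis using inner_sum_Basis by (simp add: cart_eq_inner_axis)
        qed
        have sub: "cbox x (x + h *\<^sub>R One) \<subseteq> cbox c e"
        proof
          fix y assume "y \<in> cbox x (x + h *\<^sub>R One)"
          then have y: "x $ i \<le> y $ i" "y $ i \<le> x $ i + h" for i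
            by (simp_all only: mem_box_cart vector_add_component vector_scaleR_component One real_scaleR_def mult_1_right)
          have "c $ i \<le> y $ i \<and> y $ i \<le> e $ i" for i
            using y[of i] m(2)[of i] h(3) x(1) by (auto simp: mem_box_cart intro: order_trans[of _ "x $ i"] less_imp_le)
          then show "y \<in> cbox c e" by (auto simp: mem_box_cart)
        qed
        then have "cbox x (x + h *\<^sub>R One) \<subseteq> V" using ce by auto
        have "integral (cbox x (x + h *\<^sub>R One)) f = (LINT y:cbox x (x + h *\<^sub>R One)|lborel. f y)"
          using set_borel_integral_eq_integral(2)[OF setf, of "cbox x (x + h *\<^sub>R One)"] by simp
        also have "\<dots> = (\<integral>y. indicator (cbox x (x + h *\<^sub>R One)) y *\<^sub>R v y \<partial>lborel)"
          unfolding set_lebesgue_integral_def f_def using sub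
          by (intro Bochner_Integration.integral_cong) (auto simp: indicator_def)
        also have "\<dots> = 0"
          using \<open>cbox x (x + h *\<^sub>R One) \<subseteq> V\<close> by (intro fundamental_lemma_cbox int zero) auto
        finally show ?thesis using d(2)[OF h(1,2)] by simp
      qed
      then have "f x = 0" by (metis less_irrefl zero_less_norm_iff)
      then show "v x = 0" using x(1) box_subset_cbox[of c e] by (auto simp: f_def)
    qed
    moreover have "AE x in lborel. x \<notin> N"
    proof -
      have "AE x in lebesgue. x \<notin> N" using N(1) by (intro AE_not_in) (simp add: negligible_iff_null_sets)
      then show ?thesis by (simp add: AE_completion_iff)
    qed
    moreover have "AE x in lborel. x \<notin> cbox c e - box c e" by (intro AE_not_in null_sets_cbox_Diff_box)
    ultimately show ?thesis by (elim AE_mp) (auto intro!: AE_I2)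
  qed
  obtain D where D: "countable D" "\<Union>D = V" "\<And>X. X \<in> D \<Longrightarrow> \<exists>a b. X = cbox a b"
    using open_countable_Union_open_cbox[OF V] by metis
  have "AE x in lborel. \<forall>X\<in>D. x \<in> X \<longrightarrow> v x = 0"
    unfolding AE_ball_countable[OF D(1)] using cb D(2,3) by blast
  then show ?thesis by eventually_elim (use D(2) in auto)
qed

text \<open>First-order weak derivatives with Borel representatives, tested only against products of
  bumps. All integrals are over \<open>lborel\<close>, so Fubini applies on the product space
  without passing to completions.\<close>

definition weak_gradient ::
  "(real ^ 'd::finite) set \<Rightarrow> (real ^ 'd \<Rightarrow> 'b::euclidean_space) \<Rightarrow> ('d \<Rightarrow> real ^ 'd \<Rightarrow> 'b) \<Rightarrow> bool" where
  "weak_gradient U u g \<longleftrightarrow> u \<in> borel_measurable borel \<and> (\<forall>i. g i \<in> borel_measurable borel) \<and>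
     (\<forall>K. compact K \<longrightarrow> K \<subseteq> U \<longrightarrow> integrable lborel (\<lambda>x. indicator K x *\<^sub>R u x) \<and>
        (\<forall>i. integrable lborel (\<lambda>x. indicator K x *\<^sub>R g i x))) \<and>
     (\<forall>a b h i. cbox a b \<subseteq> U \<longrightarrow> bump_family a b h \<longrightarrow>
        (\<integral>x. tensor (h(i := deriv (h i))) x *\<^sub>R u x \<partial>lborel) = - (\<integral>x. tensor h x *\<^sub>R g i x \<partial>lborel))"

lemma weak_gradientD:
  assumes "weak_gradient U u g" "cbox a b \<subseteq> U" "bump_family a b h"
  shows "(\<integral>x. tensor (h(i := deriv (h i))) x *\<^sub>R u x \<partial>lborel) = - (\<integral>x. tensor h x *\<^sub>R g i x \<partial>lborel)"
  using assms(1)[unfolded weak_gradient_def, THEN conjunct2, THEN conjunct2, THEN conjunct2, rule_format, OF assms(2,3)] .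

lemma bump_class_shift:
  assumes "bump_class a b f"
  shows "bump_class (a + c) (b + c) (\<lambda>t. f (t - c))"
proof -
  obtain e p m where f: "0 < e" "a < b" "f = bump e a b p m" using assms by (auto simp: bump_class_def)
  have "(\<lambda>t. f (t - c)) = bump e (a + c) (b + c) (pcompose p [:- c, 1:]) m"
    unfolding f bump_def by (auto simp: fun_eq_iff poly_pcompose algebra_simps)
  then show ?thesis unfolding bump_class_def using f by (intro exI[of _ e] exI conjI) auto
qed

lemma bump_class_deriv_shift:
  assumes "bump_class a b f"
  shows "deriv (\<lambda>t. f (t - c)) = (\<lambda>t. deriv f (t - c))"
proof
  fix t
  have "DERIV f (t + - c) :> deriv f (t - c)" using bump_class_deriv(1)[OF assms] by simp
  then have "DERIV (\<lambda>t. f (t + - c)) t :> deriv f (t - c)" by (subst (asm) DERIV_shift)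
  then show "deriv (\<lambda>t. f (t - c)) t = deriv f (t - c)" by (intro DERIV_imp_deriv) simp
qed

lemma bump_family_shift: "bump_family a b h \<Longrightarrow> bump_family (a + c) (b + c) (\<lambda>i t. h i (t - c $ i))"
  by (auto simp: bump_family_def intro: bump_class_shift)

lemma tensor_shift: "tensor (\<lambda>i t. h i (t - c $ i)) x = tensor h (x - c)"
  by (simp add: tensor_def)

lemma tensor_deriv_shift:
  assumes "bump_family a b h"
  shows "tensor ((\<lambda>i t. h i (t - c $ i))(j := deriv (\<lambda>t. h j (t - c $ j)))) x = tensor (h(j := deriv (h j))) (x - c)"
proof -
  have "deriv (\<lambda>t. h j (t - c $ j)) = (\<lambda>t. deriv (h j) (t - c $ j))"
    using assms unfolding bump_family_def by (intro bump_class_deriv_shift) auto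
  then show ?thesis unfolding tensor_def by (intro prod.cong) auto
qed

lemma integrable_pair_unit_interval:
  fixes f :: "real \<Rightarrow> real ^ 'd::finite \<Rightarrow> 'b::euclidean_space"
  assumes [measurable]: "(\<lambda>(s, x). f s x) \<in> borel_measurable (lborel \<Otimes>\<^sub>M lborel)" and C: "C < top"
    and b: "\<And>s. (\<integral>\<^sup>+x. ennreal (norm (f s x)) \<partial>lborel) \<le> C * indicator {0..1} s"
  shows "integrable (lborel \<Otimes>\<^sub>M lborel) (\<lambda>(s, x). f s x)"
proof (rule integrableI_bounded)
  have "(\<integral>\<^sup>+z. ennreal (norm (case z of (s, x) \<Rightarrow> f s x)) \<partial>(lborel \<Otimes>\<^sub>M lborel)) =
      (\<integral>\<^sup>+s. \<integral>\<^sup>+x. ennreal (norm (f s x)) \<partial>lborel \<partial>lborel)"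
    by (subst lborel.nn_integral_fst[symmetric]) auto
  also have "\<dots> \<le> (\<integral>\<^sup>+s. C * indicator {0..1 :: real} s \<partial>lborel)" by (rule nn_integral_mono) (rule b)
  also have "\<dots> < \<infinity>" using C by (simp add: nn_integral_cmult_indicator)
  finally show "(\<integral>\<^sup>+z. ennreal (norm (case z of (s, x) \<Rightarrow> f s x)) \<partial>(lborel \<Otimes>\<^sub>M lborel)) < \<infinity>" .
qed measurable

text \<open>\<open>W\<close> is the line integral that \<open>u (x + w) - u x\<close> should equal.
  Tested against \<open>h\<close>, the translation moves onto \<open>h\<close>, where the
  fundamental theorem of calculus applies; Fubini, the weak derivative at each fixed
  \<open>s\<close>, and Fubini again transfer the derivative to \<open>g\<close>.\<close>

lemma weak_gradient_difference:
  fixes u :: "real ^ 'd::finite \<Rightarrow> 'b::euclidean_space" and w :: "real ^ 'd"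
  assumes wg: "weak_gradient U u g" and U: "convex U"
    and ab: "cbox a b \<subseteq> {x. x \<in> U \<and> x + w \<in> U}"
  defines "W \<equiv> \<lambda>x. \<integral>s. indicator {0..1 :: real} s *\<^sub>R (\<Sum>i\<in>UNIV. w $ i *\<^sub>R g i (x + s *\<^sub>R w)) \<partial>lborel"
  defines "v \<equiv> \<lambda>x. u (x + w) - u x - W x"
  shows "integrable lborel (\<lambda>x. indicator (cbox a b) x *\<^sub>R v x)"
    and "bump_family a b h \<Longrightarrow> (\<integral>x. tensor h x *\<^sub>R v x \<partial>lborel) = 0"
proof -
  have [measurable]: "u \<in> borel_measurable borel" "\<And>i. g i \<in> borel_measurable borel"
    using wg by (auto simp: weak_gradient_def)
  have seg: "x + s *\<^sub>R w \<in> U" if "x \<in> cbox a b" "0 \<le> s" "s \<le> 1" for x s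
  proof -
    have "x \<in> U" "x + w \<in> U" using ab that by auto
    from convexD[OF U this, of "1 - s" s] show ?thesis using that by (simp add: algebra_simps)
  qed
  \<comment> \<open>The compact set swept out by all segments from \<open>x\<close> to
    \<open>x + w\<close>. Convexity keeps it inside \<open>U\<close>, so \<open>u\<close> and
    \<open>g\<close> are integrable over it and every translate of the box by \<open>s w\<close> is
    covered.\<close>
  define K where "K = (\<lambda>(s, x). x + s *\<^sub>R w) ` ({0..1} \<times> cbox a b)"
  have K: "compact K" "K \<subseteq> U"
    unfolding K_def using seg
    by (auto intro!: compact_continuous_image continuous_intros compact_Times simp: case_prod_unfold)
  have [measurable]: "K \<in> sets borel" using K(1) by (rule borel_compact)
  have KI: "x + s *\<^sub>R w \<in> K" if "x \<in> cbox a b" "0 \<le> s" "s \<le> 1" for x s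
    unfolding K_def using that by (intro image_eqI[of _ _ "(s, x)"]) auto
  have intK: "integrable lborel (\<lambda>x. indicator K x *\<^sub>R u x)" "integrable lborel (\<lambda>x. indicator K x *\<^sub>R g i x)" for i
    using wg K by (auto simp: weak_gradient_def)
  define Ag where "Ag = (\<integral>\<^sup>+x. (\<Sum>i\<in>UNIV. ennreal \<bar>w $ i\<bar> * ennreal (norm (indicator K x *\<^sub>R g i x))) \<partial>lborel)"
  define Au where "Au = (\<integral>\<^sup>+x. ennreal (norm (indicator K x *\<^sub>R u x)) \<partial>lborel)"
  have Au: "Au < top" unfolding Au_def using intK(1) by (simp add: integrable_iff_bounded)
  have Ag: "Ag < top"
  proof -
    have "Ag = (\<Sum>i\<in>UNIV. ennreal \<bar>w $ i\<bar> * (\<integral>\<^sup>+x. ennreal (norm (indicator K x *\<^sub>R g i x)) \<partial>lborel))"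
      unfolding Ag_def by (subst nn_integral_sum) (auto simp: nn_integral_cmult)
    also have "\<dots> < top" using intK(2) by (auto simp: integrable_iff_bounded ennreal_mult_less_top ennreal_sum_less_top)
    finally show ?thesis .
  qed
  \<comment> \<open>Stated for a bounded weight because it serves twice: with the indicator of the
    box for integrability of \<open>W\<close>, and with \<open>tensor h\<close> for exchanging the
    integrals.\<close>
  have gpair: "integrable (lborel \<Otimes>\<^sub>M lborel) (\<lambda>(s, x). (indicator {0..1 :: real} s * \<psi> x) *\<^sub>R (\<Sum>i\<in>UNIV. w $ i *\<^sub>R g i (x + s *\<^sub>R w)))"
    if [measurable]: "\<psi> \<in> borel_measurable borel" and C: "\<And>x. \<bar>\<psi> x\<bar> \<le> C" "\<And>x. x \<notin> cbox a b \<Longrightarrow> \<psi> x = 0" for \<psi> C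
  proof (rule integrable_pair_unit_interval[where C="ennreal C * Ag"])
    show "ennreal C * Ag < top" using Ag by (simp add: ennreal_mult_less_top)
    fix s :: real
    show "(\<integral>\<^sup>+x. ennreal (norm ((indicator {0..1 :: real} s * \<psi> x) *\<^sub>R (\<Sum>i\<in>UNIV. w $ i *\<^sub>R g i (x + s *\<^sub>R w)))) \<partial>lborel) \<le> ennreal C * Ag * indicator {0..1} s"
    proof (cases "s \<in> {0..1}")
      case True
      have "(\<integral>\<^sup>+x. ennreal (norm ((indicator {0..1 :: real} s * \<psi> x) *\<^sub>R (\<Sum>i\<in>UNIV. w $ i *\<^sub>R g i (x + s *\<^sub>R w)))) \<partial>lborel)
        \<le> (\<integral>\<^sup>+x. ennreal C * (\<Sum>i\<in>UNIV. ennreal \<bar>w $ i\<bar> * ennreal (norm (indicator K (s *\<^sub>R w + x) *\<^sub>R g i (s *\<^sub>R w + x)))) \<partial>lborel)"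
      proof (rule nn_integral_mono)
        fix x
        show "ennreal (norm ((indicator {0..1 :: real} s * \<psi> x) *\<^sub>R (\<Sum>i\<in>UNIV. w $ i *\<^sub>R g i (x + s *\<^sub>R w))))
          \<le> ennreal C * (\<Sum>i\<in>UNIV. ennreal \<bar>w $ i\<bar> * ennreal (norm (indicator K (s *\<^sub>R w + x) *\<^sub>R g i (s *\<^sub>R w + x))))"
        proof (cases "x \<in> cbox a b")
          case x: True
          have C0: "0 \<le> C" using C(1)[of x] by linarith
          have k: "s *\<^sub>R w + x \<in> K" using KI[OF x, of s] True by (simp add: add.commute)
          have "norm ((indicator {0..1 :: real} s * \<psi> x) *\<^sub>R (\<Sum>i\<in>UNIV. w $ i *\<^sub>R g i (x + s *\<^sub>R w)))
             = \<bar>\<psi> x\<bar> * norm (\<Sum>i\<in>UNIV. w $ i *\<^sub>R g i (x + s *\<^sub>R w))" using True by simp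
          also have "\<dots> \<le> C * (\<Sum>i\<in>UNIV. \<bar>w $ i\<bar> * norm (g i (s *\<^sub>R w + x)))"
            using C0 C(1)[of x] norm_sum[of "\<lambda>i. w $ i *\<^sub>R g i (x + s *\<^sub>R w)" UNIV] by (intro mult_mono) (auto simp: add.commute)
          finally have "ennreal (norm ((indicator {0..1 :: real} s * \<psi> x) *\<^sub>R (\<Sum>i\<in>UNIV. w $ i *\<^sub>R g i (x + s *\<^sub>R w))))
             \<le> ennreal (C * (\<Sum>i\<in>UNIV. \<bar>w $ i\<bar> * norm (g i (s *\<^sub>R w + x))))" by (rule ennreal_leI)
          then show ?thesis using k C0 by (simp add: ennreal_mult' sum_nonneg flip: sum_ennreal)
        next
          case False
          then show ?thesis using C(2) by simp
        qed
      qed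
      also have "\<dots> = ennreal C * (\<integral>\<^sup>+x. (\<Sum>i\<in>UNIV. ennreal \<bar>w $ i\<bar> * ennreal (norm (indicator K (s *\<^sub>R w + x) *\<^sub>R g i (s *\<^sub>R w + x)))) \<partial>lborel)"
        by (rule nn_integral_cmult) measurable
      also have "(\<integral>\<^sup>+x. (\<Sum>i\<in>UNIV. ennreal \<bar>w $ i\<bar> * ennreal (norm (indicator K (s *\<^sub>R w + x) *\<^sub>R g i (s *\<^sub>R w + x)))) \<partial>lborel) = Ag"
        unfolding Ag_def
        by (rule nn_integral_lborel_translate[of "\<lambda>x. \<Sum>i\<in>UNIV. ennreal \<bar>w $ i\<bar> * ennreal (norm (indicator K x *\<^sub>R g i x))"]) measurable
      finally show ?thesis using True by simp
    qed simp
  qed measurable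
  have W_eq: "(\<integral>s. (indicator {0..1 :: real} s * \<psi> x) *\<^sub>R (\<Sum>i\<in>UNIV. w $ i *\<^sub>R g i (x + s *\<^sub>R w)) \<partial>lborel) = \<psi> x *\<^sub>R W x" for \<psi> :: "real ^ 'd \<Rightarrow> real" and x
    unfolding W_def by (subst integral_scaleR_right[symmetric]) (simp add: mult.commute)
  have intB: "integrable lborel (\<lambda>x. indicator (cbox a b) x *\<^sub>R u x)" "integrable lborel (\<lambda>x. indicator (cbox a b) x *\<^sub>R u (x + w))"
  proof -
    show "integrable lborel (\<lambda>x. indicator (cbox a b) x *\<^sub>R u x)"
    proof -
      have "cbox a b \<subseteq> U" using ab by auto
      moreover have "integrable lborel (\<lambda>x. indicator L x *\<^sub>R u x)" if "compact L" "L \<subseteq> U" for L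
        using wg that by (simp add: weak_gradient_def)
      ultimately show ?thesis using compact_cbox by blast
    qed
    have "integrable lborel (\<lambda>x. indicator K (x + w) *\<^sub>R u (x + w))"
      using integral_lborel_translate(2)[of "\<lambda>x. indicator K x *\<^sub>R u x" w] intK(1) by simp
    from integrable_mult_indicator[OF _ this, of "cbox a b"]
    have "integrable lborel (\<lambda>x. indicator (cbox a b) x *\<^sub>R indicator K (x + w) *\<^sub>R u (x + w))" by simp
    moreover have "indicator (cbox a b) x *\<^sub>R indicator K (x + w) *\<^sub>R u (x + w) = indicator (cbox a b) x *\<^sub>R u (x + w)" for x
      using KI[of x 1] by (auto simp: indicator_def)
    ultimately show "integrable lborel (\<lambda>x. indicator (cbox a b) x *\<^sub>R u (x + w))" by (simp only:)
  qed
  have intW: "integrable lborel (\<lambda>x. \<psi> x *\<^sub>R W x)"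
    if "\<psi> \<in> borel_measurable borel" "\<And>x. \<bar>\<psi> x\<bar> \<le> C" "\<And>x. x \<notin> cbox a b \<Longrightarrow> \<psi> x = 0" for \<psi> C
    using lborel_pair.integrable_snd[OF gpair[OF that]] unfolding W_eq .
  have intv: "integrable lborel (\<lambda>x. indicator (cbox a b) x *\<^sub>R W x)"
    using intW[of "indicator (cbox a b)" 1] by (auto simp: indicator_def)
  show "integrable lborel (\<lambda>x. indicator (cbox a b) x *\<^sub>R v x)"
    unfolding v_def scaleR_diff_right by (intro Bochner_Integration.integrable_diff intB intv)
  show "(\<integral>x. tensor h x *\<^sub>R v x \<partial>lborel) = 0" if h: "bump_family a b h"
  proof -
    define hd where "hd i = h(i := deriv (h i))" for i
    have hd: "bump_family a b (hd i)" for i unfolding hd_def by (rule bump_family_deriv[OF h])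
    have [measurable]: "tensor h \<in> borel_measurable borel" "\<And>i. tensor (hd i) \<in> borel_measurable borel"
      by (rule borel_measurable_continuous_onI[OF continuous_tensor[OF h]])
        (rule borel_measurable_continuous_onI[OF continuous_tensor[OF hd]])
    have supp: "tensor h x = 0" "tensor (hd i) x = 0" if "x \<notin> cbox a b" for i x
      using that tensor_support[OF h] tensor_support[OF hd] box_subset_cbox[of a b] by blast+
    obtain C where C: "0 < C" "\<And>x. \<bar>tensor h x\<bar> \<le> C" using bounded_tensor[OF h] by blast
    have "\<exists>C. 0 < C \<and> (\<forall>x. \<bar>tensor (hd i) x\<bar> \<le> C)" for i using bounded_tensor[OF hd] by metis
    then obtain Cd where Cd: "\<And>i. 0 < Cd i" "\<And>i x. \<bar>tensor (hd i) x\<bar> \<le> Cd i" by metis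
    have intC: "integrable lborel (\<lambda>x. tensor h x *\<^sub>R z x)"
      if "integrable lborel (\<lambda>x. indicator (cbox a b) x *\<^sub>R z x)" "z \<in> borel_measurable borel" for z :: "real ^ 'd \<Rightarrow> 'b"
    proof (rule Bochner_Integration.integrable_bound[OF integrable_scaleR_right[OF that(1), of C]])
      show "AE x in lborel. norm (tensor h x *\<^sub>R z x) \<le> norm (C *\<^sub>R indicator (cbox a b) x *\<^sub>R z x)"
      proof (intro AE_I2)
        fix x
        show "norm (tensor h x *\<^sub>R z x) \<le> norm (C *\<^sub>R indicator (cbox a b) x *\<^sub>R z x)"
          using C(1) C(2)[of x] supp(1)[of x] by (cases "x \<in> cbox a b") (auto intro: mult_right_mono)
      qed
    qed (use that(2) in measurable)
    have "(\<integral>x. tensor h x *\<^sub>R (u (x + w) - u x) \<partial>lborel) = (\<integral>x. tensor h x *\<^sub>R u (x + w) \<partial>lborel) - (\<integral>x. tensor h x *\<^sub>R u x \<partial>lborel)"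
      unfolding scaleR_diff_right by (intro Bochner_Integration.integral_diff intC intB) measurable
    also have "(\<integral>x. tensor h x *\<^sub>R u (x + w) \<partial>lborel) = (\<integral>x. tensor h (x - w) *\<^sub>R u x \<partial>lborel)"
      using integral_lborel_translate(1)[of "\<lambda>x. tensor h (x - w) *\<^sub>R u x" w] by simp
    also have "\<dots> - (\<integral>x. tensor h x *\<^sub>R u x \<partial>lborel) = (\<integral>x. (tensor h (x - w) - tensor h x) *\<^sub>R u x \<partial>lborel)"
      unfolding scaleR_diff_left
    proof (rule Bochner_Integration.integral_diff[symmetric])
      show "integrable lborel (\<lambda>x. tensor h (x - w) *\<^sub>R u x)"
        using integral_lborel_translate(2)[of "\<lambda>x. tensor h (x - w) *\<^sub>R u x" w] intC[OF intB(2)] by simp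
      show "integrable lborel (\<lambda>x. tensor h x *\<^sub>R u x)" by (rule intC[OF intB(1)]) measurable
    qed
    \<comment> \<open>The smooth function \<open>s \<mapsto> tensor h (y - s w)\<close> is written
      as the integral of its derivative over \<open>[0, 1]\<close>.\<close>
    also have "\<dots> = (\<integral>y. (\<integral>s. - (indicator {0..1 :: real} s * (\<Sum>i\<in>UNIV. w $ i * tensor (hd i) (y - s *\<^sub>R w))) *\<^sub>R u y \<partial>lborel) \<partial>lborel)"
    proof (intro Bochner_Integration.integral_cong refl)
      fix y
      define F where "F s = tensor h (y - s *\<^sub>R w)" for s
      define f where "f s = - (\<Sum>i\<in>UNIV. w $ i * tensor (hd i) (y - s *\<^sub>R w))" for s
      have "((\<lambda>s. tensor h (y - s *\<^sub>R w)) has_derivative (\<lambda>t. \<Sum>j\<in>UNIV. (- (t *\<^sub>R w)) $ j * tensor (hd j) (y - s *\<^sub>R w))) (at s)" for s :: real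
        unfolding hd_def
        by (rule has_derivative_compose[OF _ tensor_has_derivative[OF h]]) (auto intro!: derivative_eq_intros)
      then have dF: "(F has_vector_derivative f s) (at s)" for s
        unfolding F_def[abs_def] f_def has_vector_derivative_def
        by (simp add: sum_distrib_left sum_negf mult_ac)
      have cf: "continuous_on {0..1} f"
        unfolding f_def by (intro continuous_intros continuous_on_compose2[OF continuous_tensor[OF hd]]) auto
      have "(\<integral>s. indicator {0..1 :: real} s *\<^sub>R f s \<partial>lborel) = F 1 - F 0"
        by (rule integral_FTC_Icc) (auto intro: has_vector_derivative_at_within dF cf)
      moreover have "integrable lborel (\<lambda>s. indicator {0..1 :: real} s *\<^sub>R f s)"
        using borel_integrable_atLeastAtMost'[OF cf] by (simp add: set_integrable_def)
      ultimately show "(tensor h (y - w) - tensor h y) *\<^sub>R u y =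
          (\<integral>s. - (indicator {0..1 :: real} s * (\<Sum>i\<in>UNIV. w $ i * tensor (hd i) (y - s *\<^sub>R w))) *\<^sub>R u y \<partial>lborel)"
        using integral_scaleR_left[of "u y" lborel "\<lambda>s. indicator {0..1 :: real} s *\<^sub>R f s"]
        by (simp add: F_def f_def)
    qed
    also have "\<dots> = (\<integral>s. (\<integral>y. - (indicator {0..1 :: real} s * (\<Sum>i\<in>UNIV. w $ i * tensor (hd i) (y - s *\<^sub>R w))) *\<^sub>R u y \<partial>lborel) \<partial>lborel)"
    proof (rule lborel_pair.Fubini_integral)
      define C' where "C' = (\<Sum>i\<in>UNIV. \<bar>w $ i\<bar> * Cd i)"
      have C': "0 \<le> C'" unfolding C'_def using Cd(1) by (intro sum_nonneg mult_nonneg_nonneg) (auto intro: less_imp_le)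
      show "integrable (lborel \<Otimes>\<^sub>M lborel) (\<lambda>(s, y). - (indicator {0..1 :: real} s * (\<Sum>i\<in>UNIV. w $ i * tensor (hd i) (y - s *\<^sub>R w))) *\<^sub>R u y)"
      proof (rule integrable_pair_unit_interval[where C="ennreal C' * Au"])
        show "ennreal C' * Au < top" using Au by (simp add: ennreal_mult_less_top)
        fix s :: real
        show "(\<integral>\<^sup>+y. ennreal (norm (- (indicator {0..1 :: real} s * (\<Sum>i\<in>UNIV. w $ i * tensor (hd i) (y - s *\<^sub>R w))) *\<^sub>R u y)) \<partial>lborel)
          \<le> ennreal C' * Au * indicator {0..1} s"
        proof (cases "s \<in> {0..1}")
          case True
          have "(\<integral>\<^sup>+y. ennreal (norm (- (indicator {0..1 :: real} s * (\<Sum>i\<in>UNIV. w $ i * tensor (hd i) (y - s *\<^sub>R w))) *\<^sub>R u y)) \<partial>lborel)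
            \<le> (\<integral>\<^sup>+y. ennreal C' * ennreal (norm (indicator K y *\<^sub>R u y)) \<partial>lborel)"
          proof (rule nn_integral_mono)
            fix y
            show "ennreal (norm (- (indicator {0..1 :: real} s * (\<Sum>i\<in>UNIV. w $ i * tensor (hd i) (y - s *\<^sub>R w))) *\<^sub>R u y)) \<le> ennreal C' * ennreal (norm (indicator K y *\<^sub>R u y))"
            proof (cases "y - s *\<^sub>R w \<in> cbox a b")
              case y: True
              have k: "y \<in> K" using KI[OF y, of s] True by simp
              have "\<bar>\<Sum>i\<in>UNIV. w $ i * tensor (hd i) (y - s *\<^sub>R w)\<bar> \<le> C'"
                unfolding C'_def by (rule order_trans[OF sum_abs]) (auto simp: abs_mult intro!: sum_mono mult_left_mono Cd(2))
              then have "norm (- (indicator {0..1 :: real} s * (\<Sum>i\<in>UNIV. w $ i * tensor (hd i) (y - s *\<^sub>R w))) *\<^sub>R u y) \<le> C' * norm (indicator K y *\<^sub>R u y)"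
                using True k by (simp add: mult_right_mono)
              then show ?thesis using C' by (simp add: ennreal_mult[symmetric] ennreal_leI)
            qed (simp add: supp)
          qed
          also have "\<dots> = ennreal C' * Au" unfolding Au_def by (rule nn_integral_cmult) measurable
          finally show ?thesis using True by simp
        qed simp
      qed measurable
    qed
    also have "\<dots> = (\<integral>s. (\<integral>x. (indicator {0..1 :: real} s * tensor h x) *\<^sub>R (\<Sum>i\<in>UNIV. w $ i *\<^sub>R g i (x + s *\<^sub>R w)) \<partial>lborel) \<partial>lborel)"
    proof (rule Bochner_Integration.integral_cong[OF refl])
      fix s :: real
      show "(\<integral>y. - (indicator {0..1 :: real} s * (\<Sum>i\<in>UNIV. w $ i * tensor (hd i) (y - s *\<^sub>R w))) *\<^sub>R u y \<partial>lborel) =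
        (\<integral>x. (indicator {0..1 :: real} s * tensor h x) *\<^sub>R (\<Sum>i\<in>UNIV. w $ i *\<^sub>R g i (x + s *\<^sub>R w)) \<partial>lborel)"
      proof (cases "s \<in> {0..1}")
        case True
        \<comment> \<open>The test function translated by \<open>s w\<close>. Its box lies in
          \<open>K\<close>, hence in \<open>U\<close>, so the weak derivative may be tested with it.
          The minus sign of integration by parts cancels the one from differentiating
          \<open>y - s w\<close> in \<open>s\<close>.\<close>
        define hs where "hs i t = h i (t - (s *\<^sub>R w) $ i)" for i t
        have hs: "bump_family (a + s *\<^sub>R w) (b + s *\<^sub>R w) hs" unfolding hs_def by (rule bump_family_shift[OF h])
        have box_shift: "cbox (a + s *\<^sub>R w) (b + s *\<^sub>R w) \<subseteq> K"
        proof
          fix y assume "y \<in> cbox (a + s *\<^sub>R w) (b + s *\<^sub>R w)"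
          then have "y - s *\<^sub>R w \<in> cbox a b" by (auto simp: mem_box_cart algebra_simps)
          from KI[OF this, of s] True show "y \<in> K" by simp
        qed
        have hsd: "tensor (hs(i := deriv (hs i))) y = tensor (hd i) (y - s *\<^sub>R w)" for i y
          unfolding hs_def[abs_def] hd_def by (rule tensor_deriv_shift[OF h])
        have hst: "tensor hs y = tensor h (y - s *\<^sub>R w)" for y
          unfolding hs_def[abs_def] by (rule tensor_shift)
        have one: "(\<integral>y. tensor (hd i) (y - s *\<^sub>R w) *\<^sub>R u y \<partial>lborel) = - (\<integral>x. tensor h x *\<^sub>R g i (x + s *\<^sub>R w) \<partial>lborel)" for i
        proof -
          have "(\<integral>y. tensor (hs(i := deriv (hs i))) y *\<^sub>R u y \<partial>lborel) = - (\<integral>y. tensor hs y *\<^sub>R g i y \<partial>lborel)"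
            by (rule weak_gradientD[OF wg order_trans[OF box_shift K(2)] hs])
          then have "(\<integral>y. tensor (hd i) (y - s *\<^sub>R w) *\<^sub>R u y \<partial>lborel) = - (\<integral>y. tensor h (y - s *\<^sub>R w) *\<^sub>R g i y \<partial>lborel)"
            unfolding hsd hst .
          also have "(\<integral>y. tensor h (y - s *\<^sub>R w) *\<^sub>R g i y \<partial>lborel) = (\<integral>x. tensor h x *\<^sub>R g i (x + s *\<^sub>R w) \<partial>lborel)"
            using integral_lborel_translate(1)[of "\<lambda>y. tensor h (y - s *\<^sub>R w) *\<^sub>R g i y" "s *\<^sub>R w"] by simp
          finally show ?thesis .
        qed
        have int1: "integrable lborel (\<lambda>y. tensor (hd i) (y - s *\<^sub>R w) *\<^sub>R u y)" for i
        proof (rule Bochner_Integration.integrable_bound[OF integrable_scaleR_right[OF intK(1), of "Cd i"]])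
          show "AE y in lborel. norm (tensor (hd i) (y - s *\<^sub>R w) *\<^sub>R u y) \<le> norm (Cd i *\<^sub>R indicator K y *\<^sub>R u y)"
          proof (intro AE_I2)
            fix y
            show "norm (tensor (hd i) (y - s *\<^sub>R w) *\<^sub>R u y) \<le> norm (Cd i *\<^sub>R indicator K y *\<^sub>R u y)"
            proof (cases "y - s *\<^sub>R w \<in> cbox a b")
              case y: True
              have "y \<in> K" using KI[OF y, of s] True by simp
              then show ?thesis using Cd(1)[of i] Cd(2)[of i "y - s *\<^sub>R w"] by (auto intro: mult_right_mono)
            qed (simp add: supp)
          qed
        qed measurable
        have int2: "integrable lborel (\<lambda>x. tensor h x *\<^sub>R g i (x + s *\<^sub>R w))" for i
        proof (rule intC)
          have "integrable lborel (\<lambda>x. indicator K (x + s *\<^sub>R w) *\<^sub>R g i (x + s *\<^sub>R w))"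
            using integral_lborel_translate(2)[of "\<lambda>x. indicator K x *\<^sub>R g i x" "s *\<^sub>R w"] intK(2) by simp
          from integrable_mult_indicator[OF _ this, of "cbox a b"]
          have "integrable lborel (\<lambda>x. indicator (cbox a b) x *\<^sub>R indicator K (x + s *\<^sub>R w) *\<^sub>R g i (x + s *\<^sub>R w))" by simp
          moreover have "indicator (cbox a b) x *\<^sub>R indicator K (x + s *\<^sub>R w) *\<^sub>R g i (x + s *\<^sub>R w) = indicator (cbox a b) x *\<^sub>R g i (x + s *\<^sub>R w)" for x
            using KI[of x s] True by (auto simp: indicator_def)
          ultimately show "integrable lborel (\<lambda>x. indicator (cbox a b) x *\<^sub>R g i (x + s *\<^sub>R w))" by (simp only:)
        qed measurable
        have "(\<integral>y. - (indicator {0..1 :: real} s * (\<Sum>i\<in>UNIV. w $ i * tensor (hd i) (y - s *\<^sub>R w))) *\<^sub>R u y \<partial>lborel)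
          = (\<integral>y. - (\<Sum>i\<in>UNIV. w $ i *\<^sub>R (tensor (hd i) (y - s *\<^sub>R w) *\<^sub>R u y)) \<partial>lborel)"
          using True by (simp add: scaleR_sum_left)
        also have "\<dots> = - (\<Sum>i\<in>UNIV. w $ i *\<^sub>R (\<integral>y. tensor (hd i) (y - s *\<^sub>R w) *\<^sub>R u y \<partial>lborel))"
        proof -
          have "(\<integral>y. (\<Sum>i\<in>UNIV. w $ i *\<^sub>R (tensor (hd i) (y - s *\<^sub>R w) *\<^sub>R u y)) \<partial>lborel) =
             (\<Sum>i\<in>UNIV. \<integral>y. w $ i *\<^sub>R (tensor (hd i) (y - s *\<^sub>R w) *\<^sub>R u y) \<partial>lborel)"
            by (intro Bochner_Integration.integral_sum integrable_scaleR_right int1)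
          also have "\<dots> = (\<Sum>i\<in>UNIV. w $ i *\<^sub>R (\<integral>y. tensor (hd i) (y - s *\<^sub>R w) *\<^sub>R u y \<partial>lborel))"
            by (intro sum.cong refl integral_scaleR_right int1)
          finally show ?thesis by (simp only: integral_minus)
        qed
        also have "\<dots> = (\<Sum>i\<in>UNIV. w $ i *\<^sub>R (\<integral>x. tensor h x *\<^sub>R g i (x + s *\<^sub>R w) \<partial>lborel))"
          unfolding one by (simp add: sum_negf)
        also have "\<dots> = (\<integral>x. (\<Sum>i\<in>UNIV. w $ i *\<^sub>R (tensor h x *\<^sub>R g i (x + s *\<^sub>R w))) \<partial>lborel)"
        proof -
          have "(\<integral>x. (\<Sum>i\<in>UNIV. w $ i *\<^sub>R (tensor h x *\<^sub>R g i (x + s *\<^sub>R w))) \<partial>lborel) =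
             (\<Sum>i\<in>UNIV. \<integral>x. w $ i *\<^sub>R (tensor h x *\<^sub>R g i (x + s *\<^sub>R w)) \<partial>lborel)"
            by (intro Bochner_Integration.integral_sum integrable_scaleR_right int2)
          also have "\<dots> = (\<Sum>i\<in>UNIV. w $ i *\<^sub>R (\<integral>x. tensor h x *\<^sub>R g i (x + s *\<^sub>R w) \<partial>lborel))"
            by (intro sum.cong refl integral_scaleR_right int2)
          finally show ?thesis ..
        qed
        also have "\<dots> = (\<integral>x. (indicator {0..1 :: real} s * tensor h x) *\<^sub>R (\<Sum>i\<in>UNIV. w $ i *\<^sub>R g i (x + s *\<^sub>R w)) \<partial>lborel)"
          using True by (simp add: scaleR_sum_right mult.commute)
        finally show ?thesis .
      qed simp
    qed
    also have "\<dots> = (\<integral>x. (\<integral>s. (indicator {0..1 :: real} s * tensor h x) *\<^sub>R (\<Sum>i\<in>UNIV. w $ i *\<^sub>R g i (x + s *\<^sub>R w)) \<partial>lborel) \<partial>lborel)"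
      by (rule lborel_pair.Fubini_integral[symmetric]) (rule gpair[OF _ C(2) supp(1)], measurable)
    also have "\<dots> = (\<integral>x. tensor h x *\<^sub>R W x \<partial>lborel)" unfolding W_eq ..
    finally have eq: "(\<integral>x. tensor h x *\<^sub>R (u (x + w) - u x) \<partial>lborel) = (\<integral>x. tensor h x *\<^sub>R W x \<partial>lborel)" .
    have "(\<integral>x. tensor h x *\<^sub>R v x \<partial>lborel) = (\<integral>x. tensor h x *\<^sub>R (u (x + w) - u x) \<partial>lborel) - (\<integral>x. tensor h x *\<^sub>R W x \<partial>lborel)"
      unfolding v_def scaleR_diff_right[of _ "u _ - u _"]
    proof (rule Bochner_Integration.integral_diff)
      show "integrable lborel (\<lambda>x. tensor h x *\<^sub>R (u (x + w) - u x))"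
        unfolding scaleR_diff_right by (intro Bochner_Integration.integrable_diff intC intB) measurable
      show "integrable lborel (\<lambda>x. tensor h x *\<^sub>R W x)" by (rule intW[OF _ C(2) supp(1)]) measurable
    qed
    then show ?thesis using eq by simp
  qed
qed

text \<open>For each fixed \<open>w\<close> the fundamental lemma is applied on the open set where
  both \<open>x\<close> and \<open>x + w\<close> lie in \<open>U\<close>, so that
  \<open>u (x + w) - u x\<close> equals the line integral of \<open>g\<close> almost
  everywhere.\<close>

lemma weak_gradient_upper_gradient:
  fixes u :: "real ^ 'd::finite \<Rightarrow> 'b::euclidean_space"
  assumes wg: "weak_gradient U u g" and U: "open U" "convex U"
  shows "upper_gradient U u (\<lambda>x. \<Sum>i\<in>UNIV. ennreal (norm (g i x)))"
proof -
  have [measurable]: "u \<in> borel_measurable borel" "\<And>i. g i \<in> borel_measurable borel"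
    using wg by (auto simp: weak_gradient_def)
  let ?G = "\<lambda>x. \<Sum>i\<in>UNIV. ennreal (norm (g i x))"
  have "AE x in lborel. x \<in> U \<and> x + w \<in> U \<longrightarrow>
      ennreal (norm (u (x + w) - u x)) \<le> ennreal (norm w) * (\<integral>\<^sup>+s\<in>{0<..1}. ?G (x + s *\<^sub>R w) \<partial>lborel)" for w
  proof -
    let ?V = "{x. x \<in> U \<and> x + w \<in> U}"
    define W where "W x = (\<integral>s. indicator {0..1 :: real} s *\<^sub>R (\<Sum>i\<in>UNIV. w $ i *\<^sub>R g i (x + s *\<^sub>R w)) \<partial>lborel)" for x
    have [measurable]: "W \<in> borel_measurable borel" unfolding W_def[abs_def] by measurable
    have "open ((\<lambda>x. x + w) -` U)" by (intro open_vimage U continuous_intros)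
    then have V: "open ?V" using U(1) by (auto simp: vimage_def Collect_conj_eq)
    have "AE x in lborel. x \<in> ?V \<longrightarrow> u (x + w) - u x - W x = 0"
      unfolding W_def using weak_gradient_difference[OF wg U(2), of _ _ w]
      by (intro fundamental_lemma V) (auto simp: W_def[symmetric])
    then show ?thesis
    proof eventually_elim
      case (elim x)
      show ?case
      proof
        assume x: "x \<in> U \<and> x + w \<in> U"
        let ?f = "\<lambda>s. indicator {0..1 :: real} s *\<^sub>R (\<Sum>i\<in>UNIV. w $ i *\<^sub>R g i (x + s *\<^sub>R w))"
        have "ennreal (norm (W x)) \<le> (\<integral>\<^sup>+s. ennreal (norm (?f s)) \<partial>lborel)"
        proof (cases "integrable lborel ?f")
          case True
          then show ?thesis unfolding W_def by (rule integral_norm_bound_ennreal)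
        next
          \<comment> \<open>The Bochner integral of a non-integrable function is 0 by convention, so
            the bound holds here as well.\<close>
          case False
          then show ?thesis unfolding W_def by (simp add: not_integrable_integral_eq)
        qed
        also have "\<dots> \<le> (\<integral>\<^sup>+s. ennreal (norm w) * (?G (x + s *\<^sub>R w) * indicator {0<..1} s) \<partial>lborel)"
        proof (rule nn_integral_mono_AE)
          \<comment> \<open>The intervals \<open>{0..1}\<close> and \<open>{0<..1}\<close> differ at
            \<open>s = 0\<close> only.\<close>
          show "AE s in lborel. ennreal (norm (?f s)) \<le> ennreal (norm w) * (?G (x + s *\<^sub>R w) * indicator {0<..1} s)"
            using AE_lborel_singleton[of "0 :: real"]
          proof eventually_elim
            case (elim s)
            show ?case
            proof (cases "s \<in> {0..1}")
              case True
              have "norm (\<Sum>i\<in>UNIV. w $ i *\<^sub>R g i (x + s *\<^sub>R w)) \<le> (\<Sum>i\<in>UNIV. \<bar>w $ i\<bar> * norm (g i (x + s *\<^sub>R w)))"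
                by (rule order_trans[OF norm_sum]) simp
              also have "\<dots> \<le> (\<Sum>i\<in>UNIV. norm w * norm (g i (x + s *\<^sub>R w)))"
                by (intro sum_mono mult_right_mono component_le_norm_cart) auto
              also have "\<dots> = norm w * (\<Sum>i\<in>UNIV. norm (g i (x + s *\<^sub>R w)))" by (simp add: sum_distrib_left)
              finally have "ennreal (norm (?f s)) \<le> ennreal (norm w * (\<Sum>i\<in>UNIV. norm (g i (x + s *\<^sub>R w))))"
                using True by (intro ennreal_leI) simp
              then show ?thesis using True elim by (simp add: ennreal_mult sum_nonneg)
            qed auto
          qed
        qed
        also have "\<dots> = ennreal (norm w) * (\<integral>\<^sup>+s\<in>{0<..1}. ?G (x + s *\<^sub>R w) \<partial>lborel)"
          by (rule nn_integral_cmult) measurable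
        finally show "ennreal (norm (u (x + w) - u x)) \<le> \<dots>" using elim x by simp
      qed
    qed
  qed
  then show ?thesis by (simp add: upper_gradient_def)
qed

section \<open>Systems of derivatives\<close>

definition midx :: "nat \<Rightarrow> ('d::finite \<Rightarrow> nat) set" where
  "midx m = {\<alpha>. multi_abs \<alpha> = m}"

definition sucidx :: "('d::finite \<Rightarrow> nat) \<Rightarrow> 'd \<Rightarrow> 'd \<Rightarrow> nat" where
  "sucidx \<beta> i = \<beta>(i := Suc (\<beta> i))"

lemma multi_abs_sucidx: "multi_abs (sucidx \<beta> i) = Suc (multi_abs \<beta>)"
  unfolding multi_abs_def sucidx_def
  by (subst (1 2) sum.remove[of _ i]) (auto intro!: sum.cong)

lemma finite_midx [simp]: "finite (midx m :: ('d::finite \<Rightarrow> nat) set)"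
proof -
  have "\<alpha> i \<le> m" if "\<alpha> \<in> midx m" for \<alpha> :: "'d \<Rightarrow> nat" and i
    using that member_le_sum[of i UNIV \<alpha>] by (auto simp: midx_def multi_abs_def)
  then have "midx m \<subseteq> {\<alpha> :: 'd \<Rightarrow> nat. \<forall>x. (x \<in> UNIV \<longrightarrow> \<alpha> x \<in> {..m}) \<and> (x \<notin> UNIV \<longrightarrow> \<alpha> x = 0)}"
    by auto
  moreover have "finite \<dots>" by (rule finite_set_of_finite_funs) auto
  ultimately show ?thesis by (rule finite_subset)
qed

text \<open>The \<open>l1\<close> counterpart of \<open>grad_abs\<close>. Sums match the form of the
  upper gradients and pass through the linear operator \<open>riesz\<close>; the comparison with
  \<open>grad_abs\<close> costs the number of multi-indices.\<close>

definition grad_sum :: "(('d::finite \<Rightarrow> nat) \<Rightarrow> real ^ 'd \<Rightarrow> 'b::euclidean_space) \<Rightarrow> nat \<Rightarrow> real ^ 'd \<Rightarrow> ennreal" where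
  "grad_sum u m x = (\<Sum>\<alpha>\<in>midx m. ennreal (norm (u \<alpha> x)))"

text \<open>What the estimates need to know about derivatives, instantiated by the classical
  derivatives of a test function on \<open>UNIV\<close> and by Borel representatives of weak
  derivatives on an open box.\<close>

definition deriv_system ::
  "(real ^ 'd::finite) set \<Rightarrow> nat \<Rightarrow> (('d \<Rightarrow> nat) \<Rightarrow> real ^ 'd \<Rightarrow> 'b::euclidean_space) \<Rightarrow> bool" where
  "deriv_system U k u \<longleftrightarrow> (\<forall>\<alpha>. multi_abs \<alpha> \<le> k \<longrightarrow> u \<alpha> \<in> borel_measurable borel) \<and>
     (\<forall>\<beta>. multi_abs \<beta> < k \<longrightarrow> upper_gradient U (u \<beta>) (\<lambda>x. \<Sum>i\<in>UNIV. ennreal (norm (u (sucidx \<beta> i) x))))"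

lemma grad_sum_borel: "deriv_system U k u \<Longrightarrow> m \<le> k \<Longrightarrow> grad_sum u m \<in> borel_measurable borel"
  unfolding grad_sum_def[abs_def]
  by (intro borel_measurable_sum measurable_compose[OF _ measurable_ennreal] borel_measurable_norm)
    (auto simp: deriv_system_def midx_def)

lemma sum_sucidx_le_grad_sum:
  assumes "\<beta> \<in> midx m"
  shows "(\<Sum>i\<in>UNIV. ennreal (norm (u (sucidx \<beta> i) x))) \<le> grad_sum u (Suc m) x"
proof -
  have "inj (sucidx \<beta>)"
    by (rule injI) (metis sucidx_def fun_upd_same fun_upd_other n_not_Suc_n)
  then have "(\<Sum>i\<in>UNIV. ennreal (norm (u (sucidx \<beta> i) x))) = (\<Sum>\<alpha>\<in>range (sucidx \<beta>). ennreal (norm (u \<alpha> x)))"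
    by (simp add: sum.reindex)
  also have "\<dots> \<le> grad_sum u (Suc m) x"
    unfolding grad_sum_def using assms by (intro sum_mono2 finite_midx) (auto simp: midx_def multi_abs_sucidx)
  finally show ?thesis .
qed

lemma upper_gradient_mono:
  assumes "upper_gradient U u G" "G' \<in> borel_measurable borel" "\<And>x. G x \<le> G' x"
  shows "upper_gradient U u G'"
  unfolding upper_gradient_def
proof (intro conjI allI)
  fix h
  have "AE x in lborel. x \<in> U \<and> x + h \<in> U \<longrightarrow>
      ennreal (norm (u (x + h) - u x)) \<le> ennreal (norm h) * (\<integral>\<^sup>+s\<in>{0<..1}. G (x + s *\<^sub>R h) \<partial>lborel)"
    using assms(1) by (simp add: upper_gradient_def)
  then show "AE x in lborel. x \<in> U \<and> x + h \<in> U \<longrightarrow>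
      ennreal (norm (u (x + h) - u x)) \<le> ennreal (norm h) * (\<integral>\<^sup>+s\<in>{0<..1}. G' (x + s *\<^sub>R h) \<partial>lborel)"
  proof eventually_elim
    case (elim x)
    have "(\<integral>\<^sup>+s\<in>{0<..1}. G (x + s *\<^sub>R h) \<partial>lborel) \<le> (\<integral>\<^sup>+s\<in>{0<..1}. G' (x + s *\<^sub>R h) \<partial>lborel)"
      by (intro nn_integral_mono mult_right_mono assms(3)) auto
    from mult_left_mono[OF this, of "ennreal (norm h)"] elim show ?case by (auto intro: order_trans)
  qed
qed (use assms in \<open>auto simp: upper_gradient_def\<close>)

lemma deriv_system_upper_gradient:
  assumes u: "deriv_system U k u" and "\<beta> \<in> midx m" "m < k"
  shows "upper_gradient U (u \<beta>) (grad_sum u (Suc m))"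
  using assms by (intro upper_gradient_mono[OF _ grad_sum_borel[OF u] sum_sucidx_le_grad_sum])
    (auto simp: deriv_system_def midx_def)

definition idx_const :: "'d::finite itself \<Rightarrow> nat \<Rightarrow> real" where
  "idx_const _ k = 1 + (\<Sum>m\<le>k. real (card (midx m :: ('d \<Rightarrow> nat) set)))"

lemma idx_const: "1 \<le> idx_const TYPE('d::finite) k"
  "m \<le> k \<Longrightarrow> real (card (midx m :: ('d \<Rightarrow> nat) set)) \<le> idx_const TYPE('d) k"
  unfolding idx_const_def
  by (auto intro!: sum_nonneg add_increasing member_le_sum[of m "{..k}" "\<lambda>m. real (card (midx m))"])

lemma grad_sum_cube_step:
  fixes u :: "('d::finite \<Rightarrow> nat) \<Rightarrow> real ^ 'd \<Rightarrow> 'b::euclidean_space"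
  assumes u: "deriv_system (box z (z + (\<chi> i. l))) k u" and l: "0 < l" and m: "m < k" and d: "2 \<le> CARD('d)"
  defines "G \<equiv> \<lambda>m x. grad_sum u m x * indicator (side_cube z l) x"
  shows "AE x in lborel. G m x \<le> ennreal (idx_const TYPE('d) k * (real CARD('d) ^ CARD('d) * (1 + 1 / l))) * riesz (\<lambda>y. G m y + G (Suc m) y) x"
proof -
  let ?K = "real CARD('d) ^ CARD('d) * (1 + 1 / l)"
  have K: "0 \<le> ?K" using l by simp
  have [measurable]: "grad_sum u m \<in> borel_measurable borel" "grad_sum u (Suc m) \<in> borel_measurable borel"
    using grad_sum_borel[OF u] m by auto
  have "AE x in lborel. \<forall>\<beta>\<in>midx m. x \<in> side_cube z l \<longrightarrow> ennreal (norm (u \<beta> x)) \<le>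
     ennreal ?K * riesz (\<lambda>y. (ennreal (norm (u \<beta> y)) + grad_sum u (Suc m) y) * indicator (side_cube z l) y) x"
    by (intro AE_finite_allI finite_midx upper_gradient_pointwise_riesz_cube[OF deriv_system_upper_gradient[OF u _ m]] l d) auto
  then show ?thesis
  proof eventually_elim
    case (elim x)
    show ?case
    proof (cases "x \<in> side_cube z l")
      case True
      have "G m x = (\<Sum>\<beta>\<in>midx m. ennreal (norm (u \<beta> x)))" using True by (simp add: G_def grad_sum_def)
      also have "\<dots> \<le> (\<Sum>\<beta>\<in>(midx m :: ('d \<Rightarrow> nat) set). ennreal ?K * riesz (\<lambda>y. G m y + G (Suc m) y) x)"
      proof (rule sum_mono)
        fix \<beta> :: "'d \<Rightarrow> nat" assume \<beta>: "\<beta> \<in> midx m"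
        have "ennreal (norm (u \<beta> y)) \<le> grad_sum u m y" for y
          unfolding grad_sum_def using \<beta> by (intro member_le_sum[of \<beta> _ "\<lambda>\<beta>. ennreal (norm (u \<beta> y))"]) auto
        then have "riesz (\<lambda>y. (ennreal (norm (u \<beta> y)) + grad_sum u (Suc m) y) * indicator (side_cube z l) y) x \<le> riesz (\<lambda>y. G m y + G (Suc m) y) x"
          by (intro riesz_mono_AE AE_I2) (auto simp: G_def indicator_def add_right_mono)
        then show "ennreal (norm (u \<beta> x)) \<le> ennreal ?K * riesz (\<lambda>y. G m y + G (Suc m) y) x"
          using elim \<beta> True by (meson mult_left_mono order_trans zero_le)
      qed
      also have "\<dots> = ennreal (real (card (midx m :: ('d \<Rightarrow> nat) set)) * ?K) * riesz (\<lambda>y. G m y + G (Suc m) y) x"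
        using K by (simp add: ennreal_mult ennreal_of_nat_eq_real_of_nat mult.assoc)
      also have "\<dots> \<le> ennreal (idx_const TYPE('d) k * ?K) * riesz (\<lambda>y. G m y + G (Suc m) y) x"
        using m K by (intro mult_right_mono ennreal_leI idx_const) auto
      finally show ?thesis .
    qed (simp add: G_def)
  qed
qed

text \<open>Each step bounds order \<open>m\<close> by a potential of the orders \<open>m\<close>
  and \<open>m + 1\<close> together; the factor 2 in \<open>C\<close> pays for the two terms. As
  \<open>m + n <= k\<close>, only the orders 1 to \<open>k\<close> are met, and their sum serves as
  a common density. Starting at \<open>m >= 1\<close> keeps the function itself out.\<close>

lemma grad_sum_cube_iterate:
  fixes u :: "('d::finite \<Rightarrow> nat) \<Rightarrow> real ^ 'd \<Rightarrow> 'b::euclidean_space"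
  assumes u: "deriv_system (box z (z + (\<chi> i. l))) k u" and l: "0 < l" and d: "2 \<le> CARD('d)"
  defines "G \<equiv> \<lambda>m x. grad_sum u m x * indicator (side_cube z l) x"
  defines "C \<equiv> 2 * (idx_const TYPE('d) k * (real CARD('d) ^ CARD('d) * (1 + 1 / l)))"
  assumes "1 \<le> m" "m + n \<le> k"
  shows "AE x in lborel. G m x \<le> ennreal (C ^ n) * (riesz ^^ n) (\<lambda>x. \<Sum>j=1..k. G j x) x"
  using assms(6,7)
proof (induction n arbitrary: m)
  case 0
  then show ?case
  proof (intro AE_I2)
    fix x
    have "G m x \<le> (\<Sum>j=1..k. G j x)"
      using 0 by (intro member_le_sum[of m "{1..k}" "\<lambda>j. G j x"]) auto
    then show "G m x \<le> ennreal (C ^ 0) * (riesz ^^ 0) (\<lambda>x. \<Sum>j=1..k. G j x) x" by simp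
  qed
next
  case (Suc n)
  let ?H = "\<lambda>x. \<Sum>j=1..k. G j x"
  have C: "0 \<le> C" unfolding C_def using l idx_const(1)[where ?'d='d and k=k] by simp
  have [measurable]: "G j \<in> borel_measurable borel" if "j \<le> k" for j
    using grad_sum_borel[OF u that] unfolding G_def by simp
  have [measurable]: "?H \<in> borel_measurable borel" by (intro borel_measurable_sum) auto
  have Hn [measurable]: "(riesz ^^ n) ?H \<in> borel_measurable borel" for n
    by (induction n) auto
  have sum: "AE x in lborel. G m x + G (Suc m) x \<le> ennreal (2 * C ^ n) * (riesz ^^ n) ?H x"
  proof -
    have "AE x in lborel. G m x \<le> ennreal (C ^ n) * (riesz ^^ n) ?H x"
      "AE x in lborel. G (Suc m) x \<le> ennreal (C ^ n) * (riesz ^^ n) ?H x"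
      using Suc.IH[of m] Suc.IH[of "Suc m"] Suc.prems by auto
    then show ?thesis
    proof eventually_elim
      case (elim x)
      from add_mono[OF this] show ?case
        using C by (simp add: ennreal_mult mult_2[symmetric] mult.assoc)
    qed
  qed
  have "AE x in lborel. G m x \<le> ennreal (C / 2) * riesz (\<lambda>y. G m y + G (Suc m) y) x"
    using grad_sum_cube_step[OF u l _ d, of m] Suc.prems by (simp add: G_def C_def)
  then show ?case
  proof eventually_elim
    case (elim x)
    also have "ennreal (C / 2) * riesz (\<lambda>y. G m y + G (Suc m) y) x \<le> ennreal (C / 2) * riesz (\<lambda>y. ennreal (2 * C ^ n) * (riesz ^^ n) ?H y) x"
      by (intro mult_left_mono riesz_mono_AE sum) simp
    also have "\<dots> = ennreal (C / 2) * (ennreal (2 * C ^ n) * riesz ((riesz ^^ n) ?H) x)"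
      by (subst riesz_cmult[OF Hn]) simp
    also have "\<dots> = ennreal (C ^ Suc n) * (riesz ^^ Suc n) ?H x"
      using C by (simp add: mult.assoc[symmetric] ennreal_mult'[symmetric])
    finally show ?case .
  qed
qed

text \<open>Averages and oscillations depend only on the almost-everywhere class, so
  \<open>f\<close> may be replaced by its Borel representative \<open>u (\<lambda>_. 0)\<close>, to
  which the Poincare inequality applies on every admissible cube.\<close>

lemma sharp_max_le_frac_max:
  fixes u :: "('d::finite \<Rightarrow> nat) \<Rightarrow> real ^ 'd \<Rightarrow> 'b::euclidean_space"
  assumes u: "deriv_system U k u" and k: "1 \<le> k" and U: "U \<in> sets borel" and d: "2 \<le> CARD('d)"
    and S: "\<And>a s. 0 < s \<Longrightarrow> side_cube a s \<subseteq> S \<Longrightarrow> box a (a + (\<chi> i. s)) \<subseteq> U"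
    and f: "AE x in lebesgue. x \<in> S \<longrightarrow> f x = u (\<lambda>_. 0) x"
    and f_meas: "\<And>Q. is_cube Q \<Longrightarrow> Q \<subseteq> S \<Longrightarrow> set_borel_measurable lebesgue Q f"
  shows "sharp_max S f x \<le> ennreal (poincare_const TYPE('d)) * frac_max (\<lambda>y. grad_sum u 1 y * indicator S y) x"
  unfolding sharp_max_def
proof (rule SUP_least, clarify)
  fix Q assume "is_cube Q" and Q: "Q \<subseteq> S" "x \<in> Q"
  then obtain a s where s: "0 < s" "Q = side_cube a s" by (auto simp: is_cube_iff)
  let ?u = "u (\<lambda>_. 0)"
  have 0: "(\<lambda>_. 0) \<in> midx 0" by (simp add: midx_def multi_abs_def)
  have [measurable]: "?u \<in> borel_measurable borel" using u by (simp add: deriv_system_def multi_abs_def)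
  have uL [measurable]: "?u \<in> borel_measurable lebesgue" by (rule measurable_completion) simp
  have QL [measurable]: "Q \<in> sets lebesgue" unfolding s(2) by simp
  have ae: "AE y in lebesgue. indicator Q y *\<^sub>R f y = indicator Q y *\<^sub>R ?u y"
    using f by eventually_elim (use Q in \<open>auto simp: indicator_def\<close>)
  have "set_lebesgue_integral lebesgue Q f = set_lebesgue_integral lebesgue Q ?u"
    unfolding set_lebesgue_integral_def
  proof (rule integral_cong_AE[OF _ _ ae])
    \<comment> \<open>Here \<open>f_meas\<close> is used: the integral of a non-measurable function
      would be the default value 0, not that of its representative.\<close>
    show "(\<lambda>y. indicator Q y *\<^sub>R f y) \<in> borel_measurable lebesgue"
      using f_meas[OF \<open>is_cube Q\<close> Q(1)] by (simp add: set_borel_measurable_def)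
  qed measurable
  then have "average Q f = average Q ?u" by (simp add: average_def)
  moreover have "AE y in lebesgue. ennreal (norm (f y - c)) * indicator Q y = ennreal (norm (?u y - c)) * indicator Q y" for c
    using f by eventually_elim (use Q in \<open>auto simp: indicator_def\<close>)
  then have "(\<integral>\<^sup>+y\<in>Q. ennreal (norm (f y - c)) \<partial>lebesgue) = (\<integral>\<^sup>+y\<in>Q. ennreal (norm (?u y - c)) \<partial>lebesgue)" for c
    by (rule nn_integral_cong_AE)
  ultimately have "mean_oscillation Q f = mean_oscillation Q ?u"
    unfolding mean_oscillation_def by (simp only:)
  also have "\<dots> \<le> ennreal (poincare_const TYPE('d)) * (ennreal (s powr (1 - real CARD('d))) * (\<integral>\<^sup>+y\<in>Q. grad_sum u (Suc 0) y \<partial>lborel))"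
    unfolding s(2) using deriv_system_upper_gradient[OF u 0] k S[OF s(1)] s Q d
    by (intro mean_oscillation_le[OF _ U]) auto
  also have "(\<integral>\<^sup>+y\<in>Q. grad_sum u (Suc 0) y \<partial>lborel) = (\<integral>\<^sup>+y\<in>side_cube a s. grad_sum u 1 y * indicator S y \<partial>lborel)"
    using Q(1) s(2) by (intro nn_integral_cong) (auto simp: indicator_def)
  also have "ennreal (poincare_const TYPE('d)) * (ennreal (s powr (1 - real CARD('d))) * \<dots>) \<le>
      ennreal (poincare_const TYPE('d)) * frac_max (\<lambda>y. grad_sum u 1 y * indicator S y) x"
    using Q(2) s by (intro mult_left_mono frac_max_upper) auto
  finally show "mean_oscillation Q f \<le> ennreal (poincare_const TYPE('d)) * frac_max (\<lambda>y. grad_sum u 1 y * indicator S y) x" .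
qed

section \<open>The estimate on a cube\<close>

lemma lebesgue_borel_rep:
  fixes v :: "real ^ 'd::finite \<Rightarrow> 'b::euclidean_space"
  assumes "v \<in> borel_measurable lebesgue"
  shows "\<exists>v'\<in>borel_measurable borel. AE x in lebesgue. v x = v' x"
proof -
  have "\<exists>g\<in>borel_measurable borel. AE x in lebesgue. v x \<bullet> b = g x" for b
  proof -
    have "(\<lambda>x. v x \<bullet> b) \<in> borel_measurable lebesgue" using assms by measurable
    from completion_ex_borel_measurable_real[OF this] obtain g where
      "g \<in> borel_measurable lborel" "AE x in lborel. v x \<bullet> b = g x" by blast
    then show ?thesis by (intro bexI[of _ g]) (auto intro: AE_completion)
  qed
  then obtain g where g: "\<And>b. g b \<in> borel_measurable borel" "\<And>b. AE x in lebesgue. v x \<bullet> b = g b x" by metis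
  have "AE x in lebesgue. \<forall>b\<in>Basis. v x \<bullet> b = g b x" by (intro AE_finite_allI g) auto
  then have "AE x in lebesgue. v x = (\<Sum>b\<in>Basis. g b x *\<^sub>R b)"
  proof eventually_elim
    case (elim x)
    then show ?case using euclidean_representation[of "v x"] by simp
  qed
  moreover have "(\<lambda>x. \<Sum>b\<in>Basis. g b x *\<^sub>R b) \<in> borel_measurable borel"
    by (intro borel_measurable_sum borel_measurable_scaleR g(1) borel_measurable_const)
  ultimately show ?thesis by (rule bexI)
qed

text \<open>Local integrability says nothing about \<open>v\<close> outside \<open>U\<close>, hence
  the indicator. Inside, \<open>v\<close> is the limit of its restrictions to an exhaustion by
  compact sets.\<close>

lemma locally_integrable_measurable:
  fixes v :: "real ^ 'd::finite \<Rightarrow> 'b::euclidean_space"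
  assumes U: "open U" and v: "locally_integrable U v"
  shows "(\<lambda>x. indicator U x *\<^sub>R v x) \<in> borel_measurable lebesgue"
proof -
  obtain D where D: "countable D" "\<Union>D = U" "\<And>X. X \<in> D \<Longrightarrow> \<exists>a b. X = cbox a b"
    using open_countable_Union_open_cbox[OF U] by metis
  \<comment> \<open>Inserting the empty set gives a nonempty family to enumerate even when
    \<open>U\<close> is empty.\<close>
  define E where "E = insert {} D"
  have E: "countable E" "E \<noteq> {}" "\<Union>E = U" "\<And>X. X \<in> E \<Longrightarrow> compact X"
  proof -
    show "compact X" if "X \<in> E" for X
      using that D(3)[of X] compact_cbox by (auto simp: E_def)
  qed (use D(1,2) in \<open>auto simp: E_def\<close>)
  define K where "K n = (\<Union>j\<le>n. from_nat_into E j)" for n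
  have K: "compact (K n)" "K n \<subseteq> U" for n
  proof -
    show "compact (K n)" unfolding K_def by (intro compact_UN) (auto intro!: E(4) from_nat_into E(2))
    show "K n \<subseteq> U" unfolding K_def using from_nat_into[OF E(2)] E(3) by blast
  qed
  show ?thesis
  proof (rule borel_measurable_LIMSEQ_metric[where f="\<lambda>n x. indicator (K n) x *\<^sub>R v x"])
    fix n
    have "set_integrable lebesgue (K n) v" using v K by (auto simp: locally_integrable_def)
    then show "(\<lambda>x. indicator (K n) x *\<^sub>R v x) \<in> borel_measurable lebesgue"
      unfolding set_integrable_def by (rule borel_measurable_integrable)
  next
    fix x
    show "(\<lambda>n. indicator (K n) x *\<^sub>R v x) \<longlonglongrightarrow> indicator U x *\<^sub>R v x"
    proof (cases "x \<in> U")
      case True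
      then obtain X where "X \<in> E" "x \<in> X" using E(3) by blast
      then obtain j where j: "x \<in> from_nat_into E j" using from_nat_into_surj[OF E(1)] by metis
      show ?thesis
      proof (rule tendsto_eventually, rule eventually_sequentiallyI[of j])
        fix n assume "j \<le> n"
        then have "x \<in> K n" using j by (auto simp: K_def)
        then show "indicator (K n) x *\<^sub>R v x = indicator U x *\<^sub>R v x" using True by simp
      qed
    next
      case False
      then have "x \<notin> K n" for n using K(2) by blast
      then show ?thesis using False by simp
    qed
  qed
qed

lemma set_integral_borel_rep:
  fixes v v' :: "real ^ 'd::finite \<Rightarrow> 'b::euclidean_space"
  assumes U: "open U" and v: "locally_integrable U v" and [measurable]: "v' \<in> borel_measurable borel"
    and ae: "AE x in lebesgue. indicator U x *\<^sub>R v x = v' x"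
    and h: "bump_family a b h" and ab: "cbox a b \<subseteq> U"
  shows "set_lebesgue_integral lebesgue U (\<lambda>x. tensor h x *\<^sub>R v x) = (\<integral>x. tensor h x *\<^sub>R v' x \<partial>lborel)"
proof -
  have [measurable]: "tensor h \<in> borel_measurable borel"
    by (rule borel_measurable_continuous_onI[OF continuous_tensor[OF h]])
  have tL [measurable]: "tensor h \<in> borel_measurable lebesgue" by (rule measurable_completion) simp
  note [measurable] = locally_integrable_measurable[OF U v]
  have "set_lebesgue_integral lebesgue U (\<lambda>x. tensor h x *\<^sub>R v x) = (\<integral>x. tensor h x *\<^sub>R (indicator U x *\<^sub>R v x) \<partial>lebesgue)"
    unfolding set_lebesgue_integral_def by (intro Bochner_Integration.integral_cong) (auto simp: mult.commute)
  also have "\<dots> = (\<integral>x. tensor h x *\<^sub>R v' x \<partial>lebesgue)"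
  proof (rule integral_cong_AE)
    show "(\<lambda>x. tensor h x *\<^sub>R v' x) \<in> borel_measurable lebesgue" by (rule measurable_completion) simp
    show "AE x in lebesgue. tensor h x *\<^sub>R indicator U x *\<^sub>R v x = tensor h x *\<^sub>R v' x"
      using ae by eventually_elim simp
  qed measurable
  also have "\<dots> = (\<integral>x. tensor h x *\<^sub>R v' x \<partial>lborel)" by (intro integral_completion) measurable
  finally show ?thesis .
qed

text \<open>The definition relates every weak derivative directly to \<open>f\<close>. The
  first-order relation between \<open>u \<beta>\<close> and \<open>u (sucidx \<beta> i)\<close> is
  recovered by testing order \<open>\<beta>\<close> with the partial derivative of a product bump
  and order \<open>sucidx \<beta> i\<close> with the bump itself.\<close>

lemma weak_derivative_system:
  fixes f :: "real ^ 'd::finite \<Rightarrow> 'b::euclidean_space"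
  assumes U: "open U" "convex U" and f: "weakly_differentiable U k f"
  obtains u where "deriv_system U k u" "AE x in lebesgue. x \<in> U \<longrightarrow> f x = u (\<lambda>_. 0) x"
    "\<And>\<alpha>. 1 \<le> multi_abs \<alpha> \<Longrightarrow> multi_abs \<alpha> \<le> k \<Longrightarrow> AE x in lebesgue. x \<in> U \<longrightarrow> weak_deriv U f \<alpha> x = u \<alpha> x"
    "locally_integrable U f"
    "\<And>\<alpha>. multi_abs \<alpha> \<le> k \<Longrightarrow> locally_integrable U (weak_deriv U f \<alpha>)"
proof -
  have hwd: "has_weak_deriv U \<alpha> f (weak_deriv U f \<alpha>)" if "multi_abs \<alpha> \<le> k" for \<alpha>
  proof -
    have "\<exists>g. has_weak_deriv U \<alpha> f g" using f that unfolding weakly_differentiable_def by simp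
    then show ?thesis unfolding weak_deriv_def by (rule someI_ex)
  qed
  have lf: "locally_integrable U f" using hwd[of "\<lambda>_. 0"] by (simp add: has_weak_deriv_def multi_abs_def)
  \<comment> \<open>For order zero \<open>weak_deriv\<close> is an arbitrary choice too, so
    \<open>f\<close> itself is taken there.\<close>
  define F where "F \<alpha> = (if \<alpha> = (\<lambda>_. 0) then f else weak_deriv U f \<alpha>)" for \<alpha>
  have lF: "locally_integrable U (F \<alpha>)" if "multi_abs \<alpha> \<le> k" for \<alpha>
    using hwd[OF that] lf by (auto simp: F_def has_weak_deriv_def)
  have WD: "set_lebesgue_integral lebesgue U (\<lambda>x. multi_deriv \<alpha> (tensor h) x *\<^sub>R f x) =
     (- 1) ^ multi_abs \<alpha> *\<^sub>R set_lebesgue_integral lebesgue U (\<lambda>x. tensor h x *\<^sub>R F \<alpha> x)"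
    if "multi_abs \<alpha> \<le> k" "bump_family a b h" "cbox a b \<subseteq> U" for \<alpha> a b h
  proof (cases "\<alpha> = (\<lambda>_. 0)")
    case True
    then show ?thesis by (simp add: F_def multi_deriv_tensor[OF that(2)] multi_abs_def)
  next
    case False
    then show ?thesis
      using hwd[OF that(1)] tensor_test_fun[OF that(2,3)] by (auto simp: F_def has_weak_deriv_def)
  qed
  have "\<exists>v. multi_abs \<alpha> \<le> k \<longrightarrow> v \<in> borel_measurable borel \<and> (AE x in lebesgue. indicator U x *\<^sub>R F \<alpha> x = v x)" for \<alpha>
    using lebesgue_borel_rep[OF locally_integrable_measurable[OF U(1) lF[of \<alpha>]]] by blast
  then obtain u where u: "\<And>\<alpha>. multi_abs \<alpha> \<le> k \<Longrightarrow> u \<alpha> \<in> borel_measurable borel"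
    "\<And>\<alpha>. multi_abs \<alpha> \<le> k \<Longrightarrow> AE x in lebesgue. indicator U x *\<^sub>R F \<alpha> x = u \<alpha> x" by metis
  have int: "integrable lborel (\<lambda>x. indicator K x *\<^sub>R u \<alpha> x)" if "compact K" "K \<subseteq> U" "multi_abs \<alpha> \<le> k" for K \<alpha>
  proof -
    have [measurable]: "K \<in> sets borel" "u \<alpha> \<in> borel_measurable borel" using that u(1) by (auto intro: borel_compact)
    have K_int: "integrable lebesgue (\<lambda>x. indicator K x *\<^sub>R F \<alpha> x)"
      using lF[OF that(3)] that by (auto simp: locally_integrable_def set_integrable_def)
    have "integrable lebesgue (\<lambda>x. indicator K x *\<^sub>R u \<alpha> x)"
    proof (rule integrable_cong_AE_imp[OF K_int])
      show "(\<lambda>x. indicator K x *\<^sub>R u \<alpha> x) \<in> borel_measurable lebesgue" by (rule measurable_completion) simp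
      show "AE x in lebesgue. indicator K x *\<^sub>R F \<alpha> x = indicator K x *\<^sub>R u \<alpha> x"
        using u(2)[OF that(3)] by eventually_elim (use that(2) in \<open>auto simp: indicator_def\<close>)
    qed
    then show ?thesis by (subst (asm) integrable_completion) measurable
  qed
  have "weak_gradient U (u \<beta>) (\<lambda>i. u (sucidx \<beta> i))" if \<beta>: "multi_abs \<beta> < k" for \<beta>
    unfolding weak_gradient_def
  proof (intro conjI allI impI)
    fix a b h i assume ab: "cbox a b \<subseteq> U" and h: "bump_family a b h"
    have \<beta>i: "multi_abs (sucidx \<beta> i) \<le> k" using \<beta> by (simp add: multi_abs_sucidx)
    have hd: "bump_family a b (h(i := deriv (h i)))" by (rule bump_family_deriv[OF h])
    have md: "multi_deriv \<beta> (tensor (h(i := deriv (h i)))) = multi_deriv (sucidx \<beta> i) (tensor h)"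
      unfolding multi_deriv_tensor[OF hd] multi_deriv_tensor[OF h]
      by (intro arg_cong[of _ _ tensor] ext) (auto simp: sucidx_def funpow_swap1)
    let ?n = "multi_abs \<beta>"
    have "(\<integral>x. tensor (h(i := deriv (h i))) x *\<^sub>R u \<beta> x \<partial>lborel) = set_lebesgue_integral lebesgue U (\<lambda>x. tensor (h(i := deriv (h i))) x *\<^sub>R F \<beta> x)"
      by (rule set_integral_borel_rep[OF U(1) lF u(1) u(2) hd ab, symmetric]) (use \<beta> in auto)
    also have "\<dots> = (- 1) ^ ?n *\<^sub>R ((- 1) ^ ?n *\<^sub>R set_lebesgue_integral lebesgue U (\<lambda>x. tensor (h(i := deriv (h i))) x *\<^sub>R F \<beta> x))"
      by (simp flip: power_add mult_2)
    also have "(- 1) ^ ?n *\<^sub>R set_lebesgue_integral lebesgue U (\<lambda>x. tensor (h(i := deriv (h i))) x *\<^sub>R F \<beta> x)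
      = set_lebesgue_integral lebesgue U (\<lambda>x. multi_deriv (sucidx \<beta> i) (tensor h) x *\<^sub>R f x)"
      using WD[OF _ hd ab, of \<beta>] \<beta> md by simp
    also have "\<dots> = (- 1) ^ Suc ?n *\<^sub>R set_lebesgue_integral lebesgue U (\<lambda>x. tensor h x *\<^sub>R F (sucidx \<beta> i) x)"
      using WD[OF \<beta>i h ab] by (simp add: multi_abs_sucidx)
    also have "(- 1) ^ ?n *\<^sub>R \<dots> = - set_lebesgue_integral lebesgue U (\<lambda>x. tensor h x *\<^sub>R F (sucidx \<beta> i) x)"
      by (simp flip: power_add mult_2)
    also have "set_lebesgue_integral lebesgue U (\<lambda>x. tensor h x *\<^sub>R F (sucidx \<beta> i) x) = (\<integral>x. tensor h x *\<^sub>R u (sucidx \<beta> i) x \<partial>lborel)"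
      by (rule set_integral_borel_rep[OF U(1) lF[OF \<beta>i] u(1)[OF \<beta>i] u(2)[OF \<beta>i] h ab])
    finally show "(\<integral>x. tensor (h(i := deriv (h i))) x *\<^sub>R u \<beta> x \<partial>lborel) = - (\<integral>x. tensor h x *\<^sub>R u (sucidx \<beta> i) x \<partial>lborel)" .
  qed (use \<beta> in \<open>auto intro!: u int simp: multi_abs_sucidx\<close>)
  then have "deriv_system U k u"
    unfolding deriv_system_def using u(1) by (intro conjI allI impI weak_gradient_upper_gradient[OF _ U]) simp_all
  moreover have ae: "AE x in lebesgue. x \<in> U \<longrightarrow> F \<alpha> x = u \<alpha> x" if "multi_abs \<alpha> \<le> k" for \<alpha>
    using u(2)[OF that] by eventually_elim auto
  have "AE x in lebesgue. x \<in> U \<longrightarrow> f x = u (\<lambda>_. 0) x"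
    using ae[of "\<lambda>_. 0"] by (simp add: F_def multi_abs_def)
  moreover have "AE x in lebesgue. x \<in> U \<longrightarrow> weak_deriv U f \<alpha> x = u \<alpha> x" if "1 \<le> multi_abs \<alpha>" "multi_abs \<alpha> \<le> k" for \<alpha>
  proof -
    have "\<alpha> \<noteq> (\<lambda>_. 0)" using that by (auto simp: multi_abs_def)
    then show ?thesis using ae[OF that(2)] by (simp add: F_def)
  qed
  moreover have "locally_integrable U (weak_deriv U f \<alpha>)" if "multi_abs \<alpha> \<le> k" for \<alpha>
    using hwd[OF that] by (simp add: has_weak_deriv_def)
  ultimately show ?thesis using that lf by blast
qed

lemma norm_le_grad_abs: "\<alpha> \<in> midx m \<Longrightarrow> norm (D \<alpha> x) \<le> grad_abs D m x"
  unfolding grad_abs_def midx_def[symmetric]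
  by (intro real_le_rsqrt member_le_sum[of \<alpha> _ "\<lambda>\<alpha>. (norm (D \<alpha> x))\<^sup>2"]) auto

lemma lebesgue_sets_AE_cong:
  assumes A: "A \<in> sets lebesgue" and ae: "AE x in lebesgue. x \<in> A \<longleftrightarrow> x \<in> B"
  shows "B \<in> sets lebesgue"
proof -
  obtain N where N: "N \<in> null_sets lebesgue" "{x \<in> space lebesgue. \<not> (x \<in> A \<longleftrightarrow> x \<in> B)} \<subseteq> N"
    using ae unfolding eventually_ae_filter by blast
  have "B - A \<in> null_sets lebesgue" "A - B \<in> null_sets lebesgue"
    using N by (auto intro: null_sets_completion_subset)
  then have "(A - (A - B)) \<union> (B - A) \<in> sets lebesgue"
    by (intro sets.Un[OF sets.Diff[OF A]]) blast+
  moreover have "(A - (A - B)) \<union> (B - A) = B" by auto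
  ultimately show ?thesis by simp
qed

context lorentz_exponent
begin

lemma lorentz_norm_eq: "lorentz_norm p r g = lorentz_fun (1 / p) r (rearrangement UNIV g)"
  by (simp add: lorentz_norm_def lorentz_norm_on_def lorentz_fun_def)

text \<open>The range \<open>0 < t < 1\<close> is encoded by truncating the rearrangement, so that
  all facts about \<open>lorentz_fun\<close> apply to the norm on a cube.\<close>

lemma lorentz_norm_cube_eq:
  "lorentz_norm_cube Q p r g = lorentz_fun (1 / p) r (\<lambda>t. if t < 1 then rearrangement Q g t else 0)"
proof (cases "r = top")
  case True
  have "(SUP t\<in>{0<..<1}. ennreal (t powr (1 / p)) * rearrangement Q g t) =
    (SUP t\<in>{0<..}. ennreal (t powr (1 / p)) * (if t < 1 then rearrangement Q g t else 0))"
  proof (intro antisym SUP_least)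
    fix t :: real assume "t \<in> {0<..<1}"
    then show "ennreal (t powr (1 / p)) * rearrangement Q g t \<le> (SUP t\<in>{0<..}. ennreal (t powr (1 / p)) * (if t < 1 then rearrangement Q g t else 0))"
      by (intro SUP_upper2[of t]) auto
  next
    fix t :: real assume "t \<in> {0<..}"
    then show "ennreal (t powr (1 / p)) * (if t < 1 then rearrangement Q g t else 0) \<le> (SUP t\<in>{0<..<1}. ennreal (t powr (1 / p)) * rearrangement Q g t)"
      by (cases "t < 1") (auto intro: SUP_upper2[of t])
  qed
  then show ?thesis unfolding lorentz_norm_cube_def lorentz_norm_on_def lorentz_fun_def using True by simp
next
  case False
  have "(\<integral>\<^sup>+t\<in>{0<..<1}. ennpowr (ennreal (t powr (1 / p)) * rearrangement Q g t) R * ennreal (1 / t) \<partial>lborel) =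
    (\<integral>\<^sup>+t\<in>{0<..}. ennpowr (ennreal (t powr (1 / p)) * (if t < 1 then rearrangement Q g t else 0)) R * ennreal (1 / t) \<partial>lborel)"
    by (intro nn_integral_cong) (auto simp: indicator_def)
  then show ?thesis unfolding lorentz_norm_cube_def lorentz_norm_on_def lorentz_fun_def using False by simp
qed

lemma lorentz_fun_sum:
  assumes "finite I" "\<And>i. i \<in> I \<Longrightarrow> a i \<in> borel_measurable borel"
  shows "lorentz_fun e r (\<lambda>t. \<Sum>i\<in>I. a i t) \<le> (\<Sum>i\<in>I. lorentz_fun e r (a i))"
  using assms
proof (induction I rule: finite_induct)
  case empty
  have "lorentz_fun e r (\<lambda>t. 0 * 0) = 0 * lorentz_fun e r (\<lambda>t. 0)" by (rule lorentz_fun_cmult) simp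
  then show ?case by simp
next
  case (insert i I)
  have "lorentz_fun e r (\<lambda>t. a i t + (\<Sum>i\<in>I. a i t)) \<le> lorentz_fun e r (a i) + lorentz_fun e r (\<lambda>t. \<Sum>i\<in>I. a i t)"
    using insert.prems by (intro lorentz_fun_add borel_measurable_sum) auto
  also have "\<dots> \<le> lorentz_fun e r (a i) + (\<Sum>i\<in>I. lorentz_fun e r (a i))"
    using insert by (intro add_left_mono) auto
  finally show ?case using insert.hyps by simp
qed

text \<open>The norms on the cube see only \<open>t < 1\<close>, while the left-hand side runs over
  all \<open>t\<close> up to the measure \<open>V\<close> of the cube. A dilation by
  \<open>1 / c\<close> with \<open>c = k + V\<close> repairs this: \<open>t / c < 1\<close> for
  \<open>t < V\<close>, and \<open>t / c <= t / k\<close> lets each of the \<open>k\<close> summands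
  have its own share of the measure. The dilation costs \<open>c^e <= c\<close>.\<close>

lemma lorentz_fun_cube_sum:
  fixes H :: "real ^ 'd::finite \<Rightarrow> ennreal"
  assumes l: "0 < l" and H0: "\<And>x. x \<notin> side_cube z l \<Longrightarrow> H x = 0" and N: "0 \<le> N"
    and H: "AE x in lebesgue. x \<in> side_cube z l \<longrightarrow> H x \<le> ennreal N * (\<Sum>j=1..k. g j x)"
    and g: "\<And>j s. j \<in> {1..k} \<Longrightarrow> {x \<in> side_cube z l. s < g j x} \<in> sets lebesgue"
    and e: "0 < e" "e \<le> 1" and k: "1 \<le> k"
  shows "lorentz_fun e r (rearrangement UNIV H) \<le>
    ennreal (N * (real k + l ^ CARD('d))) * (\<Sum>j=1..k. lorentz_fun e r (\<lambda>t. if t < 1 then rearrangement (side_cube z l) (g j) t else 0))"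
proof -
  let ?Q = "side_cube z l"
  define V where "V = l ^ CARD('d)"
  define c where "c = real k + V"
  have V: "0 < V" "emeasure lebesgue ?Q = ennreal V" using l by (auto simp: V_def emeasure_side_cube emeasure_completion_borel)
  have c: "1 \<le> c" "real k \<le> c" "V \<le> c" using k V by (auto simp: c_def)
  define a where "a j = rearrangement ?Q (g j)" for j
  have [measurable]: "a j \<in> borel_measurable borel" for j unfolding a_def by measurable
  define b where "b j t = (if t < 1 then a j t else 0)" for j t
  have [measurable]: "b j \<in> borel_measurable borel" for j unfolding b_def[abs_def] by measurable
  have QL: "?Q \<in> sets lebesgue" by simp
  have R: "rearrangement UNIV H t \<le> ennreal N * (\<Sum>j=1..k. b j (1 / c * t))" if t: "0 < t" for t
  proof (cases "V \<le> t")
    case True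
    then have "rearrangement UNIV H t \<le> 0"
      using H0 V by (intro rearrangement_leI[of ?Q] QL) (auto intro: ennreal_leI)
    then show ?thesis by simp
  next
    case False
    obtain M where M: "M \<in> null_sets lebesgue" "{x \<in> space lebesgue. \<not> (x \<in> ?Q \<longrightarrow> H x \<le> ennreal N * (\<Sum>j=1..k. g j x))} \<subseteq> M"
      using H unfolding eventually_ae_filter by blast
    \<comment> \<open>Each of the \<open>k\<close> functions may exceed its level on measure
      \<open>t / k\<close>, which adds up to \<open>t\<close>.\<close>
    let ?t = "t / real k"
    define B where "B = (\<Union>j\<in>{1..k}. {x \<in> ?Q. a j ?t < g j x})"
    have B: "B \<in> sets lebesgue" unfolding B_def using g by (intro sets.finite_UN) auto
    have "emeasure lebesgue B \<le> (\<Sum>j=1..k. emeasure lebesgue {x \<in> ?Q. a j ?t < g j x})"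
      unfolding B_def using g by (intro emeasure_subadditive_finite) auto
    also have "\<dots> \<le> (\<Sum>j=1..k. ennreal ?t)"
      unfolding a_def using g by (intro sum_mono emeasure_rearrangement_le) auto
    also have "\<dots> = ennreal t"
      using t k by (simp add: ennreal_of_nat_eq_real_of_nat ennreal_mult[symmetric])
    finally have Bt: "emeasure lebesgue B \<le> ennreal t" .
    have ab: "a j ?t \<le> b j (1 / c * t)" for j
    proof -
      have "1 / c * t \<le> ?t" "1 / c * t < 1" using c k t False by (auto simp: frac_le)
      then show ?thesis unfolding b_def a_def by (simp add: rearrangement_antimono)
    qed
    show ?thesis
    proof (rule rearrangement_leI[of "B \<union> M"])
      show "B \<union> M \<in> sets lebesgue" using B M by auto
      show "emeasure lebesgue (B \<union> M) \<le> ennreal t" unfolding emeasure_Un_null_set[OF B M(1)] by (rule Bt)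
      fix x assume x: "x \<notin> B \<union> M"
      show "H x \<le> ennreal N * (\<Sum>j=1..k. b j (1 / c * t))"
      proof (cases "x \<in> ?Q")
        case True
        then have "H x \<le> ennreal N * (\<Sum>j=1..k. g j x)" using x M(2) by auto
        also have "\<dots> \<le> ennreal N * (\<Sum>j=1..k. b j (1 / c * t))"
          using x True by (intro mult_left_mono sum_mono order_trans[OF _ ab]) (auto simp: B_def not_less)
        finally show ?thesis .
      qed (simp add: H0)
    qed
  qed
  have "lorentz_fun e r (rearrangement UNIV H) \<le> lorentz_fun e r (\<lambda>t. ennreal N * (\<Sum>j=1..k. b j (1 / c * t)))"
    by (intro lorentz_fun_mono R)
  also have "\<dots> = ennreal N * lorentz_fun e r (\<lambda>t. \<Sum>j=1..k. b j (1 / c * t))"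
    by (rule lorentz_fun_cmult) measurable
  also have "\<dots> \<le> ennreal N * (\<Sum>j=1..k. lorentz_fun e r (\<lambda>t. b j (1 / c * t)))"
    by (intro mult_left_mono lorentz_fun_sum) auto
  also have "\<dots> = ennreal N * (\<Sum>j=1..k. ennreal ((1 / c) powr - e) * lorentz_fun e r (b j))"
    using c by (subst lorentz_fun_dilate) auto
  also have "\<dots> = ennreal N * (ennreal ((1 / c) powr - e) * (\<Sum>j=1..k. lorentz_fun e r (b j)))"
    by (simp add: sum_distrib_left)
  also have "\<dots> \<le> ennreal N * (ennreal c * (\<Sum>j=1..k. lorentz_fun e r (b j)))"
  proof (intro mult_left_mono mult_right_mono ennreal_leI)
    have "(1 / c) powr - e = c powr e" using c by (simp add: powr_divide powr_minus_divide)
    also have "\<dots> \<le> c powr 1" using c e by (intro powr_mono) auto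
    finally show "(1 / c) powr - e \<le> c" using c by simp
  qed auto
  also have "\<dots> = ennreal (N * c) * (\<Sum>j=1..k. lorentz_fun e r (b j))"
    using N by (simp add: ennreal_mult' mult.assoc)
  finally show ?thesis unfolding b_def[abs_def] a_def c_def V_def .
qed

end

context lorentz_exponent
begin

lemma sharp_max_lorentz_fun_le:
  fixes u :: "('d::finite \<Rightarrow> nat) \<Rightarrow> real ^ 'd \<Rightarrow> 'b::euclidean_space"
  assumes "\<And>x. x \<in> S \<Longrightarrow> g x \<le> ennreal c * frac_max G x" and c: "0 \<le> c"
    and [measurable]: "G \<in> borel_measurable borel" and d: "2 \<le> CARD('d)"
  shows "lorentz_fun e r (rearrangement S (g :: real ^ 'd \<Rightarrow> ennreal)) \<le>
    ennreal (c * frac_const TYPE('d)) * lorentz_fun e r (fracmax_bound (real CARD('d)) (rearrangement UNIV G))"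
proof -
  let ?s = "fracmax_bound (real CARD('d)) (rearrangement UNIV G)"
  have [measurable]: "?s \<in> borel_measurable borel"
    unfolding fracmax_bound_def[abs_def] tail_sum_def by measurable
  have "lorentz_fun e r (rearrangement S g) \<le> lorentz_fun e r (\<lambda>t. ennreal (c * frac_const TYPE('d)) * ?s t)"
  proof (rule lorentz_fun_mono)
    fix t :: real assume t: "0 < t"
    obtain B where B: "B \<in> sets lebesgue" "emeasure lebesgue B \<le> ennreal t"
      "\<And>x. x \<notin> B \<Longrightarrow> frac_max G x \<le> ennreal (frac_const TYPE('d)) * ?s t"
      using frac_max_outer_bound[OF assms(3) t d] by blast
    show "rearrangement S g t \<le> ennreal (c * frac_const TYPE('d)) * ?s t"
    proof (rule rearrangement_leI[OF B(1,2)])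
      fix x assume x: "x \<in> S" "x \<notin> B"
      have "g x \<le> ennreal c * (ennreal (frac_const TYPE('d)) * ?s t)"
        by (intro order_trans[OF assms(1)] mult_left_mono B(3) x) auto
      then show "g x \<le> ennreal (c * frac_const TYPE('d)) * ?s t"
        using c by (simp add: ennreal_mult' mult.assoc)
    qed
  qed
  then show ?thesis by (simp add: lorentz_fun_cmult)
qed

lemma frac_const_pos: "0 < frac_const TYPE('d::finite)"
  unfolding frac_const_def using kernel_const_pos[where ?'d='d] by (intro add_pos_nonneg mult_nonneg_nonneg) auto

lemma cube_estimate:
  fixes Q0 :: "(real ^ 'd::finite) set"
  assumes k: "1 \<le> k" "k < CARD('d)" and Q0: "is_cube Q0"
  shows "\<exists>C1>0. \<forall>\<epsilon> (f :: real ^ 'd \<Rightarrow> 'b::euclidean_space). 0 < \<epsilon> \<longrightarrow> \<epsilon> \<le> 1 / 2 \<longrightarrow> \<epsilon> * R \<le> real CARD('d) \<longrightarrow>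
     weakly_differentiable (interior Q0) k f \<longrightarrow>
     lorentz_norm_cube Q0 (real CARD('d) / \<epsilon>) r (sharp_max Q0 f) \<le>
     ennreal (C1 * \<epsilon> powr (- enn2real (1 / r))) * sobolev_cube_norm Q0 k (real CARD('d) / (real k + \<epsilon>)) r f"
proof -
  obtain z l where l: "0 < l" and Q: "Q0 = side_cube z l" using Q0 by (auto simp: is_cube_iff)
  let ?D = "real CARD('d)"
  let ?U = "box z (z + (\<chi> i. l))"
  have d: "2 \<le> CARD('d)" using k by simp
  have int: "interior Q0 = ?U" unfolding Q side_cube_def by (rule interior_cbox)
  define N where "N = idx_const TYPE('d) k"
  have N: "1 \<le> N" unfolding N_def by (rule idx_const)
  define C where "C = (2 * (N * (?D ^ CARD('d) * (1 + 1 / l)))) ^ (k - 1)"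
  have C: "0 < C" unfolding C_def using N l by (intro zero_less_power mult_pos_pos add_pos_pos) auto
  define P where "P = poincare_const TYPE('d) * frac_const TYPE('d)"
  have P: "0 < P" unfolding P_def by (intro mult_pos_pos poincare_const_pos frac_const_pos)
  define M where "M = N * (real k + l ^ CARD('d))"
  have M: "0 < M" unfolding M_def using N l by (intro mult_pos_pos add_nonneg_pos) auto
  \<comment> \<open>In the order of the estimates: Poincare and maximal function, Lorentz bounds,
    iterated potentials on the cube, and the passage from \<open>H\<close> to the Sobolev
    norm.\<close>
  define C1 where "C1 = P * (main_const TYPE('d) k * (C * M))"
  have C1: "0 < C1" unfolding C1_def by (intro mult_pos_pos P C M main_const_pos)
  show ?thesis
  proof (intro exI[of _ C1] conjI C1 allI impI)
    fix \<epsilon> :: real and f :: "real ^ 'd \<Rightarrow> 'b"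
    assume \<epsilon>: "0 < \<epsilon>" "\<epsilon> \<le> 1 / 2" "\<epsilon> * R \<le> ?D" and f: "weakly_differentiable (interior Q0) k f"
    obtain u where u: "deriv_system ?U k u" "AE x in lebesgue. x \<in> ?U \<longrightarrow> f x = u (\<lambda>_. 0) x"
      "\<And>\<alpha>. 1 \<le> multi_abs \<alpha> \<Longrightarrow> multi_abs \<alpha> \<le> k \<Longrightarrow> AE x in lebesgue. x \<in> ?U \<longrightarrow> weak_deriv ?U f \<alpha> x = u \<alpha> x"
      "locally_integrable ?U f" "\<And>\<alpha>. multi_abs \<alpha> \<le> k \<Longrightarrow> locally_integrable ?U (weak_deriv ?U f \<alpha>)"
      using weak_derivative_system[of ?U k f] f unfolding int by (auto simp: open_box convex_box)
    have QU: "AE x in lebesgue. x \<in> Q0 \<longrightarrow> x \<in> ?U"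
      using AE_completion[OF AE_side_cube_box[of z l]] unfolding Q .
    have UQ: "?U \<subseteq> Q0" unfolding Q side_cube_def by (rule box_subset_cbox)
    define G where "G m x = grad_sum u m x * indicator Q0 x" for m x
    define H where "H x = (\<Sum>j=1..k. G j x)" for x
    have [measurable]: "Q0 \<in> sets borel" unfolding Q by simp
    have Gm [measurable]: "G j \<in> borel_measurable borel" if "j \<le> k" for j
      using grad_sum_borel[OF u(1) that] unfolding G_def[abs_def] by simp
    have Hm [measurable]: "H \<in> borel_measurable borel"
      unfolding H_def[abs_def] by (intro borel_measurable_sum) auto
    have sharp: "sharp_max Q0 f x \<le> ennreal (poincare_const TYPE('d)) * frac_max (G 1) x" for x
      unfolding G_def[abs_def]
    proof (rule sharp_max_le_frac_max[OF u(1) k(1) _ d])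
      show "box a (a + (\<chi> i. s)) \<subseteq> ?U" if "side_cube a s \<subseteq> Q0" for a s
        using interior_mono[OF that] unfolding int by (simp add: side_cube_def interior_cbox)
      show "AE x in lebesgue. x \<in> Q0 \<longrightarrow> f x = u (\<lambda>_. 0) x"
        using u(2) QU by eventually_elim auto
      fix Q assume Q': "is_cube Q" "Q \<subseteq> Q0"
      then have [measurable]: "Q \<in> sets lebesgue" by (auto simp: is_cube_iff)
      have fU: "(\<lambda>x. indicator ?U x *\<^sub>R f x) \<in> borel_measurable lebesgue"
        by (rule locally_integrable_measurable[OF open_box u(4)])
      have "(\<lambda>x. indicator Q x *\<^sub>R (indicator ?U x *\<^sub>R f x)) \<in> borel_measurable lebesgue"
        using fU by measurable
      moreover have "AE x in lebesgue. indicator Q x *\<^sub>R (indicator ?U x *\<^sub>R f x) = indicator Q x *\<^sub>R f x"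
        using QU by eventually_elim (use Q'(2) in \<open>auto simp: indicator_def\<close>)
      ultimately show "set_borel_measurable lebesgue Q f"
        unfolding set_borel_measurable_def by (rule borel_measurable_AE)
    qed auto
    have it: "AE x in lebesgue. G 1 x \<le> ennreal C * (riesz ^^ (k - 1)) H x"
      using grad_sum_cube_iterate[OF u(1) l d, of 1 "k - 1"] k
      unfolding G_def[abs_def] H_def[abs_def] C_def N_def Q by (intro AE_completion) simp
    let ?e = "(real k + \<epsilon>) / ?D"
    let ?g = "\<lambda>j x. ennreal (grad_abs (weak_deriv ?U f) j x)"
    have Hg: "AE x in lebesgue. x \<in> Q0 \<longrightarrow> H x \<le> ennreal N * (\<Sum>j=1..k. ?g j x)"
    proof -
      have "AE x in lebesgue. \<forall>j\<in>{1..k}. \<forall>\<alpha>\<in>(midx j :: ('d \<Rightarrow> nat) set). x \<in> ?U \<longrightarrow> weak_deriv ?U f \<alpha> x = u \<alpha> x"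
        by (intro AE_finite_allI finite_midx u(3)) (auto simp: midx_def)
      with QU show ?thesis
      proof eventually_elim
        case (elim x)
        show ?case
        proof
          assume x: "x \<in> Q0"
          have "H x \<le> (\<Sum>j=1..k. ennreal N * ?g j x)"
            unfolding H_def
          proof (rule sum_mono)
            fix j assume j: "j \<in> {1..k}"
            have "G j x = (\<Sum>\<alpha>\<in>midx j. ennreal (norm (weak_deriv ?U f \<alpha> x)))"
              using x elim j by (simp add: G_def grad_sum_def)
            also have "\<dots> \<le> (\<Sum>\<alpha>\<in>(midx j :: ('d \<Rightarrow> nat) set). ?g j x)"
              by (intro sum_mono ennreal_leI norm_le_grad_abs)
            also have "\<dots> = ennreal (real (card (midx j :: ('d \<Rightarrow> nat) set))) * ?g j x"
              by (simp add: ennreal_of_nat_eq_real_of_nat)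
            also have "\<dots> \<le> ennreal N * ?g j x"
              unfolding N_def using j by (intro mult_right_mono ennreal_leI idx_const) auto
            finally show "G j x \<le> ennreal N * ?g j x" .
          qed
          then show "H x \<le> ennreal N * (\<Sum>j=1..k. ?g j x)" by (simp add: sum_distrib_left)
        qed
      qed
    qed
    \<comment> \<open>The chosen weak derivatives are known to be measurable on the open box only.
      The boundary is null and Lebesgue sets are stable under null changes.\<close>
    have gm: "{x \<in> Q0. s < ?g j x} \<in> sets lebesgue" if j: "j \<in> {1..k}" for j s
    proof (rule lebesgue_sets_AE_cong)
      have [measurable]: "(\<lambda>x. indicator ?U x *\<^sub>R weak_deriv ?U f \<alpha> x) \<in> borel_measurable lebesgue" if "\<alpha> \<in> midx j" for \<alpha>
        using that j by (intro locally_integrable_measurable open_box u(5)) (auto simp: midx_def)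
      let ?h = "\<lambda>x. ennreal (sqrt (\<Sum>\<alpha>\<in>midx j. (norm (indicator ?U x *\<^sub>R weak_deriv ?U f \<alpha> x))\<^sup>2))"
      have "?h \<in> borel_measurable lebesgue" by measurable
      then show "Q0 \<inter> {x. s < ?h x} \<in> sets lebesgue" unfolding Q by (intro sets.Int super_level_lebesgue) auto
      show "AE x in lebesgue. x \<in> Q0 \<inter> {x. s < ?h x} \<longleftrightarrow> x \<in> {x \<in> Q0. s < ?g j x}"
        using QU by eventually_elim (auto simp: grad_abs_def midx_def)
    qed
    \<comment> \<open>Lifting the restriction \<open>t < 1\<close> only enlarges the left-hand
      side.\<close>
    have "lorentz_norm_cube Q0 (?D / \<epsilon>) r (sharp_max Q0 f) \<le> lorentz_fun (\<epsilon> / ?D) r (rearrangement Q0 (sharp_max Q0 f))"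
      unfolding lorentz_norm_cube_eq by (simp, intro lorentz_fun_mono) auto
    also have "\<dots> \<le> ennreal P * lorentz_fun (\<epsilon> / ?D) r (fracmax_bound ?D (rearrangement UNIV (G 1)))"
      unfolding P_def using poincare_const_pos[where ?'d='d] k
      by (intro sharp_max_lorentz_fun_le sharp d Gm) (auto intro: less_imp_le)
    also have "\<dots> \<le> ennreal P * (ennreal (main_const TYPE('d) k * \<epsilon> powr (- enn2real (1 / r))) * (ennreal C * lorentz_fun ?e r (rearrangement UNIV H)))"
      by (intro mult_left_mono lorentz_fun_fracmax_iterated_riesz[OF Gm Hm k \<epsilon> it]) (use k in auto)
    also have "lorentz_fun ?e r (rearrangement UNIV H) \<le> ennreal M * (\<Sum>j=1..k. lorentz_fun ?e r (\<lambda>t. if t < 1 then rearrangement Q0 (?g j) t else 0))"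
      unfolding M_def Q
    proof (rule lorentz_fun_cube_sum[OF l])
      show "0 < ?e" "?e \<le> 1" using k \<epsilon> by (auto simp: field_simps)
    qed (use N k Hg gm Q in \<open>auto simp: H_def G_def\<close>)
    also have "(\<Sum>j=1..k. lorentz_fun ?e r (\<lambda>t. if t < 1 then rearrangement Q0 (?g j) t else 0)) \<le> sobolev_cube_norm Q0 k (?D / (real k + \<epsilon>)) r f"
      unfolding sobolev_cube_norm_def lorentz_norm_cube_eq int by (simp, intro sum_mono2) auto
    finally have "lorentz_norm_cube Q0 (?D / \<epsilon>) r (sharp_max Q0 f) \<le>
       ennreal P * (ennreal (main_const TYPE('d) k * \<epsilon> powr (- enn2real (1 / r))) * (ennreal C * (ennreal M * sobolev_cube_norm Q0 k (?D / (real k + \<epsilon>)) r f)))"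
      by (simp add: mult_left_mono)
    also have "\<dots> = ennreal (P * (main_const TYPE('d) k * \<epsilon> powr (- enn2real (1 / r)) * (C * M))) * sobolev_cube_norm Q0 k (?D / (real k + \<epsilon>)) r f"
      using P C M main_const_pos[where ?'d='d and k=k] by (simp add: ennreal_mult mult.assoc)
    also have "P * (main_const TYPE('d) k * \<epsilon> powr (- enn2real (1 / r)) * (C * M)) = C1 * \<epsilon> powr (- enn2real (1 / r))"
      by (simp add: C1_def)
    finally show "lorentz_norm_cube Q0 (?D / \<epsilon>) r (sharp_max Q0 f) \<le>
     ennreal (C1 * \<epsilon> powr (- enn2real (1 / r))) * sobolev_cube_norm Q0 k (?D / (real k + \<epsilon>)) r f" .
  qed
qed

end

section \<open>Iterated partial derivatives of smooth functions\<close>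

text \<open>The regularity half of \<open>test_fun\<close>. It contains the continuity of all
  iterated partial derivatives, since each of them is differentiable.\<close>

definition smooth :: "(real ^ 'd::finite \<Rightarrow> 'b::real_normed_vector) \<Rightarrow> bool" where
  "smooth f \<longleftrightarrow> (\<forall>js x. iter_partial js f differentiable (at x))"

lemma iter_partial_append: "iter_partial (is @ js) f = iter_partial is (iter_partial js f)"
  by (simp add: iter_partial_def)

lemma iter_partial_Cons: "iter_partial (i # js) f = partial_deriv i (iter_partial js f)"
  by (simp add: iter_partial_def)

lemma smooth_iter_partial: "smooth f \<Longrightarrow> smooth (iter_partial js f)"
  by (simp add: smooth_def iter_partial_append[symmetric])

lemma smooth_partial: "smooth f \<Longrightarrow> smooth (partial_deriv i f)"
  using smooth_iter_partial[of f "[i]"] by (simp add: iter_partial_def)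

lemma smooth_differentiable: "smooth f \<Longrightarrow> f differentiable (at x)"
  unfolding smooth_def by (drule spec[of _ "[]"]) (simp add: iter_partial_def)

lemma smooth_continuous: "smooth f \<Longrightarrow> continuous_on UNIV f"
  by (intro continuous_at_imp_continuous_on ballI differentiable_imp_continuous_within smooth_differentiable)

lemma smooth_has_derivative:
  fixes f :: "real ^ 'd::finite \<Rightarrow> 'b::euclidean_space"
  assumes "smooth f"
  shows "(f has_derivative (\<lambda>h. \<Sum>i\<in>UNIV. h $ i *\<^sub>R partial_deriv i f x)) (at x)"
proof -
  have d: "(f has_derivative frechet_derivative f (at x)) (at x)"
    using smooth_differentiable[OF assms] by (simp add: frechet_derivative_works)
  then have lin: "linear (frechet_derivative f (at x))" by (rule has_derivative_linear)
  have "frechet_derivative f (at x) h = (\<Sum>i\<in>UNIV. h $ i *\<^sub>R partial_deriv i f x)" for h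
  proof -
    have "h = (\<Sum>i\<in>UNIV. h $ i *\<^sub>R axis i 1)"
      using basis_expansion[of h] by (simp add: scalar_mult_eq_scaleR)
    then have "frechet_derivative f (at x) h = frechet_derivative f (at x) (\<Sum>i\<in>UNIV. h $ i *\<^sub>R axis i 1)" by simp
    also have "\<dots> = (\<Sum>i\<in>UNIV. h $ i *\<^sub>R partial_deriv i f x)"
      unfolding partial_deriv_def by (simp add: linear_sum[OF lin] linear_cmul[OF lin])
    finally show ?thesis .
  qed
  then have "frechet_derivative f (at x) = (\<lambda>h. \<Sum>i\<in>UNIV. h $ i *\<^sub>R partial_deriv i f x)" by auto
  with d show ?thesis by simp
qed

lemma smooth_DERIV_line:
  fixes f :: "real ^ 'd::finite \<Rightarrow> 'b::euclidean_space"
  assumes "smooth f"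
  shows "DERIV (\<lambda>s. f (y + s *\<^sub>R axis i 1) \<bullet> b) s :> partial_deriv i f (y + s *\<^sub>R axis i 1) \<bullet> b"
proof -
  have "((\<lambda>s :: real. f (y + s *\<^sub>R axis i 1)) has_derivative
     (\<lambda>t. \<Sum>j\<in>UNIV. (t *\<^sub>R axis i 1) $ j *\<^sub>R partial_deriv j f (y + s *\<^sub>R axis i 1))) (at s)"
    by (rule has_derivative_compose[OF _ smooth_has_derivative[OF assms]]) (auto intro!: derivative_eq_intros)
  moreover have "(\<Sum>j\<in>UNIV. (t *\<^sub>R axis i 1) $ j *\<^sub>R partial_deriv j f (y + s *\<^sub>R axis i 1)) = t *\<^sub>R partial_deriv i f (y + s *\<^sub>R axis i 1)" for t
    by (simp add: axis_def if_distrib[of "\<lambda>c. c *\<^sub>R _"] if_distrib[of "\<lambda>c. _ * c"] cong: if_cong)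
  ultimately have "((\<lambda>s. f (y + s *\<^sub>R axis i 1)) has_derivative (\<lambda>t. t *\<^sub>R partial_deriv i f (y + s *\<^sub>R axis i 1))) (at s)" by simp
  from has_derivative_inner_left[OF this, of b]
  have "((\<lambda>s. f (y + s *\<^sub>R axis i 1) \<bullet> b) has_derivative (\<lambda>t. t *\<^sub>R partial_deriv i f (y + s *\<^sub>R axis i 1) \<bullet> b)) (at s)" .
  moreover have "(\<lambda>t. t *\<^sub>R partial_deriv i f (y + s *\<^sub>R axis i 1) \<bullet> b) = (*) (partial_deriv i f (y + s *\<^sub>R axis i 1) \<bullet> b)"
    by (auto simp: fun_eq_iff)
  ultimately show ?thesis by (simp add: has_field_derivative_def)
qed

text \<open>The mean value theorem, applied first in direction \<open>i\<close> and then in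
  direction \<open>j\<close>. It needs real values, hence the component along
  \<open>b\<close>.\<close>

lemma second_difference:
  fixes f :: "real ^ 'd::finite \<Rightarrow> 'b::euclidean_space"
  assumes f: "smooth f" and h: "0 < h"
  obtains \<xi> where "norm (\<xi> - x) \<le> 2 * h"
    "(f (x + h *\<^sub>R axis i 1 + h *\<^sub>R axis j 1) - f (x + h *\<^sub>R axis i 1) - f (x + h *\<^sub>R axis j 1) + f x) \<bullet> b
      = h * (h * (partial_deriv j (partial_deriv i f) \<xi> \<bullet> b))"
proof -
  let ?i = "axis i 1 :: real ^ 'd" and ?j = "axis j 1 :: real ^ 'd"
  define g where "g s = f (x + h *\<^sub>R ?j + s *\<^sub>R ?i) \<bullet> b - f (x + s *\<^sub>R ?i) \<bullet> b" for s
  have dg: "DERIV g s :> partial_deriv i f (x + h *\<^sub>R ?j + s *\<^sub>R ?i) \<bullet> b - partial_deriv i f (x + s *\<^sub>R ?i) \<bullet> b" for s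
    unfolding g_def[abs_def] by (intro DERIV_diff smooth_DERIV_line f)
  obtain \<sigma> where \<sigma>: "0 < \<sigma>" "\<sigma> < h"
    "g h - g 0 = (h - 0) * (partial_deriv i f (x + h *\<^sub>R ?j + \<sigma> *\<^sub>R ?i) \<bullet> b - partial_deriv i f (x + \<sigma> *\<^sub>R ?i) \<bullet> b)"
    using MVT2[of 0 h g "\<lambda>s. partial_deriv i f (x + h *\<^sub>R ?j + s *\<^sub>R ?i) \<bullet> b - partial_deriv i f (x + s *\<^sub>R ?i) \<bullet> b"] h dg
    by blast
  define k where "k t = partial_deriv i f (x + \<sigma> *\<^sub>R ?i + t *\<^sub>R ?j) \<bullet> b" for t
  have dk: "DERIV k t :> partial_deriv j (partial_deriv i f) (x + \<sigma> *\<^sub>R ?i + t *\<^sub>R ?j) \<bullet> b" for t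
    unfolding k_def[abs_def] by (intro smooth_DERIV_line smooth_partial f)
  obtain \<tau> where \<tau>: "0 < \<tau>" "\<tau> < h"
    "k h - k 0 = (h - 0) * (partial_deriv j (partial_deriv i f) (x + \<sigma> *\<^sub>R ?i + \<tau> *\<^sub>R ?j) \<bullet> b)"
    using MVT2[of 0 h k "\<lambda>t. partial_deriv j (partial_deriv i f) (x + \<sigma> *\<^sub>R ?i + t *\<^sub>R ?j) \<bullet> b"] h dk
    by blast
  show ?thesis
  proof (rule that)
    have "norm (\<sigma> *\<^sub>R ?i + \<tau> *\<^sub>R ?j) \<le> norm (\<sigma> *\<^sub>R ?i) + norm (\<tau> *\<^sub>R ?j)" by (rule norm_triangle_ineq)
    also have "\<dots> \<le> 2 * h" using \<sigma> \<tau> by simp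
    finally show "norm ((x + \<sigma> *\<^sub>R ?i + \<tau> *\<^sub>R ?j) - x) \<le> 2 * h" by (simp add: algebra_simps)
    have "(f (x + h *\<^sub>R ?i + h *\<^sub>R ?j) - f (x + h *\<^sub>R ?i) - f (x + h *\<^sub>R ?j) + f x) \<bullet> b = g h - g 0"
      by (simp add: g_def inner_diff_left inner_add_left algebra_simps)
    also have "\<dots> = h * (k h - k 0)" unfolding \<sigma>(3) by (simp add: k_def algebra_simps)
    also have "\<dots> = h * (h * (partial_deriv j (partial_deriv i f) (x + \<sigma> *\<^sub>R ?i + \<tau> *\<^sub>R ?j) \<bullet> b))" unfolding \<tau>(3) by simp
    finally show "(f (x + h *\<^sub>R ?i + h *\<^sub>R ?j) - f (x + h *\<^sub>R ?i) - f (x + h *\<^sub>R ?j) + f x) \<bullet> b = \<dots>" .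
  qed
qed

text \<open>The second difference quotient is symmetric in \<open>i\<close> and \<open>j\<close>,
  and by continuity both mixed derivatives are its limit as the step tends to 0.\<close>

lemma partial_deriv_commute:
  fixes f :: "real ^ 'd::finite \<Rightarrow> 'b::euclidean_space"
  assumes f: "smooth f"
  shows "partial_deriv i (partial_deriv j f) = partial_deriv j (partial_deriv i f)"
proof (rule ext, rule euclidean_eqI)
  fix x and b :: 'b assume "b \<in> Basis"
  let ?h = "\<lambda>n. inverse (real (Suc n))"
  have h: "0 < ?h n" for n by simp
  have tends: "\<xi> \<longlonglongrightarrow> x" if "\<And>n. norm (\<xi> n - x) \<le> 2 * ?h n" for \<xi> :: "nat \<Rightarrow> real ^ 'd"
  proof -
    have "(\<lambda>n. 2 * ?h n) \<longlonglongrightarrow> 2 * 0" by (intro tendsto_intros LIMSEQ_inverse_real_of_nat)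
    then have "(\<lambda>n. \<xi> n - x) \<longlonglongrightarrow> 0"
      by (intro Lim_null_comparison[of "\<lambda>n. \<xi> n - x" "\<lambda>n. 2 * ?h n"]) (use that in \<open>auto simp del: of_nat_Suc\<close>)
    then show ?thesis by (simp add: LIM_zero_iff)
  qed
  have cont: "(\<lambda>n. partial_deriv p (partial_deriv q f) (\<xi> n) \<bullet> b) \<longlonglongrightarrow> partial_deriv p (partial_deriv q f) x \<bullet> b"
    if "\<xi> \<longlonglongrightarrow> x" for p q \<xi>
    by (intro tendsto_inner tendsto_const
        continuous_on_tendsto_compose[OF smooth_continuous[OF smooth_partial[OF smooth_partial[OF f]]] that]) auto
  have "\<exists>\<xi>. norm (\<xi> - x) \<le> 2 * ?h n \<and>
    (f (x + ?h n *\<^sub>R axis i 1 + ?h n *\<^sub>R axis j 1) - f (x + ?h n *\<^sub>R axis i 1) - f (x + ?h n *\<^sub>R axis j 1) + f x) \<bullet> b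
      = ?h n * (?h n * (partial_deriv j (partial_deriv i f) \<xi> \<bullet> b))" for n
    using second_difference[OF f h[of n], of x i j b] by metis
  then obtain \<xi> where \<xi>: "\<And>n. norm (\<xi> n - x) \<le> 2 * ?h n"
    "\<And>n. (f (x + ?h n *\<^sub>R axis i 1 + ?h n *\<^sub>R axis j 1) - f (x + ?h n *\<^sub>R axis i 1) - f (x + ?h n *\<^sub>R axis j 1) + f x) \<bullet> b
      = ?h n * (?h n * (partial_deriv j (partial_deriv i f) (\<xi> n) \<bullet> b))" by metis
  have "\<exists>\<xi>. norm (\<xi> - x) \<le> 2 * ?h n \<and>
    (f (x + ?h n *\<^sub>R axis j 1 + ?h n *\<^sub>R axis i 1) - f (x + ?h n *\<^sub>R axis j 1) - f (x + ?h n *\<^sub>R axis i 1) + f x) \<bullet> b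
      = ?h n * (?h n * (partial_deriv i (partial_deriv j f) \<xi> \<bullet> b))" for n
    using second_difference[OF f h[of n], of x j i b] by metis
  then obtain \<eta> where \<eta>: "\<And>n. norm (\<eta> n - x) \<le> 2 * ?h n"
    "\<And>n. (f (x + ?h n *\<^sub>R axis j 1 + ?h n *\<^sub>R axis i 1) - f (x + ?h n *\<^sub>R axis j 1) - f (x + ?h n *\<^sub>R axis i 1) + f x) \<bullet> b
      = ?h n * (?h n * (partial_deriv i (partial_deriv j f) (\<eta> n) \<bullet> b))" by metis
  have "partial_deriv i (partial_deriv j f) (\<eta> n) \<bullet> b = partial_deriv j (partial_deriv i f) (\<xi> n) \<bullet> b" for n
  proof -
    let ?p = "x + ?h n *\<^sub>R axis i 1" and ?q = "x + ?h n *\<^sub>R axis j 1"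
    have "f (?p + ?h n *\<^sub>R axis j 1) = f (?q + ?h n *\<^sub>R axis i 1)" by (simp add: add_ac)
    then have "?h n * (?h n * (partial_deriv j (partial_deriv i f) (\<xi> n) \<bullet> b)) = ?h n * (?h n * (partial_deriv i (partial_deriv j f) (\<eta> n) \<bullet> b))"
      unfolding \<xi>(2)[symmetric] \<eta>(2)[symmetric] by (simp add: inner_diff_left inner_add_left)
    then show ?thesis using h[of n] by simp
  qed
  then have "(\<lambda>n. partial_deriv j (partial_deriv i f) (\<xi> n) \<bullet> b) \<longlonglongrightarrow> partial_deriv i (partial_deriv j f) x \<bullet> b"
    using cont[OF tends[OF \<eta>(1)], of i j] by simp
  from LIMSEQ_unique[OF this cont[OF tends[OF \<xi>(1)], of j i]]
  show "partial_deriv i (partial_deriv j f) x \<bullet> b = partial_deriv j (partial_deriv i f) x \<bullet> b" .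
qed

lemma iter_partial_move:
  fixes f :: "real ^ 'd::finite \<Rightarrow> 'b::euclidean_space"
  assumes f: "smooth f"
  shows "iter_partial (as @ j # bs) f = iter_partial (j # as @ bs) f"
proof (induction as)
  case (Cons a as)
  have "iter_partial ((a # as) @ j # bs) f = partial_deriv a (partial_deriv j (iter_partial (as @ bs) f))"
    using Cons by (simp add: iter_partial_Cons)
  also have "\<dots> = partial_deriv j (partial_deriv a (iter_partial (as @ bs) f))"
    by (rule partial_deriv_commute[OF smooth_iter_partial[OF f]])
  finally show ?case by (simp add: iter_partial_Cons)
qed simp

text \<open>Lists with equal counts are permutations of each other, and
  \<open>iter_partial_move\<close> brings any entry to the front.\<close>

lemma iter_partial_cong_count:
  fixes f :: "real ^ 'd::finite \<Rightarrow> 'b::euclidean_space"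
  assumes f: "smooth f" and "\<And>i. count_list js i = count_list js' i"
  shows "iter_partial js f = iter_partial js' f"
  using assms(2)
proof (induction js arbitrary: js')
  case Nil
  have "i \<notin> set js'" for i using Nil[of i, symmetric] by (simp add: count_list_0_iff)
  then have "js' = []" by (cases js') auto
  then show ?case by simp
next
  case (Cons j js)
  have "count_list js' j \<noteq> 0" using Cons.prems[of j, symmetric] by simp
  then have "j \<in> set js'" using count_list_0_iff[of js' j] by auto
  then obtain as bs where js': "js' = as @ j # bs" by (auto dest: split_list)
  have "count_list js i = count_list (as @ bs) i" for i
    using Cons.prems[of i] unfolding js' by (auto simp: count_list_append split: if_splits)
  from Cons.IH[OF this] show ?case
    unfolding js' iter_partial_move[OF f] by (simp add: iter_partial_Cons)
qed

text \<open>\<open>multi_deriv\<close> differentiates along a list picked by \<open>SOME\<close>,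
  and the lists picked for \<open>\<beta>\<close> and \<open>sucidx \<beta> i\<close> need not be
  related. Only their counts are, and these suffice.\<close>

lemma partial_deriv_multi_deriv:
  fixes f :: "real ^ 'd::finite \<Rightarrow> 'b::euclidean_space"
  assumes f: "smooth f"
  shows "partial_deriv i (multi_deriv \<beta> f) = multi_deriv (sucidx \<beta> i) f"
  unfolding multi_deriv_def iter_partial_Cons[symmetric]
  by (rule iter_partial_cong_count[OF f]) (simp add: some_count_list sucidx_def)

lemma smooth_multi_deriv: "smooth f \<Longrightarrow> smooth (multi_deriv \<alpha> f)"
  unfolding multi_deriv_def by (rule smooth_iter_partial)

lemma multi_deriv_zero: "multi_deriv (\<lambda>_. 0) f = f"
proof -
  have "count_list (SOME js. \<forall>i. count_list js i = 0) i = 0" for i :: 'a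
    by (rule some_count_list[of "\<lambda>_. 0"])
  then have "(SOME js :: 'a list. \<forall>i. count_list js i = 0) = []"
    by (metis count_list_0_iff list.set_intros(1) neq_Nil_conv)
  then show ?thesis by (simp add: multi_deriv_def iter_partial_def)
qed

lemma partial_deriv_diff:
  assumes "smooth f" "smooth g"
  shows "partial_deriv i (\<lambda>x. f x - g x) = (\<lambda>x. partial_deriv i f x - partial_deriv i g x)"
proof
  fix x
  have "((\<lambda>x. f x - g x) has_derivative (\<lambda>h. frechet_derivative f (at x) h - frechet_derivative g (at x) h)) (at x)"
    using assms by (intro has_derivative_diff) (auto simp: frechet_derivative_works[symmetric] smooth_differentiable)
  then show "partial_deriv i (\<lambda>x. f x - g x) x = partial_deriv i f x - partial_deriv i g x"
    by (simp add: partial_deriv_def frechet_derivative_at[symmetric])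
qed

lemma iter_partial_diff:
  assumes "smooth f" "smooth g"
  shows "iter_partial js (\<lambda>x. f x - g x) = (\<lambda>x. iter_partial js f x - iter_partial js g x)"
proof (induction js)
  case (Cons j js)
  then show ?case
    using partial_deriv_diff[OF smooth_iter_partial[OF assms(1)] smooth_iter_partial[OF assms(2)], of j js js]
    by (simp add: iter_partial_Cons)
qed (simp add: iter_partial_def)

lemma iter_partial_zero_on_open:
  assumes "open A" "\<And>x. x \<in> A \<Longrightarrow> f x = 0" "x \<in> A"
  shows "iter_partial js f x = 0"
  using assms(3)
proof (induction js arbitrary: x)
  case (Cons j js)
  let ?g = "iter_partial js f"
  have "\<forall>\<^sub>F y in nhds x. y \<in> A" using Cons.prems assms(1) by (rule eventually_nhds_in_open[rotated])
  then have "\<forall>\<^sub>F y in nhds x. (\<lambda>_. 0) y = ?g y" by eventually_elim (simp add: Cons.IH)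
  then have "\<forall>\<^sub>F y in at x. (\<lambda>_. 0) y = ?g y" unfolding eventually_at_filter by eventually_elim simp
  then have "(?g has_derivative (\<lambda>_. 0)) (at x)"
    by (rule has_derivative_transform_eventually[OF has_derivative_const]) (auto simp: Cons.IH[OF Cons.prems])
  from fun_cong[OF frechet_derivative_at[OF this], of "axis j 1"] show ?case
    by (simp add: iter_partial_Cons partial_deriv_def)
qed (use assms in \<open>simp add: iter_partial_def\<close>)

section \<open>Test functions on the whole space\<close>

lemma smooth_upper_gradient:
  fixes f :: "real ^ 'd::finite \<Rightarrow> 'b::euclidean_space"
  assumes f: "smooth f"
  shows "upper_gradient UNIV f (\<lambda>x. \<Sum>i\<in>UNIV. ennreal (norm (partial_deriv i f x)))"
  unfolding upper_gradient_def
proof (intro conjI allI)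
  show [measurable]: "f \<in> borel_measurable borel"
    by (intro borel_measurable_continuous_onI smooth_continuous f)
  have [measurable]: "partial_deriv i f \<in> borel_measurable borel" for i
    by (intro borel_measurable_continuous_onI smooth_continuous smooth_partial f)
  let ?G = "\<lambda>x. \<Sum>i\<in>UNIV. ennreal (norm (partial_deriv i f x))"
  show "?G \<in> borel_measurable borel" by measurable
  fix h :: "real ^ 'd"
  show "AE x in lborel. x \<in> UNIV \<and> x + h \<in> UNIV \<longrightarrow>
    ennreal (norm (f (x + h) - f x)) \<le> ennreal (norm h) * (\<integral>\<^sup>+s\<in>{0<..1}. ?G (x + s *\<^sub>R h) \<partial>lborel)"
  proof (intro AE_I2 impI)
    fix x
    define F' where "F' s = (\<Sum>i\<in>UNIV. h $ i *\<^sub>R partial_deriv i f (x + s *\<^sub>R h))" for s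
    have "((\<lambda>s :: real. f (x + s *\<^sub>R h)) has_derivative (\<lambda>t. \<Sum>i\<in>UNIV. (t *\<^sub>R h) $ i *\<^sub>R partial_deriv i f (x + s *\<^sub>R h))) (at s)" for s
      by (rule has_derivative_compose[OF _ smooth_has_derivative[OF f]]) (auto intro!: derivative_eq_intros)
    then have d: "((\<lambda>s. f (x + s *\<^sub>R h)) has_vector_derivative F' s) (at s)" for s
      unfolding has_vector_derivative_def F'_def by (simp add: scaleR_sum_right)
    have c: "continuous_on {0..1} F'"
      unfolding F'_def by (intro continuous_intros continuous_on_compose2[OF smooth_continuous[OF smooth_partial[OF f]]]) auto
    have int: "integrable lborel (\<lambda>s. indicator {0..1} s *\<^sub>R F' s)"
      using borel_integrable_atLeastAtMost'[OF c] by (simp add: set_integrable_def)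
    have "(\<integral>s. indicator {0..1 :: real} s *\<^sub>R F' s \<partial>lborel) = f (x + 1 *\<^sub>R h) - f (x + 0 *\<^sub>R h)"
      by (rule integral_FTC_Icc) (auto intro: has_vector_derivative_at_within d c)
    then have "ennreal (norm (f (x + h) - f x)) = ennreal (norm (\<integral>s. indicator {0..1 :: real} s *\<^sub>R F' s \<partial>lborel))" by simp
    also have "\<dots> \<le> (\<integral>\<^sup>+s. ennreal (norm (indicator {0..1 :: real} s *\<^sub>R F' s)) \<partial>lborel)"
      by (rule integral_norm_bound_ennreal[OF int])
    also have "\<dots> \<le> (\<integral>\<^sup>+s. ennreal (norm h) * (?G (x + s *\<^sub>R h) * indicator {0<..1} s) \<partial>lborel)"
    proof (rule nn_integral_mono_AE)
      show "AE s in lborel. ennreal (norm (indicator {0..1 :: real} s *\<^sub>R F' s)) \<le> ennreal (norm h) * (?G (x + s *\<^sub>R h) * indicator {0<..1} s)"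
        using AE_lborel_singleton[of "0 :: real"]
      proof eventually_elim
        case (elim s)
        show ?case
        proof (cases "s \<in> {0..1}")
          case True
          have "norm (F' s) \<le> (\<Sum>i\<in>UNIV. \<bar>h $ i\<bar> * norm (partial_deriv i f (x + s *\<^sub>R h)))"
            unfolding F'_def by (rule order_trans[OF norm_sum]) simp
          also have "\<dots> \<le> (\<Sum>i\<in>UNIV. norm h * norm (partial_deriv i f (x + s *\<^sub>R h)))"
            by (intro sum_mono mult_right_mono component_le_norm_cart) auto
          also have "\<dots> = norm h * (\<Sum>i\<in>UNIV. norm (partial_deriv i f (x + s *\<^sub>R h)))" by (simp add: sum_distrib_left)
          finally have "ennreal (norm (indicator {0..1 :: real} s *\<^sub>R F' s)) \<le> ennreal (norm h * (\<Sum>i\<in>UNIV. norm (partial_deriv i f (x + s *\<^sub>R h))))"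
            using True by (intro ennreal_leI) simp
          then show ?thesis using True elim by (simp add: ennreal_mult sum_nonneg)
        qed auto
      qed
    qed
    also have "\<dots> = ennreal (norm h) * (\<integral>\<^sup>+s\<in>{0<..1}. ?G (x + s *\<^sub>R h) \<partial>lborel)"
      by (rule nn_integral_cmult) measurable
    finally show "ennreal (norm (f (x + h) - f x)) \<le> \<dots>" .
  qed
qed

lemma test_fun_smooth: "\<phi> \<in> test_fun U \<Longrightarrow> smooth \<phi>"
  by (simp add: test_fun_def smooth_def)

lemma smooth_deriv_system:
  fixes \<phi> :: "real ^ 'd::finite \<Rightarrow> 'b::euclidean_space"
  assumes "smooth \<phi>"
  shows "deriv_system UNIV k (\<lambda>\<alpha>. multi_deriv \<alpha> \<phi>)"
  unfolding deriv_system_def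
proof (intro conjI allI impI)
  fix \<beta> :: "'d \<Rightarrow> nat"
  show "upper_gradient UNIV (multi_deriv \<beta> \<phi>) (\<lambda>x. \<Sum>i\<in>UNIV. ennreal (norm (multi_deriv (sucidx \<beta> i) \<phi> x)))"
    using smooth_upper_gradient[OF smooth_multi_deriv[OF assms], of \<beta>] unfolding partial_deriv_multi_deriv[OF assms] .
qed (intro borel_measurable_continuous_onI smooth_continuous smooth_multi_deriv assms)

text \<open>This supplies the integrability under which the mean values over growing cubes vanish.
  Off the support all derivatives are zero, and on it they are bounded.\<close>

lemma test_fun_integrable:
  fixes \<phi> :: "real ^ 'd::finite \<Rightarrow> 'b::euclidean_space"
  assumes \<phi>: "\<phi> \<in> test_fun U"
  shows "(\<integral>\<^sup>+x. ennreal (norm (multi_deriv \<alpha> \<phi> x)) \<partial>lborel) < top"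
proof -
  let ?K = "closure {x. \<phi> x \<noteq> 0}"
  have K: "compact ?K" using \<phi> by (simp add: test_fun_def)
  have 0: "multi_deriv \<alpha> \<phi> x = 0" if "x \<notin> ?K" for x
    unfolding multi_deriv_def using that closure_subset[of "{x. \<phi> x \<noteq> 0}"]
    by (intro iter_partial_zero_on_open[of "- ?K"]) auto
  have "compact (multi_deriv \<alpha> \<phi> ` ?K)"
    using smooth_continuous[OF smooth_multi_deriv[OF test_fun_smooth[OF \<phi>]]] K
    by (intro compact_continuous_image) (auto intro: continuous_on_subset)
  then obtain B where B: "\<And>x. x \<in> ?K \<Longrightarrow> norm (multi_deriv \<alpha> \<phi> x) \<le> B"
    using bounded_iff[of "multi_deriv \<alpha> \<phi> ` ?K"] compact_imp_bounded by auto
  have "(\<integral>\<^sup>+x. ennreal (norm (multi_deriv \<alpha> \<phi> x)) \<partial>lborel) \<le> (\<integral>\<^sup>+x. ennreal B * indicator ?K x \<partial>lborel)"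
    using B 0 by (intro nn_integral_mono) (auto simp: indicator_def intro: ennreal_leI)
  also have "\<dots> = ennreal B * emeasure lborel ?K"
    using K by (intro nn_integral_cmult_indicator) (auto intro: borel_compact)
  also have "\<dots> < top"
    using emeasure_bounded_finite[OF compact_imp_bounded[OF K]] by (simp add: ennreal_mult_less_top)
  finally show ?thesis .
qed

lemma grad_sum_test_fun_step:
  fixes \<phi> :: "real ^ 'd::finite \<Rightarrow> 'b::euclidean_space"
  assumes \<phi>: "\<phi> \<in> test_fun UNIV" and m: "m < k"
  defines "G \<equiv> grad_sum (\<lambda>\<alpha>. multi_deriv \<alpha> \<phi>)"
  shows "AE x in lborel. G m x \<le> ennreal (idx_const TYPE('d) k * real CARD('d) ^ CARD('d)) * riesz (G (Suc m)) x"
proof -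
  let ?K = "real CARD('d) ^ CARD('d)"
  note u = smooth_deriv_system[OF test_fun_smooth[OF \<phi>], of k]
  have "AE x in lborel. \<forall>\<beta>\<in>midx m. ennreal (norm (multi_deriv \<beta> \<phi> x)) \<le> ennreal ?K * riesz (G (Suc m)) x"
    unfolding G_def
    by (intro AE_finite_allI finite_midx upper_gradient_pointwise_riesz[OF deriv_system_upper_gradient[OF u _ m] test_fun_integrable[OF \<phi>]])
  then show ?thesis
  proof eventually_elim
    case (elim x)
    have "G m x \<le> (\<Sum>\<beta>\<in>(midx m :: ('d \<Rightarrow> nat) set). ennreal ?K * riesz (G (Suc m)) x)"
      unfolding G_def grad_sum_def[of _ m] using elim by (intro sum_mono) (auto simp: G_def)
    also have "\<dots> = ennreal (real (card (midx m :: ('d \<Rightarrow> nat) set)) * ?K) * riesz (G (Suc m)) x"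
      by (simp add: ennreal_mult ennreal_of_nat_eq_real_of_nat mult.assoc)
    also have "\<dots> \<le> ennreal (idx_const TYPE('d) k * ?K) * riesz (G (Suc m)) x"
      using m by (intro mult_right_mono ennreal_leI idx_const) auto
    finally show ?case .
  qed
qed

text \<open>In contrast to the cube no lower order is left behind, so the density is that of order
  \<open>k\<close> alone.\<close>

lemma grad_sum_test_fun_iterate:
  fixes \<phi> :: "real ^ 'd::finite \<Rightarrow> 'b::euclidean_space"
  assumes \<phi>: "\<phi> \<in> test_fun UNIV" and "m + n = k"
  defines "G \<equiv> grad_sum (\<lambda>\<alpha>. multi_deriv \<alpha> \<phi>)"
  defines "C \<equiv> idx_const TYPE('d) k * real CARD('d) ^ CARD('d)"
  shows "AE x in lborel. G m x \<le> ennreal (C ^ n) * (riesz ^^ n) (G k) x"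
  using assms(2)
proof (induction n arbitrary: m)
  case (Suc n)
  have C: "0 \<le> C" unfolding C_def using idx_const(1)[where ?'d='d and k=k] by simp
  have [measurable]: "G k \<in> borel_measurable borel"
    unfolding G_def by (rule grad_sum_borel[OF smooth_deriv_system[OF test_fun_smooth[OF \<phi>], of k]]) simp
  have Hn [measurable]: "(riesz ^^ n) (G k) \<in> borel_measurable borel" for n
    by (induction n) auto
  have IH: "AE x in lborel. G (Suc m) x \<le> ennreal (C ^ n) * (riesz ^^ n) (G k) x"
    using Suc by auto
  have "AE x in lborel. G m x \<le> ennreal C * riesz (G (Suc m)) x"
    using grad_sum_test_fun_step[OF \<phi>, of m k] Suc.prems by (simp add: G_def C_def)
  then show ?case
  proof eventually_elim
    case (elim x)
    also have "ennreal C * riesz (G (Suc m)) x \<le> ennreal C * riesz (\<lambda>y. ennreal (C ^ n) * (riesz ^^ n) (G k) y) x"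
      by (intro mult_left_mono riesz_mono_AE IH) simp
    also have "\<dots> = ennreal C * (ennreal (C ^ n) * riesz ((riesz ^^ n) (G k)) x)"
      by (subst riesz_cmult[OF Hn]) simp
    also have "\<dots> = ennreal (C ^ Suc n) * (riesz ^^ Suc n) (G k) x"
      using C by (simp add: mult.assoc[symmetric] ennreal_mult'[symmetric])
    finally show ?case .
  qed
qed simp

section \<open>The estimate on the whole space\<close>

lemma multi_deriv_diff:
  assumes "smooth f" "smooth g"
  shows "multi_deriv \<alpha> (\<lambda>x. f x - g x) x = multi_deriv \<alpha> f x - multi_deriv \<alpha> g x"
  unfolding multi_deriv_def iter_partial_diff[OF assms] ..

lemma smooth_diff: "smooth f \<Longrightarrow> smooth g \<Longrightarrow> smooth (\<lambda>x. f x - g x)"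
  unfolding smooth_def using iter_partial_diff[of f g] by (auto simp: smooth_def intro: differentiable_diff)

lemma grad_abs_triangle:
  assumes "smooth f" "smooth g"
  shows "grad_abs (\<lambda>\<alpha>. multi_deriv \<alpha> f) m x \<le>
    grad_abs (\<lambda>\<alpha>. multi_deriv \<alpha> g) m x + grad_abs (\<lambda>\<alpha>. multi_deriv \<alpha> (\<lambda>x. f x - g x)) m x"
proof -
  let ?A = "{\<alpha>. multi_abs \<alpha> = m}"
  have "norm (multi_deriv \<alpha> f x) \<le> norm (multi_deriv \<alpha> g x) + norm (multi_deriv \<alpha> (\<lambda>x. f x - g x) x)" for \<alpha>
    unfolding multi_deriv_diff[OF assms] by (metis norm_triangle_sub)
  then have "L2_set (\<lambda>\<alpha>. norm (multi_deriv \<alpha> f x)) ?A \<le>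
      L2_set (\<lambda>\<alpha>. norm (multi_deriv \<alpha> g x) + norm (multi_deriv \<alpha> (\<lambda>x. f x - g x) x)) ?A"
    by (intro L2_set_mono) auto
  also have "\<dots> \<le> L2_set (\<lambda>\<alpha>. norm (multi_deriv \<alpha> g x)) ?A + L2_set (\<lambda>\<alpha>. norm (multi_deriv \<alpha> (\<lambda>x. f x - g x) x)) ?A"
    by (rule L2_set_triangle_ineq)
  finally show ?thesis by (simp add: grad_abs_def L2_set_def)
qed

lemma grad_abs_borel:
  fixes f :: "real ^ 'd::finite \<Rightarrow> 'b::euclidean_space"
  assumes "smooth f"
  shows "(\<lambda>x. ennreal (grad_abs (\<lambda>\<alpha>. multi_deriv \<alpha> f) m x)) \<in> borel_measurable borel"
proof -
  have [measurable]: "multi_deriv \<alpha> f \<in> borel_measurable borel" for \<alpha>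
    by (intro borel_measurable_continuous_onI smooth_continuous smooth_multi_deriv assms)
  show ?thesis unfolding grad_abs_def by measurable
qed

text \<open>For \<open>r > p\<close> the Lorentz functional is only a quasi-norm. Since the factor
  \<open>(1 - \<delta>)\<^sup>-\<^sup>e\<close> can be brought arbitrarily close to 1, the norms along a Cauchy sequence still
  converge, so that the limit defining \<open>hom_sobolev_norm\<close> is not a junk value.\<close>

lemma quasi_Cauchy_convergent:
  fixes X :: "nat \<Rightarrow> ennreal" and e :: real
  assumes "\<And>\<delta> \<eta>. 0 < \<delta> \<Longrightarrow> \<delta> < 1 \<Longrightarrow> 0 < \<eta> \<Longrightarrow>
    \<exists>N. \<forall>m\<ge>N. \<forall>n\<ge>N. X m \<le> ennreal ((1 - \<delta>) powr - e) * X n + ennreal (\<delta> powr - e) * ennreal \<eta>"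
  shows "X \<longlonglongrightarrow> liminf X"
proof -
  have "limsup X \<le> liminf X"
  proof (cases "liminf X")
    case (real L)
    have step: "limsup X \<le> ennreal ((1 - \<delta>) powr - e * L)" if \<delta>: "0 < \<delta>" "\<delta> < 1" for \<delta>
    proof (rule ennreal_le_epsilon)
      fix s :: real assume s: "0 < s"
      define A where "A = (1 - \<delta>) powr - e"
      define B where "B = \<delta> powr - e"
      have AB: "0 < A" "0 < B" using \<delta> by (auto simp: A_def B_def)
      \<comment> \<open>Chosen so that \<open>A (L + \<eta>) + B \<eta> = A L + s\<close>.\<close>
      define \<eta> where "\<eta> = s / (A + B)"
      have \<eta>: "0 < \<eta>" "(A + B) * \<eta> = s" using s AB by (auto simp: \<eta>_def)
      obtain N where N: "\<And>m n. N \<le> m \<Longrightarrow> N \<le> n \<Longrightarrow> X m \<le> ennreal A * X n + ennreal B * ennreal \<eta>"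
        using assms[OF \<delta> \<eta>(1)] unfolding A_def B_def by blast
      have "(INF n\<in>{N..}. X n) \<le> liminf X" unfolding liminf_SUP_INF by (rule SUP_upper) simp
      also have "\<dots> < ennreal (L + \<eta>)" using real \<eta>(1) by (simp add: ennreal_lessI)
      finally obtain n where n: "N \<le> n" "X n < ennreal (L + \<eta>)" by (auto simp: INF_less_iff)
      have "X m \<le> ennreal (A * L) + ennreal s" if "N \<le> m" for m
      proof -
        have "X m \<le> ennreal A * ennreal (L + \<eta>) + ennreal B * ennreal \<eta>"
          using N[OF that n(1)] n(2) by (meson add_right_mono less_imp_le mult_left_mono order_trans zero_le)
        also have "\<dots> = ennreal (A * (L + \<eta>) + B * \<eta>)"
          using AB \<eta>(1) real by (simp add: ennreal_mult[symmetric] ennreal_plus[symmetric] del: ennreal_plus)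
        also have "A * (L + \<eta>) + B * \<eta> = A * L + s" using \<eta>(2) by (simp add: algebra_simps)
        finally show ?thesis using AB real s by (simp add: ennreal_plus)
      qed
      then have "limsup X \<le> ennreal (A * L) + ennreal s"
        by (intro Limsup_bounded eventually_sequentiallyI[of N]) auto
      then show "limsup X \<le> ennreal ((1 - \<delta>) powr - e * L) + ennreal s" by (simp add: A_def)
    qed
    \<comment> \<open>The parameter \<open>1 / (n + 2)\<close> is below 1 for every \<open>n\<close>
      and tends to 0, which removes the factor in front of \<open>L\<close>.\<close>
    have "(\<lambda>n. (1 - inverse (real (Suc (Suc n)))) powr - e * L) \<longlonglongrightarrow> (1 - 0) powr - e * L"
      by (intro tendsto_intros LIMSEQ_Suc[OF LIMSEQ_inverse_real_of_nat]) auto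
    then have "(\<lambda>n. ennreal ((1 - inverse (real (Suc (Suc n)))) powr - e * L)) \<longlonglongrightarrow> ennreal L"
      using tendsto_ennrealI by fastforce
    moreover have "limsup X \<le> ennreal ((1 - inverse (real (Suc (Suc n)))) powr - e * L)" for n
      by (rule step) (auto simp: field_simps)
    ultimately have "limsup X \<le> ennreal L" by (intro LIMSEQ_le_const) auto
    then show ?thesis using real by simp
  qed simp
  then have "limsup X = liminf X"
    using Liminf_le_Limsup[of sequentially X] by (intro antisym) auto
  then show ?thesis by (intro Liminf_eq_Limsup) auto
qed

section \<open>Stability under convergence in \<open>L1\<close> on compact sets\<close>

lemma liminf_vanishing_error:
  fixes a :: "nat \<Rightarrow> ennreal"
  assumes "\<And>n. y \<le> a n + \<delta> n" and \<delta>: "\<delta> \<longlonglongrightarrow> 0"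
  shows "y \<le> liminf a"
proof (rule ennreal_le_epsilon)
  fix s :: real assume s: "0 < s"
  have "\<forall>\<^sub>F n in sequentially. \<delta> n < ennreal s"
    by (rule order_tendstoD(2)[OF \<delta>]) (use s in simp)
  then have "\<forall>\<^sub>F n in sequentially. y - ennreal s \<le> a n"
  proof eventually_elim
    case (elim n)
    have "y \<le> a n + ennreal s" using assms(1)[of n] elim by (meson add_left_mono less_imp_le order_trans)
    then show ?case by (simp add: ennreal_minus_le_iff add.commute)
  qed
  then have "y - ennreal s \<le> liminf a" by (rule Liminf_bounded)
  then show "y \<le> liminf a + ennreal s" by (simp add: ennreal_minus_le_iff add.commute)
qed

text \<open>The difference of the functions enters twice, pointwise and through the two averages,
  hence the factor 2.\<close>

lemma mean_oscillation_perturb: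
  fixes f \<phi> :: "real ^ 'd::finite \<Rightarrow> 'b::euclidean_space"
  assumes Q: "is_cube Q" and f: "set_integrable lebesgue Q f" and \<phi>: "set_integrable lebesgue Q \<phi>"
  shows "mean_oscillation Q f \<le> mean_oscillation Q \<phi> +
    2 * ((\<integral>\<^sup>+x\<in>Q. ennreal (norm (\<phi> x - f x)) \<partial>lebesgue) / emeasure lebesgue Q)"
proof -
  obtain a s where s: "0 < s" "Q = side_cube a s" using Q by (auto simp: is_cube_iff)
  define V where "V = s ^ CARD('d)"
  have V: "0 < V" "emeasure lebesgue Q = ennreal V"
    using s by (auto simp: V_def emeasure_side_cube emeasure_completion_borel)
  have mV: "measure lebesgue Q = V" using V by (simp add: measure_def)
  have QL [measurable]: "Q \<in> sets lebesgue" unfolding s(2) by simp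
  have fm [measurable]: "(\<lambda>x. indicator Q x *\<^sub>R f x) \<in> borel_measurable lebesgue"
    using f unfolding set_integrable_def by (rule borel_measurable_integrable)
  have \<phi>m [measurable]: "(\<lambda>x. indicator Q x *\<^sub>R \<phi> x) \<in> borel_measurable lebesgue"
    using \<phi> unfolding set_integrable_def by (rule borel_measurable_integrable)
  define E where "E = (\<integral>\<^sup>+x\<in>Q. ennreal (norm (\<phi> x - f x)) \<partial>lebesgue)"
  have meas: "(\<lambda>x. ennreal (norm (g x - h x)) * indicator Q x) \<in> borel_measurable lebesgue"
    if [measurable]: "(\<lambda>x. indicator Q x *\<^sub>R g x) \<in> borel_measurable lebesgue" "(\<lambda>x. indicator Q x *\<^sub>R h x) \<in> borel_measurable lebesgue"
    for g h :: "real ^ 'd \<Rightarrow> 'b"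
  proof -
    have "(\<lambda>x. ennreal (norm (indicator Q x *\<^sub>R g x - indicator Q x *\<^sub>R h x))) \<in> borel_measurable lebesgue" by measurable
    moreover have "ennreal (norm (indicator Q x *\<^sub>R g x - indicator Q x *\<^sub>R h x)) = ennreal (norm (g x - h x)) * indicator Q x" for x
      by (auto simp: indicator_def)
    ultimately show ?thesis by simp
  qed
  have avg: "ennreal (norm (average Q \<phi> - average Q f)) \<le> E / ennreal V"
  proof -
    have "average Q \<phi> - average Q f = (1 / V) *\<^sub>R (LINT x:Q|lebesgue. \<phi> x - f x)"
      unfolding average_def mV using set_integral_diff(2)[OF \<phi> f] by (simp add: scaleR_diff_right)
    then have "norm (average Q \<phi> - average Q f) = 1 / V * norm (LINT x:Q|lebesgue. \<phi> x - f x)"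
      using V(1) by simp
    then have "ennreal (norm (average Q \<phi> - average Q f)) = ennreal (1 / V) * ennreal (norm (LINT x:Q|lebesgue. \<phi> x - f x))"
      using V(1) by (simp only: ennreal_mult'[symmetric] zero_le_divide_1_iff less_imp_le)
    also have "ennreal (norm (LINT x:Q|lebesgue. \<phi> x - f x)) \<le> (\<integral>\<^sup>+x. ennreal (norm (indicator Q x *\<^sub>R (\<phi> x - f x))) \<partial>lebesgue)"
      unfolding set_lebesgue_integral_def using set_integral_diff(1)[OF \<phi> f]
      by (intro integral_norm_bound_ennreal) (simp add: set_integrable_def)
    also have "(\<integral>\<^sup>+x. ennreal (norm (indicator Q x *\<^sub>R (\<phi> x - f x))) \<partial>lebesgue) = E"
      unfolding E_def by (intro nn_integral_cong) (auto simp: indicator_def)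
    finally have "ennreal (norm (average Q \<phi> - average Q f)) \<le> ennreal (1 / V) * E"
      by (simp add: mult_left_mono)
    also have "\<dots> = E / ennreal V"
      using V(1) by (simp add: divide_ennreal_def inverse_ennreal mult.commute inverse_eq_divide)
    finally show ?thesis .
  qed
  have "(\<integral>\<^sup>+x\<in>Q. ennreal (norm (f x - average Q f)) \<partial>lebesgue) \<le>
     (\<integral>\<^sup>+x. ennreal (norm (\<phi> x - average Q \<phi>)) * indicator Q x + (ennreal (norm (\<phi> x - f x)) * indicator Q x + E / ennreal V * indicator Q x) \<partial>lebesgue)"
  proof (rule nn_integral_mono)
    fix x
    have "norm (f x - average Q f) \<le> norm (\<phi> x - average Q \<phi>) + (norm (\<phi> x - f x) + norm (average Q \<phi> - average Q f))"
      by norm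
    then have "ennreal (norm (f x - average Q f)) \<le> ennreal (norm (\<phi> x - average Q \<phi>)) + (ennreal (norm (\<phi> x - f x)) + ennreal (norm (average Q \<phi> - average Q f)))"
      by (simp add: ennreal_plus[symmetric] ennreal_leI del: ennreal_plus)
    also have "\<dots> \<le> ennreal (norm (\<phi> x - average Q \<phi>)) + (ennreal (norm (\<phi> x - f x)) + E / ennreal V)"
      by (intro add_left_mono avg)
    finally show "ennreal (norm (f x - average Q f)) * indicator Q x \<le>
      ennreal (norm (\<phi> x - average Q \<phi>)) * indicator Q x + (ennreal (norm (\<phi> x - f x)) * indicator Q x + E / ennreal V * indicator Q x)"
      by (auto simp: indicator_def)
  qed
  also have "\<dots> = (\<integral>\<^sup>+x\<in>Q. ennreal (norm (\<phi> x - average Q \<phi>)) \<partial>lebesgue) + (E + E / ennreal V * ennreal V)"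
  proof -
    have c: "(\<lambda>x. indicator Q x *\<^sub>R c) \<in> borel_measurable lebesgue" for c :: 'b by measurable
    show ?thesis
      using meas[OF \<phi>m c[of "average Q \<phi>"]] meas[OF \<phi>m fm] V
      by (subst nn_integral_add, simp, simp, subst nn_integral_add, simp, simp)
        (simp add: nn_integral_cmult_indicator E_def)
  qed
  also have "E / ennreal V * ennreal V = E"
    using V(1) by (simp add: divide_ennreal_def mult.assoc inverse_ennreal ennreal_mult[symmetric])
  finally have "(\<integral>\<^sup>+x\<in>Q. ennreal (norm (f x - average Q f)) \<partial>lebesgue) \<le>
      (\<integral>\<^sup>+x\<in>Q. ennreal (norm (\<phi> x - average Q \<phi>)) \<partial>lebesgue) + 2 * E" by (simp add: mult_2)
  then have "mean_oscillation Q f \<le> ((\<integral>\<^sup>+x\<in>Q. ennreal (norm (\<phi> x - average Q \<phi>)) \<partial>lebesgue) + 2 * E) / emeasure lebesgue Q"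
    unfolding mean_oscillation_def by (rule divide_right_mono_ennreal)
  also have "\<dots> = mean_oscillation Q \<phi> + 2 * (E / emeasure lebesgue Q)"
    unfolding mean_oscillation_def by (simp add: divide_ennreal_def distrib_right mult.assoc)
  finally show ?thesis unfolding E_def .
qed

text \<open>On one fixed cube the error of the oscillation tends to 0. Every oscillation of
  \<open>\<phi> n\<close> is below its sharp maximal function, and the supremum over cubes is taken
  last.\<close>

lemma sharp_max_liminf:
  fixes f :: "real ^ 'd::finite \<Rightarrow> 'b::euclidean_space"
  assumes f: "locally_integrable UNIV f" and \<phi>: "\<And>n. locally_integrable UNIV (\<phi> n)"
    and conv: "\<And>K. compact K \<Longrightarrow> (\<lambda>n. \<integral>\<^sup>+x\<in>K. ennreal (norm (\<phi> n x - f x)) \<partial>lebesgue) \<longlonglongrightarrow> 0"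
  shows "sharp_max UNIV f x \<le> liminf (\<lambda>n. sharp_max UNIV (\<phi> n) x)"
  unfolding sharp_max_def[of UNIV f]
proof (rule SUP_least, clarify)
  fix Q :: "(real ^ 'd) set" assume Q: "is_cube Q" "x \<in> Q"
  then obtain a s where s: "0 < s" "Q = side_cube a s" by (auto simp: is_cube_iff)
  have K: "compact Q" unfolding s(2) side_cube_def by simp
  have V: "emeasure lebesgue Q = ennreal (s ^ CARD('d))" unfolding s(2) using s(1) by (simp add: emeasure_side_cube emeasure_completion_borel)
  have "mean_oscillation Q f \<le> mean_oscillation Q (\<phi> n) + 2 * ((\<integral>\<^sup>+x\<in>Q. ennreal (norm (\<phi> n x - f x)) \<partial>lebesgue) / emeasure lebesgue Q)" for n
    using f \<phi>[of n] K by (intro mean_oscillation_perturb Q) (auto simp: locally_integrable_def)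
  moreover have "(\<lambda>n. 2 * ((\<integral>\<^sup>+x\<in>Q. ennreal (norm (\<phi> n x - f x)) \<partial>lebesgue) / emeasure lebesgue Q)) \<longlonglongrightarrow> 0"
  proof -
    have "2 * inverse (ennreal (s ^ CARD('d))) < top"
      using s(1) by (simp add: ennreal_mult_less_top inverse_ennreal)
    from ennreal_tendsto_cmult[OF this conv[OF K]] show ?thesis
      by (simp add: V divide_ennreal_def mult_ac)
  qed
  ultimately have "mean_oscillation Q f \<le> liminf (\<lambda>n. mean_oscillation Q (\<phi> n))"
    by (rule liminf_vanishing_error)
  also have "\<dots> \<le> liminf (\<lambda>n. sharp_max UNIV (\<phi> n) x)"
    using Q by (intro Liminf_mono always_eventually allI) (auto simp: sharp_max_def intro: SUP_upper)
  finally show "mean_oscillation Q f \<le> liminf (\<lambda>n. sharp_max UNIV (\<phi> n) x)" .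
qed

lemma smooth_locally_integrable:
  fixes \<phi> :: "real ^ 'd::finite \<Rightarrow> 'b::euclidean_space"
  assumes "smooth \<phi>"
  shows "locally_integrable UNIV \<phi>"
  unfolding locally_integrable_def set_integrable_def
proof (intro allI impI)
  fix K :: "(real ^ 'd) set" assume "compact K \<and> K \<subseteq> UNIV"
  then have K: "compact K" by simp
  have "integrable lborel (\<lambda>x. indicator K x *\<^sub>R \<phi> x)"
    by (intro borel_integrable_compact K continuous_on_subset[OF smooth_continuous[OF assms]]) auto
  then show "integrable lebesgue (\<lambda>x. indicator K x *\<^sub>R \<phi> x)"
    by (subst integrable_completion) (auto dest: borel_measurable_integrable)
qed

context lorentz_exponent
begin

text \<open>The measure \<open>t\<close> is divided as \<open>(1 - \<delta>) t + \<delta> t\<close>.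
  With equal halves the constant in front of \<open>g\<close> would stay away from 1, and
  convergence of the norms could not be concluded.\<close>

lemma hom_norm_smooth_quasi_triangle:
  fixes f g :: "real ^ 'd::finite \<Rightarrow> 'b::euclidean_space"
  assumes "smooth f" "smooth g" and \<delta>: "0 < \<delta>" "\<delta> < 1"
  shows "hom_norm_smooth k p r f \<le> ennreal ((1 - \<delta>) powr - (1 / p)) * hom_norm_smooth k p r g +
    ennreal (\<delta> powr - (1 / p)) * hom_norm_smooth k p r (\<lambda>x. f x - g x)"
proof -
  let ?G = "\<lambda>f x. ennreal (grad_abs (\<lambda>\<alpha>. multi_deriv \<alpha> f) k x)"
  let ?d = "\<lambda>x. f x - g x"
  have m: "?G h \<in> borel_measurable lebesgue" if "smooth h" for h :: "real ^ 'd \<Rightarrow> 'b"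
    by (rule measurable_completion) (simp add: grad_abs_borel[OF that])
  have nonneg: "0 \<le> grad_abs D k x" for D :: "('d \<Rightarrow> nat) \<Rightarrow> real ^ 'd \<Rightarrow> 'b" and x
    by (simp add: grad_abs_def sum_nonneg)
  have "rearrangement UNIV (?G f) t \<le> rearrangement UNIV (?G g) ((1 - \<delta>) * t) + rearrangement UNIV (?G ?d) (\<delta> * t)"
    if t: "0 < t" for t
  proof -
    have "?G f x \<le> 1 * (?G g x + ?G ?d x)" for x
      using grad_abs_triangle[OF assms(1,2), of k x] nonneg by (simp add: ennreal_plus[symmetric] ennreal_leI del: ennreal_plus)
    then have "rearrangement UNIV (?G f) t \<le> 1 * rearrangement UNIV (\<lambda>x. ?G g x + ?G ?d x) t"
      using m[OF assms(2)] m[OF smooth_diff[OF assms(1,2)]] by (intro rearrangement_mono_AE borel_measurable_add) auto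
    also have "\<dots> = rearrangement UNIV (\<lambda>x. ?G g x + ?G ?d x) ((1 - \<delta>) * t + \<delta> * t)" by (simp add: algebra_simps)
    also have "\<dots> \<le> rearrangement UNIV (?G g) ((1 - \<delta>) * t) + rearrangement UNIV (?G ?d) (\<delta> * t)"
      using t \<delta> by (intro rearrangement_add_le m assms smooth_diff) auto
    finally show ?thesis .
  qed
  then have "lorentz_fun (1 / p) r (rearrangement UNIV (?G f)) \<le>
     lorentz_fun (1 / p) r (\<lambda>t. rearrangement UNIV (?G g) ((1 - \<delta>) * t) + rearrangement UNIV (?G ?d) (\<delta> * t))"
    by (rule lorentz_fun_mono)
  also have "\<dots> \<le> lorentz_fun (1 / p) r (\<lambda>t. rearrangement UNIV (?G g) ((1 - \<delta>) * t)) + lorentz_fun (1 / p) r (\<lambda>t. rearrangement UNIV (?G ?d) (\<delta> * t))"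
    by (rule lorentz_fun_add) measurable
  finally show ?thesis
    using \<delta> by (simp add: lorentz_fun_dilate hom_norm_smooth_def lorentz_norm_eq)
qed

text \<open>The sequence returned is the one that \<open>SOME\<close> selects in the definition of
  the norm, so the limit is taken along that very sequence.\<close>

lemma hom_sobolev_norm_limit:
  fixes f :: "real ^ 'd::finite \<Rightarrow> 'b::euclidean_space"
  assumes "f \<in> hom_sobolev k p r"
  obtains \<phi> where "hom_sobolev_rep k p r \<phi> f" "(\<lambda>n. hom_norm_smooth k p r (\<phi> n)) \<longlonglongrightarrow> hom_sobolev_norm k p r f"
proof -
  define \<phi> where "\<phi> = (SOME \<phi>. hom_sobolev_rep k p r \<phi> f)"
  have rep: "hom_sobolev_rep k p r \<phi> f"
  proof -
    have "\<exists>\<phi>. hom_sobolev_rep k p r \<phi> f" using assms by (simp add: hom_sobolev_def)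
    then show ?thesis unfolding \<phi>_def by (rule someI_ex)
  qed
  have sm: "smooth (\<phi> n)" for n using rep by (auto simp: hom_sobolev_rep_def intro: test_fun_smooth)
  have "(\<lambda>n. hom_norm_smooth k p r (\<phi> n)) \<longlonglongrightarrow> liminf (\<lambda>n. hom_norm_smooth k p r (\<phi> n))"
  proof (rule quasi_Cauchy_convergent[where e="1 / p"])
    fix \<delta> \<eta> :: real assume \<delta>: "0 < \<delta>" "\<delta> < 1" and \<eta>: "0 < \<eta>"
    obtain N where N: "\<And>m n. N \<le> m \<Longrightarrow> N \<le> n \<Longrightarrow> hom_norm_smooth k p r (\<lambda>x. \<phi> m x - \<phi> n x) < ennreal \<eta>"
    proof -
      have "0 < ennreal \<eta>" using \<eta> by simp
      moreover have "\<forall>e>0. \<exists>N. \<forall>m\<ge>N. \<forall>n\<ge>N. hom_norm_smooth k p r (\<lambda>x. \<phi> m x - \<phi> n x) < e"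
        using rep by (simp add: hom_sobolev_rep_def)
      ultimately obtain N where "\<forall>m\<ge>N. \<forall>n\<ge>N. hom_norm_smooth k p r (\<lambda>x. \<phi> m x - \<phi> n x) < ennreal \<eta>"
        by (elim allE impE) auto
      then show ?thesis by (intro that[of N]) auto
    qed
    show "\<exists>N. \<forall>m\<ge>N. \<forall>n\<ge>N. hom_norm_smooth k p r (\<phi> m) \<le>
        ennreal ((1 - \<delta>) powr - (1 / p)) * hom_norm_smooth k p r (\<phi> n) + ennreal (\<delta> powr - (1 / p)) * ennreal \<eta>"
    proof (intro exI[of _ N] allI impI)
      fix m n assume "N \<le> m" "N \<le> n"
      then show "hom_norm_smooth k p r (\<phi> m) \<le>
        ennreal ((1 - \<delta>) powr - (1 / p)) * hom_norm_smooth k p r (\<phi> n) + ennreal (\<delta> powr - (1 / p)) * ennreal \<eta>"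
        by (intro order_trans[OF hom_norm_smooth_quasi_triangle[OF sm[of m] sm[of n] \<delta>]]
            add_left_mono mult_left_mono less_imp_le[OF N]) auto
    qed
  qed
  then have "(\<lambda>n. hom_norm_smooth k p r (\<phi> n)) \<longlonglongrightarrow> hom_sobolev_norm k p r f"
    unfolding hom_sobolev_norm_def \<phi>_def[symmetric] by (simp add: limI)
  with rep show ?thesis by (rule that)
qed

text \<open>Elements of the completion are given as local \<open>L1\<close> limits, with no
  derivatives at hand. Hence the bound is proved for each \<open>\<phi> n\<close>, and the limit is
  taken on both sides: by lower semicontinuity for the sharp maximal function, its rearrangement and
  the functional on the left, and by convergence of the norms on the right.\<close>

lemma space_estimate:
  assumes k: "1 \<le> k" "k < CARD('d::finite)"
  shows "\<exists>C0>0. \<forall>\<epsilon> (f :: real ^ 'd \<Rightarrow> 'b::euclidean_space). 0 < \<epsilon> \<longrightarrow> \<epsilon> \<le> 1 / 2 \<longrightarrow> \<epsilon> * R \<le> real CARD('d) \<longrightarrow>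
     f \<in> hom_sobolev k (real CARD('d) / (real k + \<epsilon>)) r \<longrightarrow>
     lorentz_norm (real CARD('d) / \<epsilon>) r (sharp_max UNIV f) \<le>
     ennreal (C0 * \<epsilon> powr (- enn2real (1 / r))) * hom_sobolev_norm k (real CARD('d) / (real k + \<epsilon>)) r f"
proof -
  let ?D = "real CARD('d)"
  have d: "2 \<le> CARD('d)" using k by simp
  define N where "N = idx_const TYPE('d) k"
  have N: "1 \<le> N" unfolding N_def by (rule idx_const)
  define C where "C = (N * ?D ^ CARD('d)) ^ (k - 1)"
  have C: "0 < C" unfolding C_def using N by (intro zero_less_power mult_pos_pos) auto
  define P where "P = poincare_const TYPE('d) * frac_const TYPE('d)"
  have P: "0 < P" unfolding P_def by (intro mult_pos_pos poincare_const_pos frac_const_pos)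
  define C0 where "C0 = P * (main_const TYPE('d) k * (C * N))"
  have C0: "0 < C0" unfolding C0_def using N by (intro mult_pos_pos P C main_const_pos) auto
  show ?thesis
  proof (intro exI[of _ C0] conjI C0 allI impI)
    fix \<epsilon> :: real and f :: "real ^ 'd \<Rightarrow> 'b"
    let ?p = "?D / (real k + \<epsilon>)"
    let ?e = "(real k + \<epsilon>) / ?D"
    let ?u = "\<epsilon> powr (- enn2real (1 / r))"
    assume \<epsilon>: "0 < \<epsilon>" "\<epsilon> \<le> 1 / 2" "\<epsilon> * R \<le> ?D" and f: "f \<in> hom_sobolev k ?p r"
    obtain \<phi> where rep: "hom_sobolev_rep k ?p r \<phi> f"
      and lim: "(\<lambda>n. hom_norm_smooth k ?p r (\<phi> n)) \<longlonglongrightarrow> hom_sobolev_norm k ?p r f"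
      using hom_sobolev_norm_limit[OF f] by blast
    have tf: "\<phi> n \<in> test_fun UNIV" for n using rep by (simp add: hom_sobolev_rep_def)
    have sm: "smooth (\<phi> n)" for n by (rule test_fun_smooth[OF tf])
    define G where "G n = grad_sum (\<lambda>\<alpha>. multi_deriv \<alpha> (\<phi> n))" for n
    have Gm [measurable]: "G n m \<in> borel_measurable borel" for n m
      unfolding G_def by (rule grad_sum_borel[OF smooth_deriv_system[OF sm, of m]]) simp
    let ?s = "\<lambda>n. fracmax_bound ?D (rearrangement UNIV (G n 1))"
    have sb [measurable]: "?s n \<in> borel_measurable borel" for n
      unfolding fracmax_bound_def[abs_def] tail_sum_def by measurable
    have sharp: "sharp_max UNIV (\<phi> n) x \<le> ennreal (poincare_const TYPE('d)) * frac_max (G n 1) x" for n x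
    proof -
      have "sharp_max UNIV (\<phi> n) x \<le> ennreal (poincare_const TYPE('d)) * frac_max (\<lambda>y. grad_sum (\<lambda>\<alpha>. multi_deriv \<alpha> (\<phi> n)) 1 y * indicator UNIV y) x"
      proof (rule sharp_max_le_frac_max[OF smooth_deriv_system[OF sm, of k] k(1) _ d])
        show "AE x in lebesgue. x \<in> UNIV \<longrightarrow> \<phi> n x = multi_deriv (\<lambda>_. 0) (\<phi> n) x"
          by (simp add: multi_deriv_zero)
        fix Q :: "(real ^ 'd) set" assume "is_cube Q"
        then have "compact Q" by (auto simp: is_cube_def)
        then have "set_integrable lebesgue Q (\<phi> n)"
          using smooth_locally_integrable[OF sm] by (simp add: locally_integrable_def)
        then show "set_borel_measurable lebesgue Q (\<phi> n)"
          unfolding set_integrable_def set_borel_measurable_def by (rule borel_measurable_integrable)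
      qed auto
      then show ?thesis by (simp add: G_def)
    qed
    \<comment> \<open>The form required by \<open>rearrangement_liminf_le\<close>; the exceptional
      set may change with \<open>n\<close> and \<open>t\<close>.\<close>
    have outer: "\<exists>B\<in>sets lebesgue. emeasure lebesgue B \<le> ennreal t \<and>
        (\<forall>x\<in>UNIV. x \<notin> B \<longrightarrow> sharp_max UNIV (\<phi> n) x \<le> ennreal P * ?s n t)" if t: "0 < t" for n t
    proof -
      obtain B where B: "B \<in> sets lebesgue" "emeasure lebesgue B \<le> ennreal t"
        "\<And>x. x \<notin> B \<Longrightarrow> frac_max (G n 1) x \<le> ennreal (frac_const TYPE('d)) * ?s n t"
        using frac_max_outer_bound[OF Gm t d] by blast
      have "sharp_max UNIV (\<phi> n) x \<le> ennreal P * ?s n t" if "x \<notin> B" for x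
      proof -
        have "sharp_max UNIV (\<phi> n) x \<le> ennreal (poincare_const TYPE('d)) * (ennreal (frac_const TYPE('d)) * ?s n t)"
          by (intro order_trans[OF sharp] mult_left_mono B(3) that) auto
        then show ?thesis
          using poincare_const_pos[where ?'d='d] by (simp add: P_def ennreal_mult' mult.assoc)
      qed
      with B show ?thesis by blast
    qed
    have bound: "lorentz_fun (\<epsilon> / ?D) r (\<lambda>t. ennreal P * ?s n t) \<le> ennreal (C0 * ?u) * hom_norm_smooth k ?p r (\<phi> n)" for n
    proof -
      have it: "AE x in lebesgue. G n 1 x \<le> ennreal C * (riesz ^^ (k - 1)) (G n k) x"
        using grad_sum_test_fun_iterate[OF tf, of 1 "k - 1" k n] k
        unfolding G_def C_def N_def by (intro AE_completion) simp
      have "lorentz_fun (\<epsilon> / ?D) r (\<lambda>t. ennreal P * ?s n t) = ennreal P * lorentz_fun (\<epsilon> / ?D) r (?s n)"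
        by (rule lorentz_fun_cmult) measurable
      also have "\<dots> \<le> ennreal P * (ennreal (main_const TYPE('d) k * ?u) * (ennreal C * lorentz_fun ?e r (rearrangement UNIV (G n k))))"
        by (intro mult_left_mono lorentz_fun_fracmax_iterated_riesz[OF Gm Gm k \<epsilon> it]) auto
      also have "lorentz_fun ?e r (rearrangement UNIV (G n k)) \<le> ennreal N * hom_norm_smooth k ?p r (\<phi> n)"
      proof -
        have "G n k x \<le> ennreal N * ennreal (grad_abs (\<lambda>\<alpha>. multi_deriv \<alpha> (\<phi> n)) k x)" for x
        proof -
          have "G n k x \<le> (\<Sum>\<alpha>\<in>(midx k :: ('d \<Rightarrow> nat) set). ennreal (grad_abs (\<lambda>\<alpha>. multi_deriv \<alpha> (\<phi> n)) k x))"
            unfolding G_def grad_sum_def by (intro sum_mono ennreal_leI norm_le_grad_abs[where D="\<lambda>\<alpha>. multi_deriv \<alpha> (\<phi> n)"])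
          also have "\<dots> = ennreal (real (card (midx k :: ('d \<Rightarrow> nat) set))) * ennreal (grad_abs (\<lambda>\<alpha>. multi_deriv \<alpha> (\<phi> n)) k x)"
            by (simp add: ennreal_of_nat_eq_real_of_nat)
          also have "\<dots> \<le> ennreal N * ennreal (grad_abs (\<lambda>\<alpha>. multi_deriv \<alpha> (\<phi> n)) k x)"
            unfolding N_def by (intro mult_right_mono ennreal_leI idx_const) auto
          finally show ?thesis .
        qed
        then have "lorentz_fun ?e r (rearrangement UNIV (G n k)) \<le> ennreal N * lorentz_fun ?e r (rearrangement UNIV (\<lambda>x. ennreal (grad_abs (\<lambda>\<alpha>. multi_deriv \<alpha> (\<phi> n)) k x)))"
          by (intro lorentz_fun_rearrangement_mono_AE grad_abs_borel sm AE_I2 impI)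
        then show ?thesis by (simp add: hom_norm_smooth_def lorentz_norm_eq)
      qed
      finally have "lorentz_fun (\<epsilon> / ?D) r (\<lambda>t. ennreal P * ?s n t) \<le>
         ennreal P * (ennreal (main_const TYPE('d) k * ?u) * (ennreal C * (ennreal N * hom_norm_smooth k ?p r (\<phi> n))))"
        by (simp add: mult_left_mono)
      also have "\<dots> = ennreal (P * (main_const TYPE('d) k * ?u * (C * N))) * hom_norm_smooth k ?p r (\<phi> n)"
        using P C N main_const_pos[where ?'d='d and k=k] by (simp add: ennreal_mult mult.assoc)
      also have "P * (main_const TYPE('d) k * ?u * (C * N)) = C0 * ?u" by (simp add: C0_def)
      finally show ?thesis .
    qed
    have "lorentz_norm (?D / \<epsilon>) r (sharp_max UNIV f) = lorentz_fun (\<epsilon> / ?D) r (rearrangement UNIV (sharp_max UNIV f))"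
      by (simp add: lorentz_norm_eq)
    also have "\<dots> \<le> lorentz_fun (\<epsilon> / ?D) r (\<lambda>t. liminf (\<lambda>n. ennreal P * ?s n t))"
    proof (rule lorentz_fun_mono)
      fix t :: real assume t: "0 < t"
      have li: "sharp_max UNIV f x \<le> liminf (\<lambda>n. sharp_max UNIV (\<phi> n) x)" for x
        using rep by (intro sharp_max_liminf[OF _ smooth_locally_integrable[OF sm]]) (auto simp: hom_sobolev_rep_def)
      show "rearrangement UNIV (sharp_max UNIV f) t \<le> liminf (\<lambda>n. ennreal P * ?s n t)"
        by (rule rearrangement_liminf_le[where h="\<lambda>n. sharp_max UNIV (\<phi> n)", OF outer[OF t] li])
    qed
    also have "\<dots> \<le> liminf (\<lambda>n. lorentz_fun (\<epsilon> / ?D) r (\<lambda>t. ennreal P * ?s n t))"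
      by (rule lorentz_fun_liminf) measurable
    also have "\<dots> \<le> liminf (\<lambda>n. ennreal (C0 * ?u) * hom_norm_smooth k ?p r (\<phi> n))"
      by (intro Liminf_mono always_eventually allI bound)
    also have "\<dots> = ennreal (C0 * ?u) * hom_sobolev_norm k ?p r f"
      by (intro lim_imp_Liminf ennreal_tendsto_cmult lim) auto
    finally show "lorentz_norm (?D / \<epsilon>) r (sharp_max UNIV f) \<le> ennreal (C0 * ?u) * hom_sobolev_norm k ?p r f" .
  qed
qed

end

theorem corollary3p9:
  fixes r :: ennreal and k :: nat and Q0 :: "(real ^ 'd::finite) set"
  assumes "1 \<le> r" and "1 \<le> k" and "k < CARD('d)" and "is_cube Q0"
  shows "\<exists>C0>0. \<exists>C1>0. \<forall>\<^sub>F \<epsilon> in at_right (0::real).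
    (\<forall>f :: real ^ 'd \<Rightarrow> 'b::{real_normed_field, euclidean_space}.
       f \<in> hom_sobolev k (real CARD('d) / (real k + \<epsilon>)) r \<longrightarrow>
       lorentz_norm (real CARD('d) / \<epsilon>) r (sharp_max UNIV f)
         \<le> ennreal (C0 * \<epsilon> powr (- enn2real (1 / r)))
            * hom_sobolev_norm k (real CARD('d) / (real k + \<epsilon>)) r f) \<and>
    (\<forall>f :: real ^ 'd \<Rightarrow> 'b.
       f \<in> sobolev_cube Q0 k (real CARD('d) / (real k + \<epsilon>)) r \<longrightarrow>
       lorentz_norm_cube Q0 (real CARD('d) / \<epsilon>) r (sharp_max Q0 f)
         \<le> ennreal (C1 * \<epsilon> powr (- enn2real (1 / r)))
            * sobolev_cube_norm Q0 k (real CARD('d) / (real k + \<epsilon>)) r f)"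
proof -
  interpret lorentz_exponent r by (unfold_locales) (rule assms(1))
  obtain C0 where C0: "0 < C0" "\<And>\<epsilon> (f :: real ^ 'd \<Rightarrow> 'b). 0 < \<epsilon> \<Longrightarrow> \<epsilon> \<le> 1 / 2 \<Longrightarrow> \<epsilon> * R \<le> real CARD('d) \<Longrightarrow>
     f \<in> hom_sobolev k (real CARD('d) / (real k + \<epsilon>)) r \<Longrightarrow>
     lorentz_norm (real CARD('d) / \<epsilon>) r (sharp_max UNIV f) \<le>
     ennreal (C0 * \<epsilon> powr (- enn2real (1 / r))) * hom_sobolev_norm k (real CARD('d) / (real k + \<epsilon>)) r f"
    using space_estimate[OF assms(2,3), where ?'b='b] by blast
  obtain C1 where C1: "0 < C1" "\<And>\<epsilon> (f :: real ^ 'd \<Rightarrow> 'b). 0 < \<epsilon> \<Longrightarrow> \<epsilon> \<le> 1 / 2 \<Longrightarrow> \<epsilon> * R \<le> real CARD('d) \<Longrightarrow>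
     weakly_differentiable (interior Q0) k f \<Longrightarrow>
     lorentz_norm_cube Q0 (real CARD('d) / \<epsilon>) r (sharp_max Q0 f) \<le>
     ennreal (C1 * \<epsilon> powr (- enn2real (1 / r))) * sobolev_cube_norm Q0 k (real CARD('d) / (real k + \<epsilon>)) r f"
    using cube_estimate[OF assms(2,3,4), where ?'b='b] by blast
  \<comment> \<open>\<open>1 / 2\<close> secures the exponents, the second entry
    \<open>epsilon R <= d\<close>. The denominator is \<open>R + 1\<close> because \<open>R\<close>
    is the default value 0 when \<open>r\<close> is infinite.\<close>
  define b where "b = min (1 / 2) (real CARD('d) / (R + 1))"
  have R0: "0 \<le> R" by simp
  have b: "0 < b" using R0 by (simp add: b_def add_nonneg_pos)
  have small: "\<epsilon> \<le> 1 / 2" "\<epsilon> * R \<le> real CARD('d)" if "0 < \<epsilon>" "\<epsilon> < b" for \<epsilon>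
  proof -
    show "\<epsilon> \<le> 1 / 2" using that by (simp add: b_def)
    have "\<epsilon> * R \<le> \<epsilon> * (R + 1)" using that by (intro mult_left_mono) auto
    also have "\<dots> \<le> real CARD('d)"
      using that R0 by (simp add: b_def pos_less_divide_eq less_imp_le add_nonneg_pos)
    finally show "\<epsilon> * R \<le> real CARD('d)" .
  qed
  have "\<forall>\<^sub>F \<epsilon> in at_right (0::real). 0 < \<epsilon> \<and> \<epsilon> < b"
    using b by (auto simp: eventually_at_right_field)
  then show ?thesis
    by (intro exI[of _ C0] exI[of _ C1] conjI C0(1) C1(1), eventually_elim)
      (auto intro!: C0(2) C1(2) small simp: sobolev_cube_def)
qed

end
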